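(* Let $(H,\mathcal R)$ be a quasitriangular $*$-Hopf algebra over $\mathbb C$ with $\mathcal R^{*\otimes *}=\mathcal R^{-1}$. Let $BH$ be the transmutation of $H$, a Hopf algebra in the braided category ${}_H\mathcal M$ of left $H$-modules, and define $\star:BH\to\overline{BH}$ by $b\mapsto\overline{b^*}$ (using the star operation of $H$). Then $BH$ is a braided $*$-Hopf algebra in ${}_H\mathcal M$.
   Context: A $*$-Hopf algebra is a Hopf algebra $H$ over $\mathbb C$ (coproduct $\Delta h=h_{(1)}\otimes h_{(2)}$, counit $\epsilon$, antipode $S$) that is a $*$-algebra (antilinear, order-reversing involution) with $\Delta\circ *=( *\otimes * )\circ\Delta$ (then $S$ is invertible and $(Sh)^*=S^{-1}(h^* )$). Quasitriangular means there is an invertible $\mathcal R=\mathcal R^{(1)}\otimes\mathcal R^{(2)}\in H\otimes H$ with $(\Delta\otimes\mathrm{id})\mathcal R=\mathcal R_{13}\mathcal R_{23}$, $(\mathrm{id}\otimes\Delta)\mathcal R=\mathcal R_{13}\mathcal R_{12}$, $\tau\circ\Delta=\mathcal R(\Delta\ )\mathcal R^{-1}$, $\tau$ the transposition. ${}_H\mathcal M$ (tensor product via $\Delta$, trivial associator) is a bar category: for a module $V$, $\overline V$ is the conjugate vector space (same abelian group, elements written $\overline v$, $\lambda\overline v=\overline{\overline\lambda v}$) with $h\triangleright\overline v=\overline{S^{-1}(h^* )\triangleright v}$; $\overline\theta(\overline v)=\overline{\theta(v)}$; $\mathrm{bb}_V(v)=\overline{\overline v}$; $\Upsilon_{V,W}(\overline{v\otimes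 w})=\overline w\otimes\overline v$; $\star:\mathbb C\to\overline{\mathbb C}$ is complex conjugation. It is braided by $\Psi_{V,W}(v\otimes w)=\mathcal R^{(2)}\triangleright w\otimes\mathcal R^{(1)}\triangleright v$. The transmutation $BH$ is $H$ as a left $H$-module under the left adjoint action $h\triangleright b=h_{(1)}\,b\,S(h_{(2)})$, with the same algebra, unit and counit as $H$, and braided coproduct and antipode $$\underline\Delta b=b_{(1)}S(\mathcal R^{(2)})\otimes\mathcal R^{(1)}\triangleright b_{(2)},\qquad \underline S(b)=\mathcal R^{(2)}S(\mathcal R^{(1)}\triangleright b).$$ A braided $*$-Hopf algebra $B$ in a braided bar category with antireal braiding (i.e. $\Upsilon^{-1}_{X,Y}\Psi_{\overline X,\overline Y}=\overline{\Psi_{X,Y}^{-1}}\,\Upsilon^{-1}_{Y,X}$) is a Hopf algebra in the braided category (product $\mu$, unit $\eta$, coproduct $\underline\Delta$ multiplicative for the braided tensor product algebra, counit, antipode, all morphisms) with a morphism $\star_B:B\to\overline B$ such that $\overline{\star_B}\star_B=\mathrm{bb}_B$, $\overline\mu\,\Upsilon^{-1}_{B,B}(\star_B\otimes\star_B)=\star_B\mu$, $\overline\eta\,\star=\star_B\eta$, and $\overline{\underline\Delta}\,\star_B=\overline{\Psi_{B,B}}\,\Upsilon^{-1}_{B,B}(\star_B\otimes\star_B)\underline\Delta$. *)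

theory Defs
  imports Complex_Main "HOL-Library.Poly_Mapping"
begin

section \<open>Complex vector spaces and algebras\<close>

class complex_vector = ab_group_add +
  fixes scaleC :: "complex \<Rightarrow> 'a \<Rightarrow> 'a"  (infixr \<open>*\<^sub>C\<close> 75)
  assumes scaleC_add_right: "c *\<^sub>C (x + y) = c *\<^sub>C x + c *\<^sub>C y"
    and scaleC_add_left: "(c + d) *\<^sub>C x = c *\<^sub>C x + d *\<^sub>C x"
    and scaleC_scaleC [simp]: "c *\<^sub>C (d *\<^sub>C x) = (c * d) *\<^sub>C x"
    and scaleC_one [simp]: "1 *\<^sub>C x = x"

text \<open>
  The requirement 0 \<open>\<noteq>\<close> 1 inherited from \<^class>\<open>ring_1\<close> is no restriction for Hopf algebras:
  the counit sends the unit to 1.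
\<close>

class complex_algebra_1 = complex_vector + ring_1 +
  assumes mult_scaleC_left [simp]: "(c *\<^sub>C x) * y = c *\<^sub>C (x * y)"
    and mult_scaleC_right [simp]: "x * (c *\<^sub>C y) = c *\<^sub>C (x * y)"

interpretation complex_vector: vector_space "scaleC :: complex \<Rightarrow> 'a \<Rightarrow> 'a::complex_vector"
  by standard (simp_all add: scaleC_add_right scaleC_add_left)

lemmas scaleC_zero_left [simp] = complex_vector.scale_zero_left
lemmas scaleC_zero_right [simp] = complex_vector.scale_zero_right
lemmas scaleC_minus_left [simp] = complex_vector.scale_minus_left
lemmas scaleC_minus_right [simp] = complex_vector.scale_minus_right

instantiation complex :: complex_algebra_1
begin
definition scaleC_complex :: "complex \<Rightarrow> complex \<Rightarrow> complex" where
  [simp]: "scaleC_complex c z = c * z"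
instance by standard (simp_all add: algebra_simps)
end

abbreviation clinear :: "('a::complex_vector \<Rightarrow> 'b::complex_vector) \<Rightarrow> bool" where
  "clinear \<equiv> Vector_Spaces.linear scaleC scaleC"

lemma clinear_iff:
  "clinear f \<longleftrightarrow> (\<forall>x y. f (x + y) = f x + f y) \<and> (\<forall>c x. f (c *\<^sub>C x) = c *\<^sub>C f x)"
  by (auto simp: Vector_Spaces.linear_def module_hom_def module_hom_axioms_def
      complex_vector.module_axioms complex_vector.vector_space_axioms)

definition antilinear :: "('a::complex_vector \<Rightarrow> 'b::complex_vector) \<Rightarrow> bool" where
  "antilinear f \<longleftrightarrow> (\<forall>x y. f (x + y) = f x + f y) \<and> (\<forall>c x. f (c *\<^sub>C x) = cnj c *\<^sub>C f x)"


section \<open>The conjugate of a complex vector space\<close>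

datatype 'a conjugate = bar (unbar: 'a)
  for map: bar_map

text \<open>
  On morphisms, \<^const>\<open>bar_map\<close> is the functor sending \<open>\<theta>\<close> to the map
  \<open>bar v \<mapsto> bar (\<theta> v)\<close>.
\<close>

lemma unbar_inject: "unbar x = unbar y \<longleftrightarrow> x = y"
  by (cases x; cases y) simp

instantiation conjugate :: (complex_vector) complex_vector
begin
definition zero_conjugate :: "'a conjugate" where
  "0 = bar 0"
definition plus_conjugate :: "'a conjugate \<Rightarrow> 'a conjugate \<Rightarrow> 'a conjugate" where
  "x + y = bar (unbar x + unbar y)"
definition uminus_conjugate :: "'a conjugate \<Rightarrow> 'a conjugate" where
  "- x = bar (- unbar x)"
definition minus_conjugate :: "'a conjugate \<Rightarrow> 'a conjugate \<Rightarrow> 'a conjugate" where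
  "x - y = bar (unbar x - unbar y)"
definition scaleC_conjugate :: "complex \<Rightarrow> 'a conjugate \<Rightarrow> 'a conjugate" where
  "c *\<^sub>C x = bar (cnj c *\<^sub>C unbar x)"
instance
  by standard
    (simp_all add: zero_conjugate_def plus_conjugate_def uminus_conjugate_def
      minus_conjugate_def scaleC_conjugate_def scaleC_add_right scaleC_add_left algebra_simps)
end

lemma unbar_simps [simp]:
  "unbar 0 = 0" "unbar (x + y) = unbar x + unbar y" "unbar (- x) = - unbar x"
  "unbar (x - y) = unbar x - unbar y" "unbar (c *\<^sub>C x) = cnj c *\<^sub>C unbar x"
  by (simp_all add: zero_conjugate_def plus_conjugate_def uminus_conjugate_def
      minus_conjugate_def scaleC_conjugate_def)

lemma bar_simps:
  "bar 0 = 0" "bar (x + y) = bar x + bar y" "bar (- x) = - bar x"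
  "bar (x - y) = bar x - bar y" "bar (c *\<^sub>C x) = cnj c *\<^sub>C bar x"
  by (simp_all flip: unbar_inject)


section \<open>The algebraic tensor product over the complex numbers\<close>

type_synonym ('a, 'b) free_pairs = "('a \<times> 'b) \<Rightarrow>\<^sub>0 complex"

definition free_scale :: "complex \<Rightarrow> ('a, 'b) free_pairs \<Rightarrow> ('a, 'b) free_pairs" where
  "free_scale c p = Poly_Mapping.map ((*) c) p"

lemma lookup_free_scale [simp]:
  "Poly_Mapping.lookup (free_scale c p) k = c * Poly_Mapping.lookup p k"
  by (simp add: free_scale_def Poly_Mapping.map.rep_eq when_def)

interpretation free: vector_space free_scale
  by standard (simp_all add: poly_mapping_eq_iff fun_eq_iff lookup_add algebra_simps)

definition free_gen :: "'a \<Rightarrow> 'b \<Rightarrow> ('a, 'b) free_pairs" where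
  "free_gen a b = Poly_Mapping.single (a, b) 1"

definition tensor_relators :: "('a::complex_vector, 'b::complex_vector) free_pairs set" where
  "tensor_relators =
     {free_gen (a + a') b - free_gen a b - free_gen a' b | a a' b. True} \<union>
     {free_gen a (b + b') - free_gen a b - free_gen a b' | a b b'. True} \<union>
     {free_gen (c *\<^sub>C a) b - free_scale c (free_gen a b) | c a b. True} \<union>
     {free_gen a (c *\<^sub>C b) - free_scale c (free_gen a b) | c a b. True}"

definition tensor_eq ::
  "('a::complex_vector, 'b::complex_vector) free_pairs \<Rightarrow> ('a, 'b) free_pairs \<Rightarrow> bool" where
  "tensor_eq p q \<longleftrightarrow> p - q \<in> free.span tensor_relators"

quotient_type (overloaded) ('a, 'b) tensor  (infixr \<open>\<otimes>\<close> 75) =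
  "('a::complex_vector, 'b::complex_vector) free_pairs" / tensor_eq
proof (rule equivpI)
  show "reflp tensor_eq"
    by (simp add: reflp_def tensor_eq_def free.span_zero)
  show "symp tensor_eq"
    unfolding symp_def tensor_eq_def using free.span_neg by fastforce
  show "transp tensor_eq"
  proof (rule transpI)
    fix p q r
    assume "tensor_eq p q" "tensor_eq q r"
    then have "(p - q) + (q - r) \<in> free.span tensor_relators"
      unfolding tensor_eq_def by (rule free.span_add)
    then show "tensor_eq p r" by (simp add: tensor_eq_def)
  qed
qed

lift_definition pure_tensor :: "'a::complex_vector \<Rightarrow> 'b::complex_vector \<Rightarrow> 'a \<otimes> 'b"
  (infixr \<open>\<otimes>\<close> 75) is free_gen .

instantiation tensor :: (complex_vector, complex_vector) complex_vector
begin

lift_definition zero_tensor :: "'a \<otimes> 'b" is 0 .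

lift_definition plus_tensor :: "'a \<otimes> 'b \<Rightarrow> 'a \<otimes> 'b \<Rightarrow> 'a \<otimes> 'b" is "(+)"
  unfolding tensor_eq_def by (metis add_diff_add free.span_add)

lift_definition uminus_tensor :: "'a \<otimes> 'b \<Rightarrow> 'a \<otimes> 'b" is uminus
  unfolding tensor_eq_def by (metis free.span_neg minus_diff_minus)

lift_definition minus_tensor :: "'a \<otimes> 'b \<Rightarrow> 'a \<otimes> 'b \<Rightarrow> 'a \<otimes> 'b" is "(-)"
proof -
  fix p p' q q' :: "('a, 'b) free_pairs"
  assume "tensor_eq p p'" "tensor_eq q q'"
  then have "(p - p') - (q - q') \<in> free.span tensor_relators"
    unfolding tensor_eq_def by (rule free.span_diff)
  then show "tensor_eq (p - q) (p' - q')"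
    unfolding tensor_eq_def by (simp add: algebra_simps)
qed

lift_definition scaleC_tensor :: "complex \<Rightarrow> 'a \<otimes> 'b \<Rightarrow> 'a \<otimes> 'b" is free_scale
  unfolding tensor_eq_def by (metis free.scale_right_diff_distrib free.span_scale)

instance
proof
  fix x y z :: "'a \<otimes> 'b" and c d :: complex
  have eqI: "tensor_eq p q" if "p = q" for p q :: "('a, 'b) free_pairs"
    using that by (simp add: tensor_eq_def free.span_zero)
  show "x + y + z = x + (y + z)" by transfer (rule eqI, simp add: algebra_simps)
  show "x + y = y + x" by transfer (rule eqI, simp add: algebra_simps)
  show "0 + x = x" by transfer (rule eqI, simp)
  show "- x + x = 0" by transfer (rule eqI, simp)
  show "x - y = x + - y" by transfer (rule eqI, simp)
  show "c *\<^sub>C (x + y) = c *\<^sub>C x + c *\<^sub>C y"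
    by transfer (rule eqI, simp add: free.scale_right_distrib)
  show "(c + d) *\<^sub>C x = c *\<^sub>C x + d *\<^sub>C x"
    by transfer (rule eqI, simp add: free.scale_left_distrib)
  show "c *\<^sub>C d *\<^sub>C x = (c * d) *\<^sub>C x"
    by transfer (rule eqI, simp)
  show "1 *\<^sub>C x = x"
    by transfer (rule eqI, simp)
qed

end

lemma pure_tensor_add_left: "(a + a') \<otimes> b = a \<otimes> b + a' \<otimes> b"
proof transfer
  fix a a' :: 'a and b :: 'b
  have "free_gen (a + a') b - free_gen a b - free_gen a' b \<in> tensor_relators"
    unfolding tensor_relators_def by blast
  then show "tensor_eq (free_gen (a + a') b) (free_gen a b + free_gen a' b)"
    unfolding tensor_eq_def diff_diff_eq by (rule free.span_base)
qed

lemma pure_tensor_add_right: "a \<otimes> (b + b') = a \<otimes> b + a \<otimes> b'"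
proof transfer
  fix a :: 'a and b b' :: 'b
  have "free_gen a (b + b') - free_gen a b - free_gen a b' \<in> tensor_relators"
    unfolding tensor_relators_def by blast
  then show "tensor_eq (free_gen a (b + b')) (free_gen a b + free_gen a b')"
    unfolding tensor_eq_def diff_diff_eq by (rule free.span_base)
qed

lemma pure_tensor_scaleC_left: "(c *\<^sub>C a) \<otimes> b = c *\<^sub>C (a \<otimes> b)"
  by transfer (unfold tensor_eq_def, rule free.span_base, unfold tensor_relators_def, blast)

lemma pure_tensor_scaleC_right: "a \<otimes> (c *\<^sub>C b) = c *\<^sub>C (a \<otimes> b)"
  by transfer (unfold tensor_eq_def, rule free.span_base, unfold tensor_relators_def, blast)

lemma pure_tensor_zero_left [simp]: "0 \<otimes> b = 0"
  using pure_tensor_scaleC_left[of 0 0 b] by simp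

lemma pure_tensor_zero_right [simp]: "a \<otimes> 0 = 0"
  using pure_tensor_scaleC_right[of a 0 0] by simp

lemma free_pairs_induct [case_names zero gen add]:
  assumes "P 0"
    and "\<And>c a b. P (free_scale c (free_gen a b))"
    and "\<And>p q. P p \<Longrightarrow> P q \<Longrightarrow> P (p + q)"
  shows "P p"
proof (induction p rule: update_induct)
  case (update p k v)
  have "Poly_Mapping.update k v p = free_scale v (free_gen (fst k) (snd k)) + p"
    using update.hyps
    by (auto simp: poly_mapping_eq_iff fun_eq_iff free_gen_def lookup_single lookup_add
        lookup_update when_def in_keys_iff)
  with assms update.IH show ?case by metis
qed (rule assms(1))

lemma tensor_induct [case_names pure add, induct type: tensor]:
  fixes t :: "'a::complex_vector \<otimes> 'b::complex_vector"
  assumes pure: "\<And>a b. P (a \<otimes> b)" and add: "\<And>x y. P x \<Longrightarrow> P y \<Longrightarrow> P (x + y)"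
  shows "P t"
proof (induction t rule: tensor.abs_induct)
  case (1 p)
  show ?case
  proof (induction p rule: free_pairs_induct)
    case zero
    have "abs_tensor 0 = (0 :: 'a \<otimes> 'b)" by (simp add: zero_tensor_def)
    with pure[of 0 0] show ?case by simp
  next
    case (gen c a b)
    have "abs_tensor (free_scale c (free_gen a b)) = c *\<^sub>C (a \<otimes> b)"
      by (simp add: scaleC_tensor.abs_eq pure_tensor.abs_eq)
    also have "\<dots> = (c *\<^sub>C a) \<otimes> b" by (simp add: pure_tensor_scaleC_left)
    finally show ?case using pure by simp
  next
    case (add p q)
    then show ?case using assms(2) by (metis plus_tensor.abs_eq)
  qed
qed

text \<open>
  A biadditive balanced map extends uniquely along \<open>(a, b) \<mapsto> a \<otimes> b\<close> to an additive map, since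
  pure tensors generate the tensor product as an abelian group.  Only additivity is imposed, so that
  the same operator extends bilinear maps to linear maps and, for instance,
  \<open>(a, b) \<mapsto> a\<^sup>* \<otimes> b\<^sup>*\<close> to an antilinear map.
\<close>

definition balanced ::
  "('a::complex_vector \<Rightarrow> 'b::complex_vector \<Rightarrow> 'c::ab_group_add) \<Rightarrow> bool" where
  "balanced f \<longleftrightarrow>
     (\<forall>a a' b. f (a + a') b = f a b + f a' b) \<and>
     (\<forall>a b b'. f a (b + b') = f a b + f a b') \<and>
     (\<forall>c a b. f (c *\<^sub>C a) b = f a (c *\<^sub>C b))"

definition tensor_lift ::
  "('a::complex_vector \<Rightarrow> 'b::complex_vector \<Rightarrow> 'c::ab_group_add) \<Rightarrow> 'a \<otimes> 'b \<Rightarrow> 'c" where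
  "tensor_lift f = (THE g. additive g \<and> (\<forall>a b. g (a \<otimes> b) = f a b))"

lemma additive_tensor_eqI:
  assumes "additive g" "additive h" "\<And>a b. g (a \<otimes> b) = h (a \<otimes> b)"
  shows "g = h"
proof
  fix t show "g t = h t"
    by (induction t) (simp_all add: assms(3) additive.add[OF assms(1)] additive.add[OF assms(2)])
qed

lemma tensor_lift_ex:
  assumes "balanced (f :: 'a::complex_vector \<Rightarrow> 'b::complex_vector \<Rightarrow> 'c::ab_group_add)"
  shows "\<exists>g. additive g \<and> (\<forall>a b. g (a \<otimes> b) = f a b)"
proof -
  have f_add1: "f (a + a') b = f a b + f a' b" and f_add2: "f a (b + b') = f a b + f a b'"
    and f_bal: "f a (c *\<^sub>C b) = f (c *\<^sub>C a) b" for a a' b b' c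
    using assms by (auto simp: balanced_def)
  have f0: "f 0 b = 0" for b using f_add1[of 0 0 b] by simp
  define F :: "('a, 'b) free_pairs \<Rightarrow> 'c" where
    "F p = Sum_any (\<lambda>k. f (Poly_Mapping.lookup p k *\<^sub>C fst k) (snd k))" for p
  have fin: "finite {k. f (Poly_Mapping.lookup p k *\<^sub>C fst k) (snd k) \<noteq> 0}"
    for p :: "('a, 'b) free_pairs"
    by (rule finite_subset[OF _ finite_lookup[of p]]) (auto simp: f0)
  have F_add: "F (p + q) = F p + F q" for p q
    unfolding F_def
    by (simp add: lookup_add scaleC_add_left f_add1 Sum_any.distrib fin)
  interpret F: additive F by standard (rule F_add)
  have F_gen: "F (free_scale c (free_gen a b)) = f (c *\<^sub>C a) b" for c a b
  proof -
    have "F (free_scale c (free_gen a b)) = Sum_any (\<lambda>k. if k = (a, b) then f (c *\<^sub>C a) b else 0)"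
      unfolding F_def
      by (rule arg_cong[of _ _ Sum_any])
        (auto simp: fun_eq_iff free_gen_def lookup_single when_def f0)
    then show ?thesis by simp
  qed
  have F_gen1: "F (free_gen a b) = f a b" for a b
    using F_gen[of 1 a b] by simp
  have F_rel: "F (free_scale c r) = 0" if "r \<in> tensor_relators" for c r
    using that unfolding tensor_relators_def
    by (auto simp: free.scale_right_diff_distrib F.diff F_gen scaleC_add_right f_add1 f_add2
        f_bal mult.commute)
  have F_span: "F r = 0" if "r \<in> free.span tensor_relators" for r
    using that
    by (induction rule: free.span_induct_alt) (auto simp: F.zero F_add F_rel)
  have F_eq: "F p = F q" if "tensor_eq p q" for p q
    using F_span[of "p - q"] that by (simp add: tensor_eq_def F.diff)
  define g where "g t = F (rep_tensor t)" for t :: "'a \<otimes> 'b"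
  have g_abs: "g (abs_tensor p) = F p" for p
    unfolding g_def
    by (rule F_eq) (meson Quotient3_tensor rep_abs_rsp_left tensor_equivp equivp_reflp)
  have "additive g"
  proof
    fix x y show "g (x + y) = g x + g y"
      by (induction x rule: tensor.abs_induct; induction y rule: tensor.abs_induct)
        (simp add: plus_tensor.abs_eq g_abs F_add)
  qed
  moreover have "g (a \<otimes> b) = f a b" for a b
    by (simp add: pure_tensor.abs_eq g_abs F_gen1)
  ultimately show ?thesis by blast
qed

lemma tensor_lift:
  assumes "balanced f"
  shows tensor_lift_additive: "additive (tensor_lift f)"
    and tensor_lift_pure: "tensor_lift f (a \<otimes> b) = f a b"
proof -
  have "\<exists>!g. additive g \<and> (\<forall>a b. g (a \<otimes> b) = f a b)"
    using tensor_lift_ex[OF assms] additive_tensor_eqI by (metis (no_types, lifting))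
  from theI'[OF this] show "additive (tensor_lift f)" "tensor_lift f (a \<otimes> b) = f a b"
    unfolding tensor_lift_def by auto
qed

lemma tensor_lift_add: "balanced f \<Longrightarrow> tensor_lift f (x + y) = tensor_lift f x + tensor_lift f y"
  by (simp add: additive.add tensor_lift_additive)

lemma tensor_lift_scaleC:
  assumes "balanced f" "\<And>a b. f (c *\<^sub>C a) b = d *\<^sub>C f a b"
  shows "tensor_lift f (c *\<^sub>C t) = d *\<^sub>C tensor_lift f t"
  by (induction t)
    (simp_all add: assms tensor_lift_pure tensor_lift_add scaleC_add_right
      flip: pure_tensor_scaleC_left)

lemma clinear_tensor_lift:
  assumes "balanced f" "\<And>c a b. f (c *\<^sub>C a) b = c *\<^sub>C f a b"
  shows "clinear (tensor_lift f)"
  unfolding clinear_iff using assms by (blast intro: tensor_lift_add tensor_lift_scaleC)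

definition tensor_map ::
  "('a::complex_vector \<Rightarrow> 'c::complex_vector) \<Rightarrow> ('b::complex_vector \<Rightarrow> 'd::complex_vector)
    \<Rightarrow> 'a \<otimes> 'b \<Rightarrow> 'c \<otimes> 'd" where
  "tensor_map f g = tensor_lift (\<lambda>a b. f a \<otimes> g b)"

lemma balanced_tensor_map:
  assumes "clinear f \<and> clinear g \<or> antilinear f \<and> antilinear g"
  shows "balanced (\<lambda>a b. f a \<otimes> g b)"
  using assms
  by (auto simp: balanced_def clinear_iff antilinear_def pure_tensor_add_left
      pure_tensor_add_right pure_tensor_scaleC_left pure_tensor_scaleC_right)

lemma tensor_map_pure [simp]:
  "clinear f \<Longrightarrow> clinear g \<Longrightarrow> tensor_map f g (a \<otimes> b) = f a \<otimes> g b"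
  "antilinear f \<Longrightarrow> antilinear g \<Longrightarrow> tensor_map f g (a \<otimes> b) = f a \<otimes> g b"
  unfolding tensor_map_def by (simp_all add: tensor_lift_pure balanced_tensor_map)

definition tensor_swap :: "'a::complex_vector \<otimes> 'b::complex_vector \<Rightarrow> 'b \<otimes> 'a" where
  "tensor_swap = tensor_lift (\<lambda>a b. b \<otimes> a)"

definition tensor_assoc ::
  "('a::complex_vector \<otimes> 'b::complex_vector) \<otimes> 'c::complex_vector \<Rightarrow> 'a \<otimes> 'b \<otimes> 'c" where
  "tensor_assoc = tensor_lift (\<lambda>t c. tensor_lift (\<lambda>a b. a \<otimes> b \<otimes> c) t)"

definition left_unitor :: "complex \<otimes> 'a::complex_vector \<Rightarrow> 'a" where
  "left_unitor = tensor_lift (\<lambda>z a. z *\<^sub>C a)"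

definition right_unitor :: "'a::complex_vector \<otimes> complex \<Rightarrow> 'a" where
  "right_unitor = tensor_lift (\<lambda>a z. z *\<^sub>C a)"

lemma balanced_assoc_inner: "balanced (\<lambda>a b. a \<otimes> b \<otimes> c)"
  by (simp add: balanced_def pure_tensor_add_left pure_tensor_add_right
      pure_tensor_scaleC_left pure_tensor_scaleC_right)

lemma balanced_assoc:
  "balanced (\<lambda>t (c :: 'c::complex_vector).
     tensor_lift (\<lambda>(a :: 'a::complex_vector) (b :: 'b::complex_vector). a \<otimes> b \<otimes> c) t)"
proof -
  define L where "L c = tensor_lift (\<lambda>(a::'a) (b::'b). a \<otimes> b \<otimes> c)" for c :: 'c
  have L_pure: "L c (a \<otimes> b) = a \<otimes> b \<otimes> c" and L_add: "L c (s + t) = L c s + L c t" for a b c s t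
    by (simp_all add: L_def tensor_lift_pure tensor_lift_add balanced_assoc_inner)
  have 1: "L (c + c') t = L c t + L c' t" for c c' t
    by (induction t) (simp_all add: L_pure L_add pure_tensor_add_right)
  have 2: "L c (d *\<^sub>C t) = d *\<^sub>C L c t" for d c t
    unfolding L_def
    by (rule tensor_lift_scaleC[where f = "\<lambda>a b. a \<otimes> b \<otimes> c"])
      (simp_all add: balanced_assoc_inner pure_tensor_scaleC_left)
  have 3: "L (d *\<^sub>C c) t = d *\<^sub>C L c t" for d c t
    by (induction t) (simp_all add: L_pure L_add scaleC_add_right pure_tensor_scaleC_right)
  have "balanced (\<lambda>t c. L c t)"
    unfolding balanced_def by (simp add: 1 2 3 L_add)
  then show ?thesis by (simp add: L_def)
qed

lemma tensor_assoc_pure [simp]: "tensor_assoc ((a \<otimes> b) \<otimes> c) = a \<otimes> b \<otimes> c"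
  by (simp add: tensor_assoc_def tensor_lift_pure balanced_assoc balanced_assoc_inner)

lemma tensor_assoc_add: "tensor_assoc (x + y) = tensor_assoc x + tensor_assoc y"
  by (simp add: tensor_assoc_def tensor_lift_add balanced_assoc)

lemma bij_tensor_assoc:
  "bij (tensor_assoc ::
     ('a::complex_vector \<otimes> 'b::complex_vector) \<otimes> 'c::complex_vector \<Rightarrow> 'a \<otimes> 'b \<otimes> 'c)"
proof -
  have inner: "balanced (\<lambda>(b::'b) (c::'c). (a \<otimes> b) \<otimes> c)" for a :: 'a
    by (simp add: balanced_def pure_tensor_add_left pure_tensor_add_right
        pure_tensor_scaleC_left pure_tensor_scaleC_right)
  define g where "g = (\<lambda>(a::'a) (t::'b \<otimes> 'c). tensor_lift (\<lambda>b c. (a \<otimes> b) \<otimes> c) t)"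
  have g_pure: "g a (b \<otimes> c) = (a \<otimes> b) \<otimes> c" and g_add: "g a (s + t) = g a s + g a t" for a b c s t
    by (simp_all add: g_def inner tensor_lift_pure tensor_lift_add)
  have g_add1: "g (a + a') t = g a t + g a' t" for a a' t
    by (induction t) (simp_all add: g_pure g_add pure_tensor_add_left)
  have g_scale1: "g (d *\<^sub>C a) t = d *\<^sub>C g a t" for d a t
    by (induction t) (simp_all add: g_pure g_add scaleC_add_right pure_tensor_scaleC_left)
  have g_scale2: "g a (d *\<^sub>C t) = d *\<^sub>C g a t" for d a t
    unfolding g_def
    by (rule tensor_lift_scaleC[where f = "\<lambda>b c. (a \<otimes> b) \<otimes> c"])
      (simp_all add: inner pure_tensor_scaleC_left pure_tensor_scaleC_right)
  have bal: "balanced g" by (simp add: balanced_def g_add g_add1 g_scale1 g_scale2)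
  define h where "h = tensor_lift g"
  have h_pure: "h (a \<otimes> b \<otimes> c) = (a \<otimes> b) \<otimes> c" and h_add: "h (s + t) = h s + h t" for a b c s t
    by (simp_all add: h_def tensor_lift_pure tensor_lift_add bal g_pure)
  have hf1: "h (tensor_assoc (t \<otimes> c)) = t \<otimes> c" for t c
    by (induction t) (simp_all add: pure_tensor_add_left tensor_assoc_add h_add h_pure)
  have hf: "h (tensor_assoc t) = t" for t
    by (induction t) (simp_all add: tensor_assoc_add h_add hf1)
  have fh1: "tensor_assoc (h (a \<otimes> t)) = a \<otimes> t" for a t
    by (induction t) (simp_all add: pure_tensor_add_right tensor_assoc_add h_add h_pure)
  have fh: "tensor_assoc (h t) = t" for t
    by (induction t) (simp_all add: tensor_assoc_add h_add fh1)
  show ?thesis by (rule bijI'[of tensor_assoc]) (metis hf, metis fh)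
qed

subsection \<open>The tensor product of algebras\<close>

lemma clinear_mult_left: "clinear ((*) a)" for a :: "'a::complex_algebra_1"
  by (simp add: clinear_iff distrib_left)

lemma tensor_map_add:
  "clinear f \<Longrightarrow> clinear g \<Longrightarrow> tensor_map f g (x + y) = tensor_map f g x + tensor_map f g y"
  unfolding tensor_map_def by (simp add: tensor_lift_add balanced_tensor_map)

lemma balanced_mult:
  "balanced (\<lambda>a b. tensor_map ((*) a) ((*) b) y)"
  for y :: "'a::complex_algebra_1 \<otimes> 'b::complex_algebra_1"
proof (induction y)
  case (pure a b)
  show ?case
    by (simp add: balanced_def clinear_mult_left distrib_right pure_tensor_add_left
        pure_tensor_add_right pure_tensor_scaleC_left pure_tensor_scaleC_right)
next
  case (add x y)
  then show ?case
    by (simp add: balanced_def tensor_map_add clinear_mult_left algebra_simps)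
qed

lemma ex_functional_one: "\<exists>f :: 'a::complex_algebra_1 \<Rightarrow> complex. clinear f \<and> f 1 = 1"
proof -
  interpret vector_space_pair "scaleC :: complex \<Rightarrow> 'a \<Rightarrow> 'a" "scaleC :: complex \<Rightarrow> complex \<Rightarrow> complex"
    by unfold_locales
  have "\<not> complex_vector.dependent {1 :: 'a}" by simp
  from linear_independent_extend[OF this, of "\<lambda>_. 1"] show ?thesis by auto
qed

instantiation tensor :: (complex_algebra_1, complex_algebra_1) complex_algebra_1
begin

definition one_tensor :: "'a \<otimes> 'b" where
  "1 = 1 \<otimes> 1"

definition times_tensor :: "'a \<otimes> 'b \<Rightarrow> 'a \<otimes> 'b \<Rightarrow> 'a \<otimes> 'b" where
  "x * y = tensor_lift (\<lambda>a b. tensor_map ((*) a) ((*) b) y) x"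

lemma times_tensor_pure: "(a \<otimes> b) * (c \<otimes> d) = (a * c) \<otimes> (b * d :: 'b)" for a c :: 'a
  unfolding times_tensor_def tensor_lift_pure[OF balanced_mult]
  by (simp add: clinear_mult_left)

lemma times_tensor_add_left: "(x + y) * z = x * z + y * z" for x y z :: "'a \<otimes> 'b"
  by (simp add: times_tensor_def tensor_lift_add balanced_mult)

lemma times_tensor_add_right: "x * (y + z) = x * y + x * z" for x y z :: "'a \<otimes> 'b"
proof (induction x)
  case (pure a b)
  show ?case
    unfolding times_tensor_def tensor_lift_pure[OF balanced_mult]
    by (simp add: tensor_map_add clinear_mult_left)
next
  case (add u v)
  then show ?case by (simp add: times_tensor_add_left)
qed

lemma one_tensor_neq_zero: "(1 :: 'a) \<otimes> (1 :: 'b) \<noteq> 0"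
proof -
  obtain f :: "'a \<Rightarrow> complex" where f: "clinear f" "f 1 = 1"
    using ex_functional_one by blast
  obtain g :: "'b \<Rightarrow> complex" where g: "clinear g" "g 1 = 1"
    using ex_functional_one by blast
  have bal: "balanced (\<lambda>a b. f a * g b)"
    using f(1) g(1) by (simp add: balanced_def clinear_iff algebra_simps)
  have "tensor_lift (\<lambda>a b. f a * g b) (1 \<otimes> 1) = 1"
    by (simp add: tensor_lift_pure[OF bal] f g)
  moreover have "tensor_lift (\<lambda>a b. f a * g b) 0 = 0"
    by (rule additive.zero[OF tensor_lift_additive[OF bal]])
  ultimately show ?thesis by auto
qed

instance
proof
  fix x y z :: "'a \<otimes> 'b" and c :: complex
  note add = times_tensor_add_left times_tensor_add_right
  have assoc2: "(a \<otimes> b) * y * z = (a \<otimes> b) * (y * z)" if "z = u \<otimes> v" for a b u v and y z :: "'a \<otimes> 'b"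
    unfolding that by (induction y) (simp_all add: add times_tensor_pure mult.assoc)
  have assoc1: "(a \<otimes> b) * y * z = (a \<otimes> b) * (y * z)" for a b and y z :: "'a \<otimes> 'b"
    by (induction z) (simp_all add: add assoc2)
  show "x * y * z = x * (y * z)"
    by (induction x) (simp_all add: add assoc1)
  show "1 * x = x" "x * 1 = x"
    unfolding one_tensor_def by (induction x; simp add: add times_tensor_pure)+
  show "(x + y) * z = x * z + y * z" "x * (y + z) = x * y + x * z"
    by (fact add)+
  show "(0 :: 'a \<otimes> 'b) \<noteq> 1"
    unfolding one_tensor_def by (rule one_tensor_neq_zero[symmetric])
  have left: "(c *\<^sub>C (a \<otimes> b)) * y = c *\<^sub>C ((a \<otimes> b) * y)" for a b and y :: "'a \<otimes> 'b"
    by (induction y)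
      (simp_all add: add scaleC_add_right times_tensor_pure flip: pure_tensor_scaleC_left)
  show "(c *\<^sub>C x) * y = c *\<^sub>C (x * y)"
    by (induction x) (simp_all add: add scaleC_add_right left)
  have right: "(a \<otimes> b) * (c *\<^sub>C y) = c *\<^sub>C ((a \<otimes> b) * y)" for a b and y :: "'a \<otimes> 'b"
    by (induction y)
      (simp_all add: add scaleC_add_right times_tensor_pure flip: pure_tensor_scaleC_left)
  show "x * (c *\<^sub>C y) = c *\<^sub>C (x * y)"
    by (induction x) (simp_all add: add scaleC_add_right right)
qed

end


section \<open>Quasitriangular *-Hopf algebras\<close>

text \<open>Inverses in a not necessarily commutative ring; only meaningful for invertible elements.\<close>

definition invertible_elt :: "'a::ring_1 \<Rightarrow> bool" where
  "invertible_elt x \<longleftrightarrow> (\<exists>y. x * y = 1 \<and> y * x = 1)"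

definition inverse_elt :: "'a::ring_1 \<Rightarrow> 'a" where
  "inverse_elt x = (THE y. x * y = 1 \<and> y * x = 1)"

lemma inverse_elt_eqI:
  assumes "x * y = 1" "y * x = 1"
  shows "inverse_elt x = y"
  unfolding inverse_elt_def
proof (rule the_equality)
  fix z assume z: "x * z = 1 \<and> z * x = 1"
  have "z = z * (x * y)" by (simp add: assms)
  also have "\<dots> = (z * x) * y" by (simp only: mult.assoc)
  also have "\<dots> = y" by (simp add: z)
  finally show "z = y" .
qed (use assms in simp)

locale hopf_algebra =
  fixes \<Delta> :: "'h::complex_algebra_1 \<Rightarrow> 'h \<otimes> 'h"
    and \<epsilon> :: "'h \<Rightarrow> complex"
    and S :: "'h \<Rightarrow> 'h"
  assumes coprod_linear: "clinear \<Delta>"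
    and counit_linear: "clinear \<epsilon>"
    and antipode_linear: "clinear S"
    and coassoc: "tensor_assoc (tensor_map \<Delta> id (\<Delta> h)) = tensor_map id \<Delta> (\<Delta> h)"
    and counit_left: "left_unitor (tensor_map \<epsilon> id (\<Delta> h)) = h"
    and counit_right: "right_unitor (tensor_map id \<epsilon> (\<Delta> h)) = h"
    and coprod_mult: "\<Delta> (g * h) = \<Delta> g * \<Delta> h"
    and coprod_one: "\<Delta> 1 = 1"
    and counit_mult: "\<epsilon> (g * h) = \<epsilon> g * \<epsilon> h"
    and counit_one: "\<epsilon> 1 = 1"
    and antipode_left: "tensor_lift (\<lambda>a b. S a * b) (\<Delta> h) = \<epsilon> h *\<^sub>C 1"
    and antipode_right: "tensor_lift (\<lambda>a b. a * S b) (\<Delta> h) = \<epsilon> h *\<^sub>C 1"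

locale star_hopf_algebra = hopf_algebra \<Delta> \<epsilon> S
  for \<Delta> :: "'h::complex_algebra_1 \<Rightarrow> 'h \<otimes> 'h" and \<epsilon> S +
  fixes star :: "'h \<Rightarrow> 'h"
  assumes star_antilinear: "antilinear star"
    and star_star: "star (star h) = h"
    and star_mult: "star (g * h) = star h * star g"
    and coprod_star: "\<Delta> (star h) = tensor_map star star (\<Delta> h)"

text \<open>
  The leg embeddings of \<open>H \<otimes> H\<close> all have target \<open>H \<otimes> (H \<otimes> H)\<close>; the hexagon axiom for
  \<open>(\<Delta> \<otimes> id) R\<close> is therefore reassociated.
\<close>

definition leg12 :: "'h::complex_algebra_1 \<otimes> 'h \<Rightarrow> 'h \<otimes> 'h \<otimes> 'h" where
  "leg12 = tensor_lift (\<lambda>a b. a \<otimes> b \<otimes> 1)"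

definition leg13 :: "'h::complex_algebra_1 \<otimes> 'h \<Rightarrow> 'h \<otimes> 'h \<otimes> 'h" where
  "leg13 = tensor_lift (\<lambda>a b. a \<otimes> 1 \<otimes> b)"

definition leg23 :: "'h::complex_algebra_1 \<otimes> 'h \<Rightarrow> 'h \<otimes> 'h \<otimes> 'h" where
  "leg23 = tensor_lift (\<lambda>a b. 1 \<otimes> a \<otimes> b)"

locale quasitriangular_star_hopf_algebra = star_hopf_algebra \<Delta> \<epsilon> S star
  for \<Delta> :: "'h::complex_algebra_1 \<Rightarrow> 'h \<otimes> 'h" and \<epsilon> S star +
  fixes R :: "'h \<otimes> 'h"
  assumes R_invertible: "invertible_elt R"
    and coprod_id_R: "tensor_assoc (tensor_map \<Delta> id R) = leg13 R * leg23 R"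
    and id_coprod_R: "tensor_map id \<Delta> R = leg13 R * leg12 R"
    and quasi_cocommutative: "tensor_swap (\<Delta> h) = R * \<Delta> h * inverse_elt R"


section \<open>The braided bar category of left modules\<close>

text \<open>
  An object is a vector space type together with an action; morphisms are the equivariant linear
  maps.  The monoidal structure on underlying spaces is that of \<open>(\<otimes>)\<close>, with associator
  \<^const>\<open>tensor_assoc\<close> and unitors \<^const>\<open>left_unitor\<close>, \<^const>\<open>right_unitor\<close>.
\<close>

definition left_module ::
  "('h::complex_algebra_1 \<Rightarrow> 'v::complex_vector \<Rightarrow> 'v) \<Rightarrow> bool" where
  "left_module act \<longleftrightarrow>
     (\<forall>v. clinear (\<lambda>h. act h v)) \<and> (\<forall>h. clinear (act h)) \<and>
     (\<forall>v. act 1 v = v) \<and> (\<forall>g h v. act (g * h) v = act g (act h v))"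

definition left_module_hom ::
  "('h::complex_algebra_1 \<Rightarrow> 'v::complex_vector \<Rightarrow> 'v) \<Rightarrow> ('h \<Rightarrow> 'w::complex_vector \<Rightarrow> 'w)
    \<Rightarrow> ('v \<Rightarrow> 'w) \<Rightarrow> bool" where
  "left_module_hom actV actW f \<longleftrightarrow> clinear f \<and> (\<forall>h v. f (actV h v) = actW h (f v))"

definition trivial_act :: "('h \<Rightarrow> complex) \<Rightarrow> 'h \<Rightarrow> complex \<Rightarrow> complex" where
  "trivial_act \<epsilon> h z = \<epsilon> h * z"

definition tensor_act ::
  "('h::complex_algebra_1 \<Rightarrow> 'h \<otimes> 'h) \<Rightarrow> ('h \<Rightarrow> 'v::complex_vector \<Rightarrow> 'v)
    \<Rightarrow> ('h \<Rightarrow> 'w::complex_vector \<Rightarrow> 'w) \<Rightarrow> 'h \<Rightarrow> 'v \<otimes> 'w \<Rightarrow> 'v \<otimes> 'w" where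
  "tensor_act \<Delta> actV actW h =
     tensor_lift (\<lambda>v w. tensor_lift (\<lambda>h1 h2. actV h1 v \<otimes> actW h2 w) (\<Delta> h))"

text \<open>
  In a *-Hopf algebra the antipode is bijective, with inverse \<open>star \<circ> S \<circ> star\<close>, so that
  \<open>inv S\<close> below is a genuine inverse.
\<close>

definition conjugate_act ::
  "('h \<Rightarrow> 'h) \<Rightarrow> ('h \<Rightarrow> 'h) \<Rightarrow> ('h \<Rightarrow> 'v \<Rightarrow> 'v) \<Rightarrow> 'h \<Rightarrow> 'v conjugate \<Rightarrow> 'v conjugate" where
  "conjugate_act S star act h x = bar (act (inv S (star h)) (unbar x))"

definition bb :: "'v \<Rightarrow> 'v conjugate conjugate" where
  "bb v = bar (bar v)"

definition Upsilon ::
  "('v::complex_vector \<otimes> 'w::complex_vector) conjugate \<Rightarrow> 'w conjugate \<otimes> 'v conjugate" where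
  "Upsilon x = tensor_lift (\<lambda>v w. bar w \<otimes> bar v) (unbar x)"

definition star_complex :: "complex \<Rightarrow> complex conjugate" where
  "star_complex z = bar (cnj z)"

definition braiding ::
  "'h::complex_algebra_1 \<otimes> 'h \<Rightarrow> ('h \<Rightarrow> 'v::complex_vector \<Rightarrow> 'v)
    \<Rightarrow> ('h \<Rightarrow> 'w::complex_vector \<Rightarrow> 'w) \<Rightarrow> 'v \<otimes> 'w \<Rightarrow> 'w \<otimes> 'v" where
  "braiding R actV actW =
     tensor_lift (\<lambda>v w. tensor_lift (\<lambda>r1 r2. actW r2 w \<otimes> actV r1 v) R)"

text \<open>
  The braiding of the module category is antireal if the following holds at all pairs of left
  modules.  Both inverses exist: \<open>Upsilon\<close> is bijective (lemma \<open>bij_Upsilon\<close>), and the braiding is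
  bijective because \<open>R\<close> is invertible.
\<close>

definition antireal_braiding_at ::
  "('h::complex_algebra_1 \<Rightarrow> 'h) \<Rightarrow> ('h \<Rightarrow> 'h) \<Rightarrow> 'h \<otimes> 'h
    \<Rightarrow> ('h \<Rightarrow> 'x::complex_vector \<Rightarrow> 'x) \<Rightarrow> ('h \<Rightarrow> 'y::complex_vector \<Rightarrow> 'y) \<Rightarrow> bool" where
  "antireal_braiding_at S star R actX actY \<longleftrightarrow>
     inv Upsilon \<circ> braiding R (conjugate_act S star actX) (conjugate_act S star actY)
       = bar_map (inv (braiding R actX actY)) \<circ> inv Upsilon"

lemma bij_Upsilon:
  "bij (Upsilon :: ('v::complex_vector \<otimes> 'w::complex_vector) conjugate \<Rightarrow> _)"
proof -
  have bal: "balanced (\<lambda>(v::'v) (w::'w). bar w \<otimes> bar v)"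
    by (simp add: balanced_def bar_simps pure_tensor_add_left pure_tensor_add_right
        pure_tensor_scaleC_left pure_tensor_scaleC_right)
  have bal': "balanced (\<lambda>(y::'w conjugate) (x::'v conjugate). unbar x \<otimes> unbar y)"
    by (simp add: balanced_def pure_tensor_add_left pure_tensor_add_right
        pure_tensor_scaleC_left pure_tensor_scaleC_right)
  define g :: "'w conjugate \<otimes> 'v conjugate \<Rightarrow> 'v \<otimes> 'w"
    where "g = tensor_lift (\<lambda>y x. unbar x \<otimes> unbar y)"
  have 1: "g (tensor_lift (\<lambda>v w. bar w \<otimes> bar v) t) = t" for t
    unfolding g_def by (induction t) (simp_all add: tensor_lift_pure tensor_lift_add bal bal')
  have 2: "tensor_lift (\<lambda>v w. bar w \<otimes> bar v) (g t) = t" for t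
    unfolding g_def by (induction t) (simp_all add: tensor_lift_pure tensor_lift_add bal bal')
  show ?thesis
    by (rule bijI'[of Upsilon]) (metis 1 Upsilon_def unbar_inject, metis 2 Upsilon_def conjugate.sel)
qed


section \<open>Braided *-Hopf algebras\<close>

text \<open>The map \<open>id \<otimes> f \<otimes> id\<close>, with the necessary reassociations.\<close>

definition middle_map ::
  "('b::complex_vector \<otimes> 'c::complex_vector \<Rightarrow> 'c \<otimes> 'b) \<Rightarrow>
    ('a::complex_vector \<otimes> 'b) \<otimes> ('c \<otimes> 'd::complex_vector) \<Rightarrow> ('a \<otimes> 'c) \<otimes> ('b \<otimes> 'd)" where
  "middle_map f =
     inv tensor_assoc \<circ> tensor_map id tensor_assoc \<circ> tensor_map id (tensor_map f id)
       \<circ> tensor_map id (inv tensor_assoc) \<circ> tensor_assoc"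

text \<open>
  Hopf algebras in the braided category of left modules over the quasitriangular Hopf algebra with
  structure maps \<open>\<Delta>\<close>, \<open>\<epsilon>\<close> and universal R-matrix \<open>R\<close>.
\<close>

locale braided_hopf_algebra =
  fixes \<Delta> :: "'h::complex_algebra_1 \<Rightarrow> 'h \<otimes> 'h"
    and \<epsilon> :: "'h \<Rightarrow> complex"
    and R :: "'h \<otimes> 'h"
    and act :: "'h \<Rightarrow> 'b::complex_vector \<Rightarrow> 'b"
    and \<mu> :: "'b \<otimes> 'b \<Rightarrow> 'b"
    and \<eta> :: "complex \<Rightarrow> 'b"
    and \<Delta>\<^sub>B :: "'b \<Rightarrow> 'b \<otimes> 'b"
    and \<epsilon>\<^sub>B :: "'b \<Rightarrow> complex"
    and S\<^sub>B :: "'b \<Rightarrow> 'b"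
  assumes object: "left_module act"
    and mult_hom: "left_module_hom (tensor_act \<Delta> act act) act \<mu>"
    and unit_hom: "left_module_hom (trivial_act \<epsilon>) act \<eta>"
    and coprod_hom: "left_module_hom act (tensor_act \<Delta> act act) \<Delta>\<^sub>B"
    and counit_hom: "left_module_hom act (trivial_act \<epsilon>) \<epsilon>\<^sub>B"
    and antipode_hom: "left_module_hom act act S\<^sub>B"
    and mult_assoc: "\<mu> \<circ> tensor_map \<mu> id = \<mu> \<circ> tensor_map id \<mu> \<circ> tensor_assoc"
    and unit_left: "\<mu> \<circ> tensor_map \<eta> id = left_unitor"
    and unit_right: "\<mu> \<circ> tensor_map id \<eta> = right_unitor"
    and coprod_coassoc:
      "tensor_assoc \<circ> tensor_map \<Delta>\<^sub>B id \<circ> \<Delta>\<^sub>B = tensor_map id \<Delta>\<^sub>B \<circ> \<Delta>\<^sub>B"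
    and counit_left: "left_unitor \<circ> tensor_map \<epsilon>\<^sub>B id \<circ> \<Delta>\<^sub>B = id"
    and counit_right: "right_unitor \<circ> tensor_map id \<epsilon>\<^sub>B \<circ> \<Delta>\<^sub>B = id"
    and coprod_mult:
      "\<Delta>\<^sub>B \<circ> \<mu> =
         tensor_map \<mu> \<mu> \<circ> middle_map (braiding R act act) \<circ> tensor_map \<Delta>\<^sub>B \<Delta>\<^sub>B"
    and coprod_unit: "\<Delta>\<^sub>B (\<eta> 1) = \<eta> 1 \<otimes> \<eta> 1"
    and counit_mult: "\<epsilon>\<^sub>B \<circ> \<mu> = left_unitor \<circ> tensor_map \<epsilon>\<^sub>B \<epsilon>\<^sub>B"
    and counit_unit: "\<epsilon>\<^sub>B \<circ> \<eta> = id"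
    and antipode_left: "\<mu> \<circ> tensor_map S\<^sub>B id \<circ> \<Delta>\<^sub>B = \<eta> \<circ> \<epsilon>\<^sub>B"
    and antipode_right: "\<mu> \<circ> tensor_map id S\<^sub>B \<circ> \<Delta>\<^sub>B = \<eta> \<circ> \<epsilon>\<^sub>B"

locale braided_star_hopf_algebra =
  braided_hopf_algebra \<Delta> \<epsilon> R act \<mu> \<eta> \<Delta>\<^sub>B \<epsilon>\<^sub>B S\<^sub>B
  for \<Delta> :: "'h::complex_algebra_1 \<Rightarrow> 'h \<otimes> 'h" and \<epsilon> and S and star and R
    and act :: "'h \<Rightarrow> 'b::complex_vector \<Rightarrow> 'b" and \<mu> \<eta> \<Delta>\<^sub>B \<epsilon>\<^sub>B S\<^sub>B +
  fixes star\<^sub>B :: "'b \<Rightarrow> 'b conjugate"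
  assumes star_hom: "left_module_hom act (conjugate_act S star act) star\<^sub>B"
    and star_star: "bar_map star\<^sub>B \<circ> star\<^sub>B = bb"
    and star_mult: "bar_map \<mu> \<circ> inv Upsilon \<circ> tensor_map star\<^sub>B star\<^sub>B = star\<^sub>B \<circ> \<mu>"
    and star_unit: "bar_map \<eta> \<circ> star_complex = star\<^sub>B \<circ> \<eta>"
    and star_coprod:
      "bar_map \<Delta>\<^sub>B \<circ> star\<^sub>B =
         bar_map (braiding R act act) \<circ> inv Upsilon \<circ> tensor_map star\<^sub>B star\<^sub>B \<circ> \<Delta>\<^sub>B"


section \<open>The transmutation of a quasitriangular Hopf algebra\<close>

definition adjoint_act ::
  "('h::complex_algebra_1 \<Rightarrow> 'h \<otimes> 'h) \<Rightarrow> ('h \<Rightarrow> 'h) \<Rightarrow> 'h \<Rightarrow> 'h \<Rightarrow> 'h" where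
  "adjoint_act \<Delta> S h b = tensor_lift (\<lambda>h1 h2. h1 * b * S h2) (\<Delta> h)"

definition transmuted_mult :: "'h::complex_algebra_1 \<otimes> 'h \<Rightarrow> 'h" where
  "transmuted_mult = tensor_lift (*)"

definition transmuted_unit :: "complex \<Rightarrow> 'h::complex_algebra_1" where
  "transmuted_unit z = z *\<^sub>C 1"

definition transmuted_coprod ::
  "('h::complex_algebra_1 \<Rightarrow> 'h \<otimes> 'h) \<Rightarrow> ('h \<Rightarrow> 'h) \<Rightarrow> 'h \<otimes> 'h \<Rightarrow> 'h \<Rightarrow> 'h \<otimes> 'h" where
  "transmuted_coprod \<Delta> S R b =
     tensor_lift (\<lambda>b1 b2. tensor_lift (\<lambda>r1 r2. (b1 * S r2) \<otimes> adjoint_act \<Delta> S r1 b2) R) (\<Delta> b)"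

definition transmuted_antipode ::
  "('h::complex_algebra_1 \<Rightarrow> 'h \<otimes> 'h) \<Rightarrow> ('h \<Rightarrow> 'h) \<Rightarrow> 'h \<otimes> 'h \<Rightarrow> 'h \<Rightarrow> 'h" where
  "transmuted_antipode \<Delta> S R b = tensor_lift (\<lambda>r1 r2. r2 * S (adjoint_act \<Delta> S r1 b)) R"

end

theory Submission
  imports Defs
begin

text \<open>
  The transmuted coproduct is the ordinary one read through the braided tensor product.  The map
  \<open>\<Phi> (a \<otimes> b) = a R\<^sup>(\<^sup>2\<^sup>) \<otimes> R\<^sup>(\<^sup>1\<^sup>) \<rhd> b = (a \<otimes> 1) q (1 \<otimes> b) q\<inverse>\<close>, where \<open>q\<close> is the flip of \<open>R\<close>, is
  bijective and satisfies \<open>\<Phi> \<circ> \<Delta>\<^sub>B = \<Delta>\<close>.  It intertwines the tensor product action with the adjoint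
  action through \<open>\<Delta>\<close> and sends the braided tensor product algebra to the algebra \<open>H \<otimes> H\<close>.  So
  equivariance, coassociativity and multiplicativity of \<open>\<Delta>\<^sub>B\<close> follow from the corresponding
  properties of \<open>\<Delta>\<close>; coassociativity also uses the Yang-Baxter equation.  If \<open>R\<^sup>* = R\<inverse>\<close> then
  \<open>q\<^sup>* = q\<inverse>\<close>, and applying \<open>*\<close> to \<open>\<Phi> (x \<otimes> y)\<close> gives \<open>q (1 \<otimes> y\<^sup>*) q\<inverse> (x\<^sup>* \<otimes> 1)\<close>, which is \<open>\<Phi>\<close> of the
  braiding of \<open>y\<^sup>* \<otimes> x\<^sup>*\<close>; this is the compatibility of \<open>\<Delta>\<^sub>B\<close> with the star.
\<close>

section \<open>Sums over tensors\<close>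

text \<open>Two different inverses of \<open>R\<close> occur. \<open>(S \<otimes> id) R\<close>
  inverts \<open>R\<close> in \<open>H \<otimes> H\<close>; together with
  \<open>(\<Delta> \<otimes> id) R = R13 R23\<close> it turns an adjoint action summed over
  \<open>R\<close> into conjugation by \<open>q\<close>. The \<open>S s\<close> in the transmuted
  coproduct belongs to the other one: iterating \<Phi> multiplies one leg of \<open>R\<close> on the
  left and the other on the right, so undoing it requires the inverse in
  \<open>H \<otimes> H^op\<close>, which is \<open>(id \<otimes> S) R\<close>. The antipode axioms
  do not follow by transport along \<Phi> and are computed directly. The right axiom is one
  cancellation. The left one produces \<open>S (S d)\<close>, and the square of \<open>S\<close>
  need not be the identity; Drinfeld's element, which implements this square by conjugation, absorbs
  it. Bijectivity of \<open>S\<close> is not an axiom. It is derived from the star through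
  uniqueness of convolution inverses, and only then can conjugate modules be computed with.
  Antireality of the braiding is proved for arbitrary modules from
  \<open>(S \<otimes> S) R = R\<close>, the formula for the inverse of \<open>R\<close>, and the
  reality of \<open>R\<close>.\<close>

text \<open>
  Sweedler notation: \<open>tsum (\<Delta> h) (\<lambda>a b. f a b)\<close> stands for the sum of \<open>f h\<^sub>(\<^sub>1\<^sub>) h\<^sub>(\<^sub>2\<^sub>)\<close>.  It is taken over one
  chosen decomposition into pure tensors, so it is additive in \<open>f\<close> without side conditions; it is
  meaningful, and agrees with \<open>tensor_lift\<close>, only for balanced \<open>f\<close>.
\<close>

definition tensor_rep :: "'a::complex_vector \<otimes> 'b::complex_vector \<Rightarrow> ('a \<times> 'b) list" where
  "tensor_rep t = (SOME xs. (\<Sum>(a, b)\<leftarrow>xs. a \<otimes> b) = t)"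

definition tsum ::
  "'a::complex_vector \<otimes> 'b::complex_vector \<Rightarrow> ('a \<Rightarrow> 'b \<Rightarrow> 'c::ab_group_add) \<Rightarrow> 'c" where
  "tsum t f = (\<Sum>(a, b)\<leftarrow>tensor_rep t. f a b)"

text \<open>Stronger than \<open>balanced\<close>, but checkable one argument at a time from the
  shape of a term, which is what \<open>intro clin\<close> does.\<close>

definition bilin ::
  "('a::complex_vector \<Rightarrow> 'b::complex_vector \<Rightarrow> 'c::complex_vector) \<Rightarrow> bool" where
  "bilin f \<longleftrightarrow> (\<forall>a. clinear (f a)) \<and> (\<forall>b. clinear (\<lambda>a. f a b))"

definition trilin ::
  "('a::complex_vector \<Rightarrow> 'b::complex_vector \<Rightarrow> 'c::complex_vector \<Rightarrow> 'd::complex_vector) \<Rightarrow> bool" where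
  "trilin f \<longleftrightarrow> (\<forall>a b. clinear (f a b)) \<and> (\<forall>a c. clinear (\<lambda>b. f a b c)) \<and> (\<forall>b c. clinear (\<lambda>a. f a b c))"

lemma tensor_rep: "(\<Sum>(a, b)\<leftarrow>tensor_rep t. a \<otimes> b) = t"
proof -
  have "\<exists>xs. (\<Sum>(a, b)\<leftarrow>xs. a \<otimes> b) = t"
  proof (induction t)
    case (pure a b)
    show ?case by (rule exI[of _ "[(a, b)]"]) simp
  next
    case (add x y)
    then obtain xs ys where "(\<Sum>(a, b)\<leftarrow>xs. a \<otimes> b) = x" "(\<Sum>(a, b)\<leftarrow>ys. a \<otimes> b) = y" by blast
    then show ?case by (intro exI[of _ "xs @ ys"]) simp
  qed
  then show ?thesis unfolding tensor_rep_def by (rule someI_ex)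
qed

lemma tsum_pure_tensor [simp]: "tsum t (\<lambda>a b. a \<otimes> b) = t"
  by (simp add: tsum_def tensor_rep)

lemma tsum_add: "tsum t (\<lambda>a b. f a b + g a b) = tsum t f + tsum t g"
proof -
  have "(\<Sum>(a, b)\<leftarrow>xs. f a b + g a b) = (\<Sum>(a, b)\<leftarrow>xs. f a b) + (\<Sum>(a, b)\<leftarrow>xs. g a b)" for xs
    by (induction xs) (auto simp: algebra_simps)
  then show ?thesis by (simp add: tsum_def)
qed

lemma tsum_additive:
  assumes "\<And>x y. F (x + y) = F x + F y"
  shows "F (tsum t f) = tsum t (\<lambda>a b. F (f a b))"
proof -
  interpret additive F by standard (rule assms)
  have "F (\<Sum>(a, b)\<leftarrow>xs. f a b) = (\<Sum>(a, b)\<leftarrow>xs. F (f a b))" for xs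
    by (induction xs) (auto simp: zero add)
  then show ?thesis by (simp add: tsum_def)
qed

lemma tsum_zero: "tsum t (\<lambda>a b. 0) = 0"
  using tsum_add[of t "\<lambda>a b. 0" "\<lambda>a b. 0"] by simp

lemma tsum_clinear: "clinear F \<Longrightarrow> F (tsum t f) = tsum t (\<lambda>a b. F (f a b))"
  by (rule tsum_additive) (simp add: clinear_iff)

lemma tsum_scaleC: "c *\<^sub>C tsum t f = tsum t (\<lambda>a b. c *\<^sub>C f a b)"
  by (rule tsum_additive) (simp add: scaleC_add_right)

lemma tsum_mult_left: "c * tsum t f = tsum t (\<lambda>a b. c * f a b)"
  for c :: "'a::complex_algebra_1"
  by (rule tsum_additive) (simp add: distrib_left)

lemma tsum_mult_right: "tsum t f * c = tsum t (\<lambda>a b. f a b * c)"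
  for c :: "'a::complex_algebra_1"
  by (rule tsum_additive[where F = "\<lambda>x. x * c"]) (simp add: distrib_right)

lemma tsum_tensor_left: "c \<otimes> tsum t f = tsum t (\<lambda>a b. c \<otimes> f a b)"
  by (rule tsum_additive) (simp add: pure_tensor_add_right)

lemma tsum_tensor_right: "tsum t f \<otimes> c = tsum t (\<lambda>a b. f a b \<otimes> c)"
  by (rule tsum_additive[where F = "\<lambda>x. x \<otimes> c"]) (simp add: pure_tensor_add_left)

lemma tsum_commute:
  "tsum s (\<lambda>a b. tsum t (\<lambda>c d. f a b c d)) = tsum t (\<lambda>c d. tsum s (\<lambda>a b. f a b c d))"
proof -
  have "(\<Sum>(a, b)\<leftarrow>xs. tsum t (\<lambda>c d. f a b c d)) = tsum t (\<lambda>c d. \<Sum>(a, b)\<leftarrow>xs. f a b c d)" for xs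
    by (induction xs) (auto simp: tsum_add tsum_zero)
  then show ?thesis by (simp add: tsum_def[of s])
qed

section \<open>Structural rules for linearity of Sweedler expressions\<close>

lemma clinear_ident: "clinear (\<lambda>x. x)"
  by (simp add: clinear_iff)

lemma clinear_comp: "clinear g \<Longrightarrow> clinear f \<Longrightarrow> clinear (\<lambda>x. g (f x))"
  by (simp add: clinear_iff)

lemma clinear_add: "clinear f \<Longrightarrow> clinear g \<Longrightarrow> clinear (\<lambda>x. f x + g x)"
  by (simp add: clinear_iff scaleC_add_right algebra_simps)

lemma clinear_scale: "clinear f \<Longrightarrow> clinear (\<lambda>x. c *\<^sub>C f x)"
  by (simp add: clinear_iff scaleC_add_right algebra_simps)

lemma clinear_scale_left: "clinear f \<Longrightarrow> clinear (\<lambda>x. f x *\<^sub>C v)"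
  by (simp add: clinear_iff scaleC_add_left algebra_simps)

lemma clinear_times_left: "clinear f \<Longrightarrow> clinear (\<lambda>x. a * f x)"
  for a :: "'a::complex_algebra_1"
  by (simp add: clinear_iff distrib_left)

lemma clinear_times_right: "clinear f \<Longrightarrow> clinear (\<lambda>x. f x * a)"
  for a :: "'a::complex_algebra_1"
  by (simp add: clinear_iff distrib_right)

lemma clinear_tensor_left: "clinear f \<Longrightarrow> clinear (\<lambda>x. a \<otimes> f x)"
  by (simp add: clinear_iff pure_tensor_add_right pure_tensor_scaleC_right)

lemma clinear_tensor_right: "clinear f \<Longrightarrow> clinear (\<lambda>x. f x \<otimes> a)"
  by (simp add: clinear_iff pure_tensor_add_left pure_tensor_scaleC_left)

lemma clinear_tsum: "(\<And>a b. clinear (\<lambda>x. f x a b)) \<Longrightarrow> clinear (\<lambda>x. tsum t (\<lambda>a b. f x a b))"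
proof -
  assume "clinear (\<lambda>x. f x a b)" for a b
  then have "f (x + y) = (\<lambda>a b. f x a b + f y a b)" "f (c *\<^sub>C x) = (\<lambda>a b. c *\<^sub>C f x a b)" for x y c
    by (auto simp: fun_eq_iff clinear_iff)
  then show ?thesis by (simp add: clinear_iff tsum_add tsum_scaleC)
qed

lemma bilin_balanced: "bilin f \<Longrightarrow> balanced f"
  by (auto simp: bilin_def balanced_def clinear_iff)

lemma balanced_tsum: "balanced f \<Longrightarrow> tensor_lift f t = tsum t f"
  using tsum_additive[of "tensor_lift f" t "\<lambda>a b. a \<otimes> b"]
  by (simp add: tensor_lift_add tensor_lift_pure)

lemma bilin_tsum: "bilin f \<Longrightarrow> tensor_lift f t = tsum t f"
  by (simp add: balanced_tsum bilin_balanced)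

text \<open>The decompositions chosen for \<open>s\<close>, \<open>t\<close> and
  \<open>s + t\<close> are unrelated, so linearity in the tensor cannot be read off the sum; it is
  inherited from \<open>tensor_lift\<close>.\<close>

lemma clinear_tsum_arg: "bilin g \<Longrightarrow> clinear (\<lambda>t. tsum t g)"
proof -
  assume g: "bilin g"
  have "clinear (tensor_lift g)"
    using g by (intro clinear_tensor_lift) (auto simp: bilin_balanced bilin_def clinear_iff)
  also have "tensor_lift g = (\<lambda>t. tsum t g)"
    by (rule ext) (rule bilin_tsum[OF g])
  finally show ?thesis .
qed

lemma clinear_tsum_arg': "bilin g \<Longrightarrow> clinear f \<Longrightarrow> clinear (\<lambda>x. tsum (f x) g)"
  by (rule clinear_comp[OF clinear_tsum_arg])

lemma bilinI: "(\<And>a. clinear (\<lambda>b. f a b)) \<Longrightarrow> (\<And>b. clinear (\<lambda>a. f a b)) \<Longrightarrow> bilin f"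
  by (simp add: bilin_def)

lemma trilinI:
  "(\<And>a b. clinear (\<lambda>c. f a b c)) \<Longrightarrow> (\<And>a c. clinear (\<lambda>b. f a b c)) \<Longrightarrow> (\<And>b c. clinear (\<lambda>a. f a b c))
    \<Longrightarrow> trilin f"
  by (simp add: trilin_def)

named_theorems clin

text \<open>Of the last two rules, \<open>clinear_tsum\<close> treats a variable in the summand and
  \<open>clinear_tsum_arg'\<close> a variable in the tensor summed over.\<close>

lemmas [clin] = bilinI trilinI clinear_ident clinear_add clinear_scale clinear_scale_left
  clinear_times_left clinear_times_right clinear_tensor_left clinear_tensor_right clinear_tsum
  clinear_tsum_arg'

lemma tsum_pure: "bilin f \<Longrightarrow> tsum (a \<otimes> b) f = f a b"
  by (simp add: tensor_lift_pure bilin_balanced flip: bilin_tsum)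

lemma tsum_tsum: "bilin g \<Longrightarrow> tsum (tsum t f) g = tsum t (\<lambda>a b. tsum (f a b) g)"
  by (rule tsum_clinear[of "\<lambda>t. tsum t g"]) (rule clinear_tsum_arg)

lemma tsum_cong: "(\<And>a b. f a b = g a b) \<Longrightarrow> tsum t f = tsum t g"
  by presburger

lemma tsum_mult:
  assumes "bilin g"
  shows "tsum (s * t) g = tsum s (\<lambda>a b. tsum t (\<lambda>c d. g (a * c) (b * d)))"
proof -
  have "s * t = tsum s (\<lambda>a b. tsum t (\<lambda>c d. (a * c) \<otimes> (b * d)))"
  proof -
    have "s * t = tsum s (\<lambda>a b. a \<otimes> b) * tsum t (\<lambda>c d. c \<otimes> d)" by simp
    also have "\<dots> = tsum s (\<lambda>a b. tsum t (\<lambda>c d. (a * c) \<otimes> (b * d)))"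
      by (simp only: tsum_mult_right) (simp only: tsum_mult_left times_tensor_pure)
    finally show ?thesis .
  qed
  then show ?thesis by (simp add: tsum_tsum tsum_pure assms)
qed

lemma tensor_times: "s * t = tsum s (\<lambda>a b. tsum t (\<lambda>c d. (a * c) \<otimes> (b * d)))"
  using tsum_mult[of "\<lambda>a b. a \<otimes> b" s t] by (simp add: clin)

lemma trilin_bilin:
  assumes "trilin F"
  shows "bilin (\<lambda>a s. tsum s (\<lambda>b c. F a b c))" "bilin (\<lambda>s c. tsum s (\<lambda>a b. F a b c))"
proof -
  have 1: "bilin (F a)" "clinear (\<lambda>a. F a b c)" "bilin (\<lambda>a b. F a b c)" "clinear (\<lambda>c. F a b c)" for a b c
    using assms by (auto simp: trilin_def bilin_def)
  show "bilin (\<lambda>a s. tsum s (\<lambda>b c. F a b c))" "bilin (\<lambda>s c. tsum s (\<lambda>a b. F a b c))"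
    by (intro clin 1)+
qed

lemma tensor_map_tsum:
  "clinear f \<Longrightarrow> clinear g \<Longrightarrow> tensor_map f g t = tsum t (\<lambda>a b. f a \<otimes> g b)"
  by (simp add: tensor_map_def balanced_tsum balanced_tensor_map)

lemma tensor_map_tsum_antilinear:
  "antilinear f \<Longrightarrow> antilinear g \<Longrightarrow> tensor_map f g t = tsum t (\<lambda>a b. f a \<otimes> g b)"
  by (simp add: tensor_map_def balanced_tsum balanced_tensor_map)

lemma tensor_swap_tsum: "tensor_swap t = tsum t (\<lambda>a b. b \<otimes> a)"
  unfolding tensor_swap_def by (rule bilin_tsum) (intro clin)

lemma tensor_assoc_tsum: "tensor_assoc t = tsum t (\<lambda>s c. tsum s (\<lambda>a b. a \<otimes> b \<otimes> c))"
proof -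
  have "trilin (\<lambda>a b c. a \<otimes> b \<otimes> c)" by (intro clin)
  from trilin_bilin(2)[OF this] have "bilin (\<lambda>s c. tsum s (\<lambda>a b. a \<otimes> b \<otimes> c))" .
  then show ?thesis
    unfolding tensor_assoc_def balanced_tsum[OF balanced_assoc_inner] by (rule bilin_tsum)
qed

text \<open>Removes \<open>tensor_assoc\<close> from coassociativity and the first hexagon, so that
  later computations never mention bracketing.\<close>

lemma tsum_assoc:
  assumes "trilin F"
  shows "tsum (tensor_assoc t) (\<lambda>a s. tsum s (\<lambda>b c. F a b c)) = tsum t (\<lambda>s c. tsum s (\<lambda>a b. F a b c))"
proof -
  have "bilin (F a)" for a using assms by (auto simp: trilin_def bilin_def)
  with trilin_bilin(1)[OF assms] show ?thesis
    by (simp add: tensor_assoc_tsum tsum_tsum tsum_pure)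
qed

section \<open>Convolution and the antipode\<close>

lemma left_unitor_tsum: "left_unitor t = tsum t (\<lambda>z a. z *\<^sub>C a)"
  unfolding left_unitor_def by (rule bilin_tsum) (intro clin)

lemma right_unitor_tsum: "right_unitor t = tsum t (\<lambda>a z. z *\<^sub>C a)"
  unfolding right_unitor_def by (rule bilin_tsum) (intro clin)

lemma clinear_id: "clinear id"
  by (simp add: clinear_iff)

lemma bilin_scale: "bilin (\<lambda>z a. z *\<^sub>C a)" "bilin (\<lambda>a z. z *\<^sub>C a)"
  by (intro clin)+

context hopf_algebra
begin

lemma clinear_coprod [clin]: "clinear f \<Longrightarrow> clinear (\<lambda>x. \<Delta> (f x))"
  by (rule clinear_comp[OF coprod_linear])

lemma clinear_counit [clin]: "clinear f \<Longrightarrow> clinear (\<lambda>x. \<epsilon> (f x))"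
  by (rule clinear_comp[OF counit_linear])

lemma clinear_antipode [clin]: "clinear f \<Longrightarrow> clinear (\<lambda>x. S (f x))"
  by (rule clinear_comp[OF antipode_linear])

lemma tsum_coassoc:
  assumes "trilin F"
  shows "tsum (\<Delta> h) (\<lambda>a s. tsum (\<Delta> a) (\<lambda>b c. F b c s)) = tsum (\<Delta> h) (\<lambda>a s. tsum (\<Delta> s) (\<lambda>b c. F a b c))"
proof -
  have "tsum (\<Delta> h) (\<lambda>a s. tsum (\<Delta> a) (\<lambda>b c. F b c s))
      = tsum (tensor_map \<Delta> id (\<Delta> h)) (\<lambda>a s. tsum a (\<lambda>b c. F b c s))"
    by (simp add: tensor_map_tsum clinear_id coprod_linear tsum_tsum tsum_pure trilin_bilin[OF assms])
  also have "\<dots> = tsum (tensor_map id \<Delta> (\<Delta> h)) (\<lambda>a s. tsum s (\<lambda>b c. F a b c))"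
    by (simp add: tsum_assoc[OF assms, symmetric] coassoc)
  also have "\<dots> = tsum (\<Delta> h) (\<lambda>a s. tsum (\<Delta> s) (\<lambda>b c. F a b c))"
    by (simp add: tensor_map_tsum clinear_id coprod_linear tsum_tsum tsum_pure trilin_bilin[OF assms])
  finally show ?thesis .
qed

lemma tsum_counit_left: "clinear f \<Longrightarrow> tsum (\<Delta> h) (\<lambda>a b. \<epsilon> a *\<^sub>C f b) = f h"
proof -
  assume f: "clinear f"
  have "tsum (\<Delta> h) (\<lambda>a b. \<epsilon> a *\<^sub>C b) = h"
    using counit_left[of h]
    by (simp add: tensor_map_tsum clinear_id counit_linear left_unitor_tsum tsum_tsum tsum_pure bilin_scale)
  from arg_cong[OF this, of f] show ?thesis
    using f by (simp add: tsum_clinear) (simp add: clinear_iff)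
qed

lemma tsum_counit_right: "clinear f \<Longrightarrow> tsum (\<Delta> h) (\<lambda>a b. \<epsilon> b *\<^sub>C f a) = f h"
proof -
  assume f: "clinear f"
  have "tsum (\<Delta> h) (\<lambda>a b. \<epsilon> b *\<^sub>C a) = h"
    using counit_right[of h]
    by (simp add: tensor_map_tsum clinear_id counit_linear right_unitor_tsum tsum_tsum tsum_pure bilin_scale)
  from arg_cong[OF this, of f] show ?thesis
    using f by (simp add: tsum_clinear) (simp add: clinear_iff)
qed

lemma tsum_antipode_left: "tsum (\<Delta> h) (\<lambda>a b. S a * b) = \<epsilon> h *\<^sub>C 1"
  by (subst antipode_left[symmetric], rule bilin_tsum[symmetric]) (intro clin)

lemma tsum_antipode_right: "tsum (\<Delta> h) (\<lambda>a b. a * S b) = \<epsilon> h *\<^sub>C 1"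
  by (subst antipode_right[symmetric], rule bilin_tsum[symmetric]) (intro clin)

lemma tsum_coprod_mult:
  "bilin f \<Longrightarrow> tsum (\<Delta> (g * h)) f = tsum (\<Delta> g) (\<lambda>a b. tsum (\<Delta> h) (\<lambda>c d. f (a * c) (b * d)))"
  by (simp add: coprod_mult tsum_mult)

text \<open>In the convolution algebra of linear maps from \<open>H\<close> to an algebra, a factor
  \<phi> with right inverse \<psi> can be cancelled. Every uniqueness argument for antipodes and for
  adjoint actions below is an instance.\<close>

lemma convolution_cancel_right:
  fixes \<phi> \<psi> :: "'h \<Rightarrow> 'a::complex_algebra_1"
  assumes lin: "clinear f" "clinear \<phi>" "clinear \<psi>"
    and inv: "\<And>h. tsum (\<Delta> h) (\<lambda>a b. \<phi> a * \<psi> b) = \<epsilon> h *\<^sub>C 1"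
    and eq: "\<And>h. tsum (\<Delta> h) (\<lambda>a b. f a * \<phi> b) = k h"
  shows "f h = tsum (\<Delta> h) (\<lambda>a b. k a * \<psi> b)"
proof -
  have c: "clinear (\<lambda>x. f (g x))" "clinear (\<lambda>x. \<phi> (g x))" "clinear (\<lambda>x. \<psi> (g x))" if "clinear g" for g
    using that lin by (auto intro: clinear_comp)
  have "f h = tsum (\<Delta> h) (\<lambda>a b. \<epsilon> b *\<^sub>C f a)"
    by (simp add: tsum_counit_right lin)
  also have "\<dots> = tsum (\<Delta> h) (\<lambda>a s. tsum (\<Delta> s) (\<lambda>b c. f a * \<phi> b * \<psi> c))"
    by (simp add: mult.assoc inv flip: tsum_mult_left)
  also have "\<dots> = tsum (\<Delta> h) (\<lambda>a s. tsum (\<Delta> a) (\<lambda>b c. f b * \<phi> c * \<psi> s))"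
    by (rule tsum_coassoc[symmetric]) (intro clin c)
  also have "\<dots> = tsum (\<Delta> h) (\<lambda>a b. k a * \<psi> b)"
    by (simp add: eq flip: tsum_mult_right)
  finally show ?thesis .
qed

text \<open>The usual argument is uniqueness of the convolution inverse of multiplication on
  \<open>H \<otimes> H\<close>. Here the two variables are cancelled in turn: \<open>A\<close> is
  the antipode axiom for \<open>g * h\<close>, \<open>B\<close> cancels in \<open>h\<close> with
  \<open>g\<close> fixed, and the final step cancels in \<open>g\<close>.\<close>

lemma antipode_mult: "S (g * h) = S h * S g"
proof -
  have A: "tsum (\<Delta> h) (\<lambda>c d. tsum (\<Delta> g) (\<lambda>a b. S (a * c) * b) * d) = \<epsilon> g *\<^sub>C \<epsilon> h *\<^sub>C 1" for g h
  proof -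
    have "tsum (\<Delta> (g * h)) (\<lambda>a b. S a * b) = tsum (\<Delta> h) (\<lambda>c d. tsum (\<Delta> g) (\<lambda>a b. S (a * c) * (b * d)))"
      by (subst tsum_commute, rule tsum_coprod_mult) (intro clin)
    then show ?thesis
      by (simp add: tsum_antipode_left counit_mult tsum_mult_right mult.assoc)
  qed
  have B: "tsum (\<Delta> g) (\<lambda>a b. S (a * h) * b) = \<epsilon> g *\<^sub>C S h" for g h
  proof -
    have "tsum (\<Delta> g) (\<lambda>a b. S (a * h) * b) = tsum (\<Delta> h) (\<lambda>c d. (\<epsilon> g *\<^sub>C \<epsilon> c *\<^sub>C 1) * S d)"
      by (rule convolution_cancel_right[where \<phi> = "\<lambda>x. x" and \<psi> = S and f = "\<lambda>h. tsum (\<Delta> g) (\<lambda>a b. S (a * h) * b)"])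
        (intro clin tsum_antipode_right A)+
    also have "\<dots> = \<epsilon> g *\<^sub>C S h"
    proof -
      have "tsum (\<Delta> h) (\<lambda>c d. \<epsilon> c *\<^sub>C S d) = S h"
        by (rule tsum_counit_left) (rule antipode_linear)
      from arg_cong[OF this, of "(*\<^sub>C) (\<epsilon> g)"] show ?thesis by (simp add: tsum_scaleC)
    qed
    finally show ?thesis .
  qed
  have "S (g * h) = tsum (\<Delta> g) (\<lambda>a b. (\<epsilon> a *\<^sub>C S h) * S b)"
    by (rule convolution_cancel_right[where \<phi> = "\<lambda>x. x" and \<psi> = S and f = "\<lambda>g. S (g * h)"])
      (intro clin tsum_antipode_right B)+
  also have "\<dots> = S h * S g"
    using tsum_counit_left[of "\<lambda>x. S h * S x" g]
    by (simp add: clinear_times_left[OF antipode_linear])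
  finally show ?thesis .
qed

lemma bilin_antipode: "bilin (\<lambda>a b. S a * b)"
  by (intro clin)

lemma antipode_one: "S 1 = 1"
  using tsum_antipode_left[of 1]
  by (simp add: coprod_one one_tensor_def tsum_pure[OF bilin_antipode] counit_one)

lemma counit_antipode: "\<epsilon> (S h) = \<epsilon> h"
proof -
  have "\<epsilon> (S h) = tsum (\<Delta> h) (\<lambda>a b. \<epsilon> b *\<^sub>C \<epsilon> (S a))"
    by (rule tsum_counit_right[symmetric]) (intro clin)
  also have "\<dots> = \<epsilon> (tsum (\<Delta> h) (\<lambda>a b. S a * b))"
    by (simp add: tsum_clinear[OF counit_linear] counit_mult mult.commute)
  also have "\<dots> = \<epsilon> h"
    using counit_linear by (simp add: tsum_antipode_left clinear_iff counit_one)
  finally show ?thesis .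
qed

text \<open>Both sides are convolution inverses of \<Delta>: \<open>inv\<close> makes the flipped
  formula a right inverse, \<open>inv'\<close> makes \<open>\<Delta> \<circ> S\<close> a left
  inverse.\<close>

lemma coprod_antipode: "\<Delta> (S h) = tsum (\<Delta> h) (\<lambda>a b. S b \<otimes> S a)"
proof -
  have inv: "tsum (\<Delta> h) (\<lambda>a b. \<Delta> a * tsum (\<Delta> b) (\<lambda>c d. S d \<otimes> S c)) = \<epsilon> h *\<^sub>C 1" for h
  proof -
    have tri: "trilin (\<lambda>b c d. (a * S d) \<otimes> (b * S c))" for a
      by (intro clin)
    have "tsum (\<Delta> h) (\<lambda>a b. \<Delta> a * tsum (\<Delta> b) (\<lambda>c d. S d \<otimes> S c))
        = tsum (\<Delta> h) (\<lambda>s t. tsum (\<Delta> s) (\<lambda>a b. tsum (\<Delta> t) (\<lambda>c d. (a * S d) \<otimes> (b * S c))))"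
    proof (rule tsum_cong)
      fix s t
      have "\<Delta> s * tsum (\<Delta> t) (\<lambda>c d. S d \<otimes> S c) = tsum (\<Delta> s) (\<lambda>a b. a \<otimes> b) * tsum (\<Delta> t) (\<lambda>c d. S d \<otimes> S c)"
        by simp
      also have "\<dots> = tsum (\<Delta> s) (\<lambda>a b. tsum (\<Delta> t) (\<lambda>c d. (a * S d) \<otimes> (b * S c)))"
        by (simp only: tsum_mult_right) (simp only: tsum_mult_left times_tensor_pure)
      finally show "\<Delta> s * tsum (\<Delta> t) (\<lambda>c d. S d \<otimes> S c)
          = tsum (\<Delta> s) (\<lambda>a b. tsum (\<Delta> t) (\<lambda>c d. (a * S d) \<otimes> (b * S c)))" .
    qed
    also have "\<dots> = tsum (\<Delta> h) (\<lambda>a s. tsum (\<Delta> s) (\<lambda>b t. tsum (\<Delta> t) (\<lambda>c d. (a * S d) \<otimes> (b * S c))))"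
      by (rule tsum_coassoc[where F = "\<lambda>a b t. tsum (\<Delta> t) (\<lambda>c d. (a * S d) \<otimes> (b * S c))"]) (intro clin)
    also have "\<dots> = tsum (\<Delta> h) (\<lambda>a s. tsum (\<Delta> s) (\<lambda>t d. tsum (\<Delta> t) (\<lambda>b c. (a * S d) \<otimes> (b * S c))))"
      by (simp add: tsum_coassoc[OF tri])
    also have "\<dots> = tsum (\<Delta> h) (\<lambda>a s. (a * S s) \<otimes> 1)"
    proof (rule tsum_cong)
      fix a s
      have "tsum (\<Delta> s) (\<lambda>t d. tsum (\<Delta> t) (\<lambda>b c. (a * S d) \<otimes> (b * S c)))
          = tsum (\<Delta> s) (\<lambda>t d. \<epsilon> t *\<^sub>C ((a * S d) \<otimes> 1))"
        by (simp add: tsum_antipode_right pure_tensor_scaleC_right flip: tsum_tensor_left)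
      also have "\<dots> = (a * S s) \<otimes> 1"
        by (rule tsum_counit_left[of "\<lambda>d. (a * S d) \<otimes> 1"]) (intro clin)
      finally show "tsum (\<Delta> s) (\<lambda>t d. tsum (\<Delta> t) (\<lambda>b c. (a * S d) \<otimes> (b * S c))) = (a * S s) \<otimes> 1" .
    qed
    also have "\<dots> = \<epsilon> h *\<^sub>C 1"
      by (simp add: tsum_antipode_right pure_tensor_scaleC_left one_tensor_def flip: tsum_tensor_right)
    finally show ?thesis .
  qed
  have cl: "clinear (\<lambda>b. tsum (\<Delta> b) (\<lambda>c d. S d \<otimes> S c))"
    by (intro clin)
  have inv': "tsum (\<Delta> h) (\<lambda>a b. \<Delta> (S a) * \<Delta> b) = \<epsilon> h *\<^sub>C 1" for h
    using arg_cong[OF tsum_antipode_left[of h], of \<Delta>] coprod_linear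
    by (simp add: tsum_clinear coprod_mult) (simp add: clinear_iff coprod_one)
  have "\<Delta> (S h) = tsum (\<Delta> h) (\<lambda>a b. (\<epsilon> a *\<^sub>C 1) * tsum (\<Delta> b) (\<lambda>c d. S d \<otimes> S c))"
    by (rule convolution_cancel_right[where \<phi> = \<Delta> and \<psi> = "\<lambda>b. tsum (\<Delta> b) (\<lambda>c d. S d \<otimes> S c)" and f = "\<lambda>h. \<Delta> (S h)"])
      (intro clin coprod_linear inv inv')+
  also have "\<dots> = tsum (\<Delta> h) (\<lambda>a b. S b \<otimes> S a)"
    by (simp add: tsum_counit_left[of "\<lambda>b. tsum (\<Delta> b) (\<lambda>c d. S d \<otimes> S c)"] cl)
  finally show ?thesis .
qed

end

section \<open>Algebra maps and the adjoint action\<close>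

definition alg_hom :: "('a::complex_algebra_1 \<Rightarrow> 'b::complex_algebra_1) \<Rightarrow> bool" where
  "alg_hom \<phi> \<longleftrightarrow> clinear \<phi> \<and> \<phi> 1 = 1 \<and> (\<forall>g h. \<phi> (g * h) = \<phi> g * \<phi> h)"

lemma alg_hom_clinear: "alg_hom \<phi> \<Longrightarrow> clinear \<phi>"
  and alg_hom_one: "alg_hom \<phi> \<Longrightarrow> \<phi> 1 = 1"
  and alg_hom_mult: "alg_hom \<phi> \<Longrightarrow> \<phi> (g * h) = \<phi> g * \<phi> h"
  by (simp_all add: alg_hom_def)

lemma clinear_alg_hom: "alg_hom \<phi> \<Longrightarrow> clinear f \<Longrightarrow> clinear (\<lambda>x. \<phi> (f x))"
  by (rule clinear_comp[OF alg_hom_clinear])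

lemma alg_hom_scaleC: "alg_hom \<phi> \<Longrightarrow> \<phi> (c *\<^sub>C x) = c *\<^sub>C \<phi> x"
  by (simp add: alg_hom_def clinear_iff)

lemma alg_hom_tsum: "alg_hom \<phi> \<Longrightarrow> \<phi> (tsum t f) = tsum t (\<lambda>a b. \<phi> (f a b))"
  by (rule tsum_clinear[OF alg_hom_clinear])

lemma alg_hom_ident: "alg_hom (\<lambda>x. x)"
  by (simp add: alg_hom_def clinear_ident)

context hopf_algebra
begin

lemma alg_hom_coprod: "alg_hom \<Delta>"
  by (simp add: alg_hom_def coprod_linear coprod_one coprod_mult)

text \<open>The adjoint action pulled back along an algebra map \<phi>. The identity gives the
  action of \<open>H\<close> on its transmutation; \<Delta> gives the action of \<open>H\<close> on
  \<open>H \<otimes> H\<close> that corresponds under \<Phi> to the tensor product action.\<close>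

definition ad :: "('h \<Rightarrow> 'a::complex_algebra_1) \<Rightarrow> 'h \<Rightarrow> 'a \<Rightarrow> 'a" where
  "ad \<phi> h x = tsum (\<Delta> h) (\<lambda>a b. \<phi> a * x * \<phi> (S b))"

lemma clinear_ad_arg: "clinear f \<Longrightarrow> clinear (\<lambda>x. ad \<phi> h (f x))"
  unfolding ad_def by (intro clin)

lemma clinear_ad: "alg_hom \<phi> \<Longrightarrow> clinear f \<Longrightarrow> clinear (\<lambda>x. ad \<phi> (f x) y)"
  unfolding ad_def by (intro clin clinear_alg_hom[of \<phi>])

lemma adjoint_act_eq: "adjoint_act \<Delta> S h = ad (\<lambda>x. x) h"
proof
  fix b
  show "adjoint_act \<Delta> S h b = ad (\<lambda>x. x) h b"
    unfolding adjoint_act_def ad_def by (rule bilin_tsum) (intro clin)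
qed

lemma alg_hom_antipode_right:
  "alg_hom \<phi> \<Longrightarrow> tsum (\<Delta> h) (\<lambda>a b. \<phi> a * \<phi> (S b)) = \<epsilon> h *\<^sub>C 1"
  using arg_cong[OF tsum_antipode_right[of h], of \<phi>]
  by (simp add: alg_hom_scaleC alg_hom_one alg_hom_mult alg_hom_tsum)

lemma alg_hom_antipode_left:
  "alg_hom \<phi> \<Longrightarrow> tsum (\<Delta> h) (\<lambda>a b. \<phi> (S a) * \<phi> b) = \<epsilon> h *\<^sub>C 1"
  using arg_cong[OF tsum_antipode_left[of h], of \<phi>]
  by (simp add: alg_hom_scaleC alg_hom_one alg_hom_mult alg_hom_tsum)

lemma ad_one:
  assumes "alg_hom \<phi>"
  shows "ad \<phi> 1 x = x"
proof -
  have "bilin (\<lambda>a b. \<phi> a * x * \<phi> (S b))"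
    by (intro clin clinear_alg_hom[OF assms])
  then show ?thesis
    by (simp add: ad_def coprod_one one_tensor_def tsum_pure antipode_one alg_hom_one assms)
qed

lemma ad_unit: "alg_hom \<phi> \<Longrightarrow> ad \<phi> h 1 = \<epsilon> h *\<^sub>C 1"
  by (simp add: ad_def alg_hom_antipode_right)

lemma ad_mult:
  assumes "alg_hom \<phi>"
  shows "ad \<phi> (g * h) x = ad \<phi> g (ad \<phi> h x)"
proof -
  have "ad \<phi> (g * h) x = tsum (\<Delta> g) (\<lambda>a b. tsum (\<Delta> h) (\<lambda>c d. \<phi> (a * c) * x * \<phi> (S (b * d))))"
    unfolding ad_def by (rule tsum_coprod_mult) (intro clin clinear_alg_hom[OF assms])
  then show ?thesis
    by (simp add: ad_def tsum_mult_left tsum_mult_right antipode_mult alg_hom_mult[OF assms] mult.assoc)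
qed

text \<open>The antipode inside the action meets \<open>\<phi> b\<close> and disappears. By
  \<open>ad_eqI\<close> this identity characterizes the action, so adjoint actions can be compared
  without expanding any antipode.\<close>

lemma ad_cancel:
  assumes "alg_hom \<phi>"
  shows "tsum (\<Delta> h) (\<lambda>a b. ad \<phi> a x * \<phi> b) = \<phi> h * x"
proof -
  have "tsum (\<Delta> h) (\<lambda>a b. ad \<phi> a x * \<phi> b) = tsum (\<Delta> h) (\<lambda>s c. tsum (\<Delta> s) (\<lambda>a b. \<phi> a * x * (\<phi> (S b) * \<phi> c)))"
    by (simp add: ad_def tsum_mult_right mult.assoc)
  also have "\<dots> = tsum (\<Delta> h) (\<lambda>a s. tsum (\<Delta> s) (\<lambda>b c. \<phi> a * x * (\<phi> (S b) * \<phi> c)))"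
    by (rule tsum_coassoc) (intro clin clinear_alg_hom[OF assms])
  also have "\<dots> = tsum (\<Delta> h) (\<lambda>a s. \<epsilon> s *\<^sub>C (\<phi> a * x))"
    by (simp add: alg_hom_antipode_left[OF assms] flip: tsum_mult_left)
  also have "\<dots> = \<phi> h * x"
    by (rule tsum_counit_right[where f = "\<lambda>a. \<phi> a * x"]) (intro clin clinear_alg_hom[OF assms])
  finally show ?thesis .
qed

lemma ad_eqI:
  assumes "alg_hom \<phi>" "clinear f" "\<And>h. tsum (\<Delta> h) (\<lambda>a b. f a * \<phi> b) = \<phi> h * x"
  shows "f h = ad \<phi> h x"
  unfolding ad_def
  by (rule convolution_cancel_right[where \<phi> = \<phi> and \<psi> = "\<lambda>x. \<phi> (S x)"])
    (use assms in \<open>simp_all add: clinear_alg_hom[OF assms(1) antipode_linear] alg_hom_antipode_right alg_hom_clinear\<close>)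

lemma ad_times:
  assumes "alg_hom \<phi>"
  shows "ad \<phi> h (x * y) = tsum (\<Delta> h) (\<lambda>a b. ad \<phi> a x * ad \<phi> b y)"
proof (rule ad_eqI[OF assms, symmetric])
  show "clinear (\<lambda>h. tsum (\<Delta> h) (\<lambda>a b. ad \<phi> a x * ad \<phi> b y))"
    by (intro clin clinear_ad assms)
  fix h
  have "tsum (\<Delta> h) (\<lambda>s c. tsum (\<Delta> s) (\<lambda>a b. ad \<phi> a x * ad \<phi> b y) * \<phi> c)
      = tsum (\<Delta> h) (\<lambda>s c. tsum (\<Delta> s) (\<lambda>a b. ad \<phi> a x * (ad \<phi> b y * \<phi> c)))"
    by (simp add: tsum_mult_right mult.assoc)
  also have "\<dots> = tsum (\<Delta> h) (\<lambda>a s. tsum (\<Delta> s) (\<lambda>b c. ad \<phi> a x * (ad \<phi> b y * \<phi> c)))"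
    by (rule tsum_coassoc) (intro clin clinear_ad assms clinear_alg_hom[OF assms])
  also have "\<dots> = tsum (\<Delta> h) (\<lambda>a s. ad \<phi> a x * (\<phi> s * y))"
    by (simp only: ad_cancel[OF assms] flip: tsum_mult_left)
  also have "\<dots> = tsum (\<Delta> h) (\<lambda>a s. ad \<phi> a x * \<phi> s) * y"
    by (simp only: tsum_mult_right mult.assoc)
  also have "\<dots> = \<phi> h * (x * y)"
    by (simp only: ad_cancel[OF assms] mult.assoc)
  finally show "tsum (\<Delta> h) (\<lambda>s c. tsum (\<Delta> s) (\<lambda>a b. ad \<phi> a x * ad \<phi> b y) * \<phi> c) = \<phi> h * (x * y)" .
qed

lemma alg_hom_ad:
  "alg_hom \<psi> \<Longrightarrow> \<psi> (ad \<phi> h x) = ad (\<lambda>x. \<psi> (\<phi> x)) h (\<psi> x)"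
  by (simp add: ad_def alg_hom_tsum alg_hom_mult)

lemma counit_ad: "\<epsilon> (ad (\<lambda>x. x) h b) = \<epsilon> h * \<epsilon> b"
proof -
  have "alg_hom \<epsilon>"
    by (simp add: alg_hom_def counit_linear counit_one counit_mult)
  note e = this
  have "\<epsilon> (ad (\<lambda>x. x) h b) = ad \<epsilon> h (\<epsilon> b * 1)"
    by (simp add: alg_hom_ad[OF e])
  also have "\<dots> = tsum (\<Delta> h) (\<lambda>a c. \<epsilon> c *\<^sub>C (\<epsilon> a * \<epsilon> b))"
    by (simp add: ad_def counit_antipode mult.commute)
  also have "\<dots> = \<epsilon> h * \<epsilon> b"
    by (rule tsum_counit_right[where f = "\<lambda>a. \<epsilon> a * \<epsilon> b"]) (intro clin)
  finally show ?thesis .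
qed

text \<open>Expanded, the second leg is the third-by-inner product \<open>h_(2) S(h_(3))\<close>,
  which collapses to the counit and leaves the outer factors \<open>h_(1) a S(h_(2))\<close> in the
  first leg. No such collapse occurs for \<open>1 \<otimes> b\<close>, where \<open>b\<close> sits
  between the inner factors.\<close>

lemma ad_coprod_tensor_one: "ad \<Delta> h (a \<otimes> 1) = ad (\<lambda>x. x) h a \<otimes> 1"
proof (rule ad_eqI[OF alg_hom_coprod, symmetric])
  show "clinear (\<lambda>h. ad (\<lambda>x. x) h a \<otimes> (1::'h))"
    by (intro clin clinear_ad alg_hom_ident)
  fix h
  have D: "(x \<otimes> 1) * \<Delta> y = tsum (\<Delta> y) (\<lambda>c d. (x * c) \<otimes> d)" for x y :: 'h
    using tsum_mult_left[of "x \<otimes> 1" "\<Delta> y" "\<lambda>c d. c \<otimes> d"] by (simp add: times_tensor_pure)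
  have "tsum (\<Delta> h) (\<lambda>x y. (ad (\<lambda>x. x) x a \<otimes> 1) * \<Delta> y)
      = tsum (\<Delta> h) (\<lambda>x s. tsum (\<Delta> s) (\<lambda>c d. (ad (\<lambda>x. x) x a * c) \<otimes> d))"
    by (simp add: D)
  also have "\<dots> = tsum (\<Delta> h) (\<lambda>s d. tsum (\<Delta> s) (\<lambda>x c. (ad (\<lambda>x. x) x a * c) \<otimes> d))"
    by (rule tsum_coassoc[symmetric]) (intro clin clinear_ad alg_hom_ident)
  also have "\<dots> = tsum (\<Delta> h) (\<lambda>s d. (s \<otimes> d) * (a \<otimes> 1))"
    by (simp add: ad_cancel[OF alg_hom_ident] times_tensor_pure flip: tsum_tensor_right)
  also have "\<dots> = \<Delta> h * (a \<otimes> 1)"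
    by (simp flip: tsum_mult_right)
  finally show "tsum (\<Delta> h) (\<lambda>x y. (ad (\<lambda>x. x) x a \<otimes> 1) * \<Delta> y) = \<Delta> h * (a \<otimes> 1)" .
qed

end

section \<open>The R-matrix\<close>

lemma leg12_tsum: "leg12 t = tsum t (\<lambda>a b. a \<otimes> b \<otimes> 1)"
  and leg13_tsum: "leg13 t = tsum t (\<lambda>a b. a \<otimes> 1 \<otimes> b)"
  and leg23_tsum: "leg23 t = tsum t (\<lambda>a b. 1 \<otimes> a \<otimes> b)"
  unfolding leg12_def leg13_def leg23_def by (rule bilin_tsum, intro clin)+

lemma alg_homI_tsum:
  assumes "bilin f" "f 1 1 = 1" "\<And>a b c d. f (a * c) (b * d) = f a b * f c d"
  shows "alg_hom (\<lambda>t. tsum t f)"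
proof -
  have "tsum (s * t) f = tsum s f * tsum t f" for s t
    by (simp add: tsum_mult assms tsum_mult_right) (simp add: tsum_mult_left)
  then show ?thesis
    by (simp add: alg_hom_def clinear_tsum_arg assms one_tensor_def tsum_pure)
qed

lemma alg_hom_swap: "alg_hom tensor_swap"
proof -
  have "alg_hom (\<lambda>t::'a \<otimes> 'b. tsum t (\<lambda>a b. b \<otimes> a))"
    by (rule alg_homI_tsum) (intro clin, simp_all add: one_tensor_def times_tensor_pure)
  then show ?thesis by (simp add: tensor_swap_tsum[abs_def])
qed

context quasitriangular_star_hopf_algebra
begin

lemma R_inverse: "R * inverse_elt R = 1" "inverse_elt R * R = 1"
proof -
  obtain y where "R * y = 1" "y * R = 1"
    using R_invertible unfolding invertible_elt_def by blast
  then show "R * inverse_elt R = 1" "inverse_elt R * R = 1"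
    by (simp_all add: inverse_elt_eqI)
qed

lemma tsum_coprod_id_R:
  assumes "trilin F"
  shows "tsum R (\<lambda>a b. tsum (\<Delta> a) (\<lambda>c d. F c d b)) = tsum R (\<lambda>a b. tsum R (\<lambda>c d. F a c (b * d)))"
proof -
  have tri: "bilin (F a)" for a
    using assms by (auto simp: trilin_def bilin_def)
  have "leg13 R * leg23 R = tsum R (\<lambda>a b. tsum R (\<lambda>c d. a \<otimes> c \<otimes> (b * d)))"
    unfolding leg13_tsum leg23_tsum by (simp only: tsum_mult_right) (simp add: tsum_mult_left times_tensor_pure)
  note legs = this
  have "tsum R (\<lambda>a b. tsum (\<Delta> a) (\<lambda>c d. F c d b))
      = tsum (tensor_map \<Delta> id R) (\<lambda>a s. tsum a (\<lambda>b c. F b c s))"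
    by (simp add: tensor_map_tsum clinear_id coprod_linear tsum_tsum tsum_pure trilin_bilin[OF assms])
  also have "\<dots> = tsum (leg13 R * leg23 R) (\<lambda>a s. tsum s (\<lambda>b c. F a b c))"
    by (simp add: tsum_assoc[OF assms, symmetric] coprod_id_R)
  also have "\<dots> = tsum R (\<lambda>a b. tsum R (\<lambda>c d. F a c (b * d)))"
    by (simp add: legs tsum_tsum tsum_pure trilin_bilin[OF assms] tri)
  finally show ?thesis .
qed

lemma tsum_id_coprod_R:
  assumes "trilin F"
  shows "tsum R (\<lambda>a b. tsum (\<Delta> b) (\<lambda>c d. F a c d)) = tsum R (\<lambda>a b. tsum R (\<lambda>c d. F (a * c) d b))"
proof -
  have tri: "bilin (F a)" for a
    using assms by (auto simp: trilin_def bilin_def)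
  have "leg13 R * leg12 R = tsum R (\<lambda>a b. tsum R (\<lambda>c d. (a * c) \<otimes> d \<otimes> b))"
    unfolding leg13_tsum leg12_tsum by (simp only: tsum_mult_right) (simp add: tsum_mult_left times_tensor_pure)
  note legs = this
  have "tsum R (\<lambda>a b. tsum (\<Delta> b) (\<lambda>c d. F a c d))
      = tsum (tensor_map id \<Delta> R) (\<lambda>a s. tsum s (\<lambda>b c. F a b c))"
    by (simp add: tensor_map_tsum clinear_id coprod_linear tsum_tsum tsum_pure trilin_bilin[OF assms])
  also have "\<dots> = tsum R (\<lambda>a b. tsum R (\<lambda>c d. F (a * c) d b))"
    by (simp add: id_coprod_R legs tsum_tsum tsum_pure trilin_bilin[OF assms] tri)
  finally show ?thesis .
qed

lemma coprod_op_R: "tensor_swap (\<Delta> h) * R = R * \<Delta> h"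
  by (simp add: quasi_cocommutative mult.assoc R_inverse)

lemma tsum_coprod_op_R:
  assumes "bilin f"
  shows "tsum (\<Delta> h) (\<lambda>x y. tsum R (\<lambda>a b. f (y * a) (x * b)))
       = tsum (\<Delta> h) (\<lambda>x y. tsum R (\<lambda>a b. f (a * x) (b * y)))"
proof -
  have c: "clinear (\<lambda>x. f a (g x))" "clinear (\<lambda>x. f (g x) a)" if "clinear g" for a g
    using assms that by (auto simp: bilin_def intro: clinear_comp[of "f a"] clinear_comp[of "\<lambda>x. f x a"])
  have bil: "bilin (\<lambda>a b. tsum R (\<lambda>c d. f (a * c) (b * d)))"
    by (intro clin c)
  have "tsum (\<Delta> h) (\<lambda>x y. tsum R (\<lambda>a b. f (y * a) (x * b))) = tsum (tensor_swap (\<Delta> h) * R) f"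
    by (simp add: tsum_mult assms tensor_swap_tsum tsum_tsum bil tsum_pure)
  also have "\<dots> = tsum (\<Delta> h) (\<lambda>x y. tsum R (\<lambda>a b. f (a * x) (b * y)))"
    unfolding coprod_op_R by (subst tsum_commute) (simp add: tsum_mult assms)
  finally show ?thesis .
qed

text \<open>Applying \<epsilon> to the first leg of
  \<open>(\<Delta> \<otimes> id) R = R13 R23\<close> gives \<open>R = (1 \<otimes> e) R\<close>;
  cancelling the invertible \<open>R\<close> leaves \<open>e = 1\<close>.\<close>

lemma counit_R_left: "tsum R (\<lambda>a b. \<epsilon> a *\<^sub>C b) = 1"
proof -
  define e where "e = tsum R (\<lambda>a b. \<epsilon> a *\<^sub>C b)"
  have "R = tsum R (\<lambda>a b. tsum (\<Delta> a) (\<lambda>c d. \<epsilon> c *\<^sub>C (d \<otimes> b)))"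
    by (simp add: tsum_counit_left clinear_tensor_right clinear_ident)
  also have "\<dots> = tsum R (\<lambda>a b. tsum R (\<lambda>c d. \<epsilon> a *\<^sub>C (c \<otimes> (b * d))))"
    by (rule tsum_coprod_id_R) (intro clin)
  also have "\<dots> = (1 \<otimes> e) * tsum R (\<lambda>c d. c \<otimes> d)"
    unfolding e_def tsum_tensor_left
    by (simp only: tsum_mult_right) (simp add: tsum_mult_left pure_tensor_scaleC_right times_tensor_pure del: tsum_pure_tensor)
  finally have "(1 \<otimes> e) * R = R" by simp
  then have "(1 \<otimes> e) * (R * inverse_elt R) = R * inverse_elt R"
    by (simp only: mult.assoc[symmetric])
  then have "1 \<otimes> e = (1 \<otimes> 1 :: 'h \<otimes> 'h)"
    by (simp add: R_inverse times_tensor_pure flip: one_tensor_def)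
  from arg_cong[OF this, of "\<lambda>t. tsum t (\<lambda>a b. \<epsilon> a *\<^sub>C b)"]
  have "\<epsilon> 1 *\<^sub>C e = \<epsilon> 1 *\<^sub>C 1"
    by (subst (asm) (1 2) tsum_pure) (intro clin)
  then show ?thesis by (simp add: counit_one e_def)
qed

lemma counit_R_right: "tsum R (\<lambda>a b. \<epsilon> b *\<^sub>C a) = 1"
proof -
  define e where "e = tsum R (\<lambda>a b. \<epsilon> b *\<^sub>C a)"
  have "R = tsum R (\<lambda>a b. tsum (\<Delta> b) (\<lambda>c d. \<epsilon> d *\<^sub>C (a \<otimes> c)))"
    by (simp add: tsum_counit_right clinear_tensor_left clinear_ident)
  also have "\<dots> = tsum R (\<lambda>a b. tsum R (\<lambda>c d. \<epsilon> b *\<^sub>C ((a * c) \<otimes> d)))"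
    by (rule tsum_id_coprod_R) (intro clin)
  also have "\<dots> = (e \<otimes> 1) * tsum R (\<lambda>c d. c \<otimes> d)"
    unfolding e_def tsum_tensor_right
    by (simp only: tsum_mult_right) (simp add: tsum_mult_left pure_tensor_scaleC_left times_tensor_pure del: tsum_pure_tensor)
  finally have "(e \<otimes> 1) * R = R" by simp
  then have "(e \<otimes> 1) * (R * inverse_elt R) = R * inverse_elt R"
    by (simp only: mult.assoc[symmetric])
  then have "e \<otimes> 1 = (1 \<otimes> 1 :: 'h \<otimes> 'h)"
    by (simp add: R_inverse times_tensor_pure flip: one_tensor_def)
  from arg_cong[OF this, of "\<lambda>t. tsum t (\<lambda>a b. \<epsilon> b *\<^sub>C a)"]
  have "\<epsilon> 1 *\<^sub>C e = \<epsilon> 1 *\<^sub>C 1"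
    by (subst (asm) (1 2) tsum_pure) (intro clin)
  then show ?thesis by (simp add: counit_one e_def)
qed

text \<open>Read backwards, the first hexagon turns the product of \<open>(S \<otimes> id) R\<close>
  with \<open>R\<close> into \<open>S\<close> times identity on the legs of a coproduct, which
  collapses by the antipode axiom. A left inverse of an invertible element is its inverse.\<close>

lemma antipode_R: "tsum R (\<lambda>a b. S a \<otimes> b) = inverse_elt R"
proof -
  have "tsum R (\<lambda>a b. S a \<otimes> b) * tsum R (\<lambda>c d. c \<otimes> d)
      = tsum R (\<lambda>a b. tsum R (\<lambda>c d. (S a * c) \<otimes> (b * d)))"
    by (simp only: tsum_mult_right) (simp add: tsum_mult_left times_tensor_pure del: tsum_pure_tensor)
  also have "\<dots> = tsum R (\<lambda>a b. tsum (\<Delta> a) (\<lambda>c d. (S c * d) \<otimes> b))"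
    by (rule tsum_coprod_id_R[symmetric]) (intro clin)
  also have "\<dots> = 1 \<otimes> tsum R (\<lambda>a b. \<epsilon> a *\<^sub>C b)"
    by (simp add: tsum_antipode_left tsum_tensor_left pure_tensor_scaleC_left pure_tensor_scaleC_right
        flip: tsum_tensor_right)
  finally have "tsum R (\<lambda>a b. S a \<otimes> b) * R = 1"
    by (simp add: counit_R_left one_tensor_def)
  then have "tsum R (\<lambda>a b. S a \<otimes> b) * (R * inverse_elt R) = inverse_elt R"
    by (simp only: mult.assoc[symmetric] mult_1_left)
  then show ?thesis by (simp add: R_inverse)
qed

text \<open>\<open>(id \<otimes> S) R\<close> is the inverse of \<open>R\<close> in the tensor product of \<open>H\<close> with its opposite algebra.\<close>

lemma tsum_R_op_inverse:
  assumes "bilin f"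
  shows "tsum R (\<lambda>a b. tsum R (\<lambda>c d. f (a * c) (d * S b))) = f 1 1"
    and "tsum R (\<lambda>a b. tsum R (\<lambda>c d. f (a * c) (S d * b))) = f 1 1"
proof -
  have "tsum R (\<lambda>a b. tsum R (\<lambda>c d. (a * c) \<otimes> (d * S b))) = tsum R (\<lambda>a b. tsum (\<Delta> b) (\<lambda>c d. a \<otimes> (c * S d)))"
    by (rule tsum_id_coprod_R[symmetric]) (intro clin)
  also have "\<dots> = tsum R (\<lambda>a b. \<epsilon> b *\<^sub>C a) \<otimes> 1"
    by (simp add: tsum_antipode_right tsum_tensor_right pure_tensor_scaleC_left pure_tensor_scaleC_right
        flip: tsum_tensor_left)
  finally have "tsum (tsum R (\<lambda>a b. tsum R (\<lambda>c d. (a * c) \<otimes> (d * S b)))) f = tsum (1 \<otimes> 1) f"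
    by (simp add: counit_R_right)
  then show "tsum R (\<lambda>a b. tsum R (\<lambda>c d. f (a * c) (d * S b))) = f 1 1"
    by (simp add: tsum_tsum tsum_pure assms)
  have "tsum R (\<lambda>a b. tsum R (\<lambda>c d. (a * c) \<otimes> (S d * b))) = tsum R (\<lambda>a b. tsum (\<Delta> b) (\<lambda>c d. a \<otimes> (S c * d)))"
    by (rule tsum_id_coprod_R[symmetric]) (intro clin)
  also have "\<dots> = tsum R (\<lambda>a b. \<epsilon> b *\<^sub>C a) \<otimes> 1"
    by (simp add: tsum_antipode_left tsum_tensor_right pure_tensor_scaleC_left pure_tensor_scaleC_right
        flip: tsum_tensor_left)
  finally have "tsum (tsum R (\<lambda>a b. tsum R (\<lambda>c d. (a * c) \<otimes> (S d * b)))) f = tsum (1 \<otimes> 1) f"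
    by (simp add: counit_R_right)
  then show "tsum R (\<lambda>a b. tsum R (\<lambda>c d. f (a * c) (S d * b))) = f 1 1"
    by (simp add: tsum_tsum tsum_pure assms)
qed

lemma tsum_R_inverse:
  assumes "bilin f"
  shows "tsum R (\<lambda>a b. tsum R (\<lambda>c d. f (S a * c) (b * d))) = f 1 1"
    and "tsum R (\<lambda>a b. tsum R (\<lambda>c d. f (a * S c) (b * d))) = f 1 1"
proof -
  have c: "clinear (\<lambda>x. f a (g x))" "clinear (\<lambda>x. f (g x) a)" if "clinear g" for a g
    using assms that by (auto simp: bilin_def intro: clinear_comp[of "f a"] clinear_comp[of "\<lambda>x. f x a"])
  have bil: "bilin (\<lambda>a b. tsum R (\<lambda>c d. f (a * c) (b * d)))" "bilin (\<lambda>a b. f (c * a) (d * b))" for c d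
    by (intro clin c)+
  have "tsum (inverse_elt R * R) f = f 1 1" "tsum (R * inverse_elt R) f = f 1 1"
    by (simp_all add: R_inverse one_tensor_def tsum_pure assms)
  then show "tsum R (\<lambda>a b. tsum R (\<lambda>c d. f (S a * c) (b * d))) = f 1 1"
    and "tsum R (\<lambda>a b. tsum R (\<lambda>c d. f (a * S c) (b * d))) = f 1 1"
    by (simp_all add: tsum_mult assms tsum_tsum tsum_pure bil flip: antipode_R)
qed

text \<open>Multiplying on the left by the inverse \<open>(S \<otimes> id) R\<close> gives, since
  \<open>S\<close> reverses products, the image under \<open>S \<otimes> id\<close> of the inverse
  relation in \<open>H \<otimes> H^op\<close>, hence 1.\<close>

lemma antipode_antipode_R: "tsum R (\<lambda>a b. S a \<otimes> S b) = R"
proof -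
  have "inverse_elt R * tsum R (\<lambda>a b. S a \<otimes> S b) = tsum R (\<lambda>a b. tsum R (\<lambda>c d. (S c * S a) \<otimes> (d * S b)))"
    unfolding antipode_R[symmetric]
    by (simp only: tsum_mult_left) (simp only: tsum_mult_right times_tensor_pure)
  also have "\<dots> = tsum R (\<lambda>a b. tsum R (\<lambda>c d. S (a * c) \<otimes> (d * S b)))"
    by (simp add: antipode_mult)
  also have "\<dots> = S 1 \<otimes> 1"
    by (rule tsum_R_op_inverse(1)[where f = "\<lambda>x y. S x \<otimes> y"]) (intro clin)
  finally have "R * (inverse_elt R * tsum R (\<lambda>a b. S a \<otimes> S b)) = R"
    by (simp add: antipode_one flip: one_tensor_def)
  then show ?thesis by (simp add: R_inverse flip: mult.assoc)
qed

end

section \<open>Comparing the braided and the ordinary tensor product\<close>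

context quasitriangular_star_hopf_algebra
begin

text \<open>
  For modules \<open>V\<close>, \<open>W\<close> of \<open>H\<close> the element \<open>Phi (\<lambda>x. x) (a \<otimes> b)\<close> acts on \<open>V \<otimes> W\<close> by braiding \<open>b\<close> past \<open>V\<close>
  and then letting \<open>a\<close> act on \<open>V\<close> and \<open>b\<close> on \<open>W\<close>.  A general algebra map \<open>\<phi>\<close> is needed for \<open>\<phi> = \<Delta>\<close>,
  where \<open>W\<close> is itself a tensor product.
\<close>

definition Phi :: "('h \<Rightarrow> 'a::complex_algebra_1) \<Rightarrow> 'h \<otimes> 'a \<Rightarrow> 'h \<otimes> 'a" where
  "Phi \<phi> t = tsum t (\<lambda>a x. tsum R (\<lambda>r s. (a * s) \<otimes> ad \<phi> r x))"

definition Phi_inv :: "('h \<Rightarrow> 'a::complex_algebra_1) \<Rightarrow> 'h \<otimes> 'a \<Rightarrow> 'h \<otimes> 'a" where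
  "Phi_inv \<phi> t = tsum t (\<lambda>a x. tsum R (\<lambda>r s. (a * S s) \<otimes> ad \<phi> r x))"

definition Q :: "('h \<Rightarrow> 'a::complex_algebra_1) \<Rightarrow> 'h \<otimes> 'a" where
  "Q \<phi> = tsum R (\<lambda>r s. s \<otimes> \<phi> r)"

definition Q_inv :: "('h \<Rightarrow> 'a::complex_algebra_1) \<Rightarrow> 'h \<otimes> 'a" where
  "Q_inv \<phi> = tsum R (\<lambda>r s. s \<otimes> \<phi> (S r))"

lemma bilin_Phi: "bilin (\<lambda>a x. tsum R (\<lambda>r s. (a * s) \<otimes> ad \<phi> r x))"
  and bilin_Phi_inv: "bilin (\<lambda>a x. tsum R (\<lambda>r s. (a * S s) \<otimes> ad \<phi> r x))"
  by (intro clin clinear_ad_arg)+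

lemma clinear_Phi: "clinear f \<Longrightarrow> clinear (\<lambda>x. Phi \<phi> (f x))"
  unfolding Phi_def by (rule clinear_tsum_arg'[OF bilin_Phi])

lemma clinear_Phi_inv: "clinear f \<Longrightarrow> clinear (\<lambda>x. Phi_inv \<phi> (f x))"
  unfolding Phi_inv_def by (rule clinear_tsum_arg'[OF bilin_Phi_inv])

lemma Phi_pure: "Phi \<phi> (a \<otimes> x) = tsum R (\<lambda>r s. (a * s) \<otimes> ad \<phi> r x)"
  by (simp add: Phi_def tsum_pure bilin_Phi)

lemma Phi_inv_pure: "Phi_inv \<phi> (a \<otimes> x) = tsum R (\<lambda>r s. (a * S s) \<otimes> ad \<phi> r x)"
  by (simp add: Phi_inv_def tsum_pure bilin_Phi_inv)

lemma Phi_tsum: "Phi \<phi> (tsum t f) = tsum t (\<lambda>a b. Phi \<phi> (f a b))"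
  by (rule tsum_clinear[OF clinear_Phi[OF clinear_ident]])

lemma Phi_inv_tsum: "Phi_inv \<phi> (tsum t f) = tsum t (\<lambda>a b. Phi_inv \<phi> (f a b))"
  by (rule tsum_clinear[OF clinear_Phi_inv[OF clinear_ident]])

text \<open>Because \<open>ad\<close> is a left action and the first factor is multiplied from the
  right, the two copies of \<open>R\<close> combine as \<open>r' * r\<close> and
  \<open>s * S s'\<close>. This is the product in \<open>H \<otimes> H^op\<close>.\<close>

lemma Phi_inv_Phi:
  assumes "alg_hom \<phi>"
  shows "Phi_inv \<phi> (Phi \<phi> t) = t"
proof -
  have "Phi_inv \<phi> (Phi \<phi> (a \<otimes> x)) = a \<otimes> x" for a x
  proof -
    have "Phi_inv \<phi> (Phi \<phi> (a \<otimes> x)) = tsum R (\<lambda>r s. tsum R (\<lambda>r' s'. (a * (s * S s')) \<otimes> ad \<phi> (r' * r) x))"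
      by (simp add: Phi_pure Phi_inv_tsum Phi_inv_pure ad_mult[OF assms] mult.assoc)
    also have "\<dots> = tsum R (\<lambda>r' s'. tsum R (\<lambda>r s. (a * (s * S s')) \<otimes> ad \<phi> (r' * r) x))"
      by (rule tsum_commute)
    also have "\<dots> = (a * 1) \<otimes> ad \<phi> 1 x"
      by (rule tsum_R_op_inverse(1)[where f = "\<lambda>u v. (a * v) \<otimes> ad \<phi> u x"]) (intro clin clinear_ad assms)
    finally show ?thesis by (simp add: ad_one assms)
  qed
  then have "tsum t (\<lambda>a b. Phi_inv \<phi> (Phi \<phi> (a \<otimes> b))) = t" by simp
  then show ?thesis by (simp flip: Phi_tsum Phi_inv_tsum)
qed

lemma Phi_Phi_inv:
  assumes "alg_hom \<phi>"
  shows "Phi \<phi> (Phi_inv \<phi> t) = t"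
proof -
  have "Phi \<phi> (Phi_inv \<phi> (a \<otimes> x)) = a \<otimes> x" for a x
  proof -
    have "Phi \<phi> (Phi_inv \<phi> (a \<otimes> x)) = tsum R (\<lambda>r s. tsum R (\<lambda>r' s'. (a * (S s * s')) \<otimes> ad \<phi> (r' * r) x))"
      by (simp add: Phi_pure Phi_tsum Phi_inv_pure ad_mult[OF assms] mult.assoc)
    also have "\<dots> = tsum R (\<lambda>r' s'. tsum R (\<lambda>r s. (a * (S s * s')) \<otimes> ad \<phi> (r' * r) x))"
      by (rule tsum_commute)
    also have "\<dots> = (a * 1) \<otimes> ad \<phi> 1 x"
      by (rule tsum_R_op_inverse(2)[where f = "\<lambda>u v. (a * v) \<otimes> ad \<phi> u x"]) (intro clin clinear_ad assms)
    finally show ?thesis by (simp add: ad_one assms)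
  qed
  then have "tsum t (\<lambda>a b. Phi \<phi> (Phi_inv \<phi> (a \<otimes> b))) = t" by simp
  then show ?thesis by (simp flip: Phi_tsum Phi_inv_tsum)
qed

lemma Phi_eqD: "alg_hom \<phi> \<Longrightarrow> Phi \<phi> s = Phi \<phi> t \<Longrightarrow> s = t"
  by (metis Phi_inv_Phi)

lemma Q_inverse:
  assumes "alg_hom \<phi>"
  shows "Q \<phi> * Q_inv \<phi> = 1" "Q_inv \<phi> * Q \<phi> = 1"
proof -
  have c: "bilin (\<lambda>x y. y \<otimes> \<phi> x)" by (intro clin clinear_alg_hom[OF assms])
  have "Q \<phi> * Q_inv \<phi> = tsum R (\<lambda>a b. tsum R (\<lambda>c d. (b * d) \<otimes> \<phi> (a * S c)))"
    unfolding Q_def Q_inv_def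
    by (simp only: tsum_mult_right) (simp add: tsum_mult_left times_tensor_pure alg_hom_mult[OF assms])
  also have "\<dots> = 1 \<otimes> \<phi> 1" by (rule tsum_R_inverse(2)[OF c])
  finally show "Q \<phi> * Q_inv \<phi> = 1" by (simp add: alg_hom_one[OF assms] one_tensor_def)
  have "Q_inv \<phi> * Q \<phi> = tsum R (\<lambda>a b. tsum R (\<lambda>c d. (b * d) \<otimes> \<phi> (S a * c)))"
    unfolding Q_def Q_inv_def
    by (simp only: tsum_mult_right) (simp add: tsum_mult_left times_tensor_pure alg_hom_mult[OF assms])
  also have "\<dots> = 1 \<otimes> \<phi> 1" by (rule tsum_R_inverse(1)[OF c])
  finally show "Q_inv \<phi> * Q \<phi> = 1" by (simp add: alg_hom_one[OF assms] one_tensor_def)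
qed

text \<open>The hexagon replaces the two legs of \<open>\<Delta> r\<close>, which stand on either
  side of \<open>x\<close>, by legs of two separate copies of \<open>R\<close>. The right copy
  carries the antipode and so sums to the inverse.\<close>

lemma tsum_R_ad:
  assumes "alg_hom \<phi>"
  shows "tsum R (\<lambda>r s. s \<otimes> ad \<phi> r x) = Q \<phi> * (1 \<otimes> x) * Q_inv \<phi>"
proof -
  have "tsum R (\<lambda>r s. s \<otimes> ad \<phi> r x) = tsum R (\<lambda>r s. tsum (\<Delta> r) (\<lambda>c d. s \<otimes> (\<phi> c * x * \<phi> (S d))))"
    by (simp add: ad_def tsum_tensor_left)
  also have "\<dots> = tsum R (\<lambda>a b. tsum R (\<lambda>c d. (b * d) \<otimes> (\<phi> a * x * \<phi> (S c))))"
    by (rule tsum_coprod_id_R) (intro clin clinear_alg_hom[OF assms])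
  also have "\<dots> = Q \<phi> * (1 \<otimes> x) * Q_inv \<phi>"
    unfolding Q_def Q_inv_def
    by (simp only: tsum_mult_right) (simp add: tsum_mult_left times_tensor_pure)
  finally show ?thesis .
qed

lemma Phi_pure_Q:
  assumes "alg_hom \<phi>"
  shows "Phi \<phi> (a \<otimes> x) = (a \<otimes> 1) * Q \<phi> * (1 \<otimes> x) * Q_inv \<phi>"
proof -
  have "Phi \<phi> (a \<otimes> x) = (a \<otimes> 1) * tsum R (\<lambda>r s. s \<otimes> ad \<phi> r x)"
    by (simp add: Phi_pure tsum_mult_left times_tensor_pure)
  then show ?thesis by (simp add: tsum_R_ad[OF assms] mult.assoc)
qed

lemma coprod_Q: "\<Delta> h * Q (\<lambda>x. x) = Q (\<lambda>x. x) * tensor_swap (\<Delta> h)"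
proof -
  have Q: "Q (\<lambda>x. x) = tensor_swap R" by (simp add: Q_def tensor_swap_tsum)
  have sw: "tensor_swap (tensor_swap t) = t" for t :: "'h \<otimes> 'h"
  proof -
    have "bilin (\<lambda>a b :: 'h. b \<otimes> (a :: 'h))" by (intro clin)
    then show ?thesis by (simp add: tensor_swap_tsum tsum_tsum tsum_pure)
  qed
  show ?thesis
    using arg_cong[OF coprod_op_R[of h], of tensor_swap]
    by (simp add: alg_hom_mult[OF alg_hom_swap] sw Q)
qed

abbreviation "\<Phi> \<equiv> Phi (\<lambda>x. x)"
abbreviation "q \<equiv> Q (\<lambda>x. x)"
abbreviation "q' \<equiv> Q_inv (\<lambda>x. x)"
abbreviation lad (infixr \<open>\<rhd>\<close> 76) where "h \<rhd> b \<equiv> ad (\<lambda>x. x) h b"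

lemmas q_inverse = Q_inverse[OF alg_hom_ident]
lemmas Phi_ident_pure = Phi_pure_Q[OF alg_hom_ident]

text \<open>Conjugation by \<open>q\<close> exchanges \<Delta> with its flip. For the flipped
  coproduct, \<open>1 \<otimes> b\<close> is in the favourable position that
  \<open>a \<otimes> 1\<close> has for \<Delta>.\<close>

lemma ad_coprod_q: "ad \<Delta> h (q * (1 \<otimes> b) * q') = q * (1 \<otimes> h \<rhd> b) * q'"
proof (rule ad_eqI[OF alg_hom_coprod, symmetric])
  show "clinear (\<lambda>h. q * (1 \<otimes> h \<rhd> b) * q')"
    by (intro clin clinear_ad alg_hom_ident)
  fix h
  have q: "q' * \<Delta> y = tensor_swap (\<Delta> y) * q'" for y
  proof -
    have "q' * \<Delta> y = q' * (\<Delta> y * q) * q'" by (simp add: mult.assoc q_inverse)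
    also have "\<dots> = tensor_swap (\<Delta> y) * q'" by (simp add: coprod_Q q_inverse flip: mult.assoc)
    finally show ?thesis .
  qed
  have "tsum (\<Delta> h) (\<lambda>x y. (1 \<otimes> x \<rhd> b) * tensor_swap (\<Delta> y))
      = tsum (\<Delta> h) (\<lambda>x s. tsum (\<Delta> s) (\<lambda>c d. d \<otimes> (x \<rhd> b * c)))"
    by (simp add: tensor_swap_tsum tsum_mult_left times_tensor_pure)
  also have "\<dots> = tsum (\<Delta> h) (\<lambda>s d. tsum (\<Delta> s) (\<lambda>x c. d \<otimes> (x \<rhd> b * c)))"
    by (rule tsum_coassoc[symmetric]) (intro clin clinear_ad alg_hom_ident)
  also have "\<dots> = tensor_swap (\<Delta> h) * (1 \<otimes> b)"
    by (simp add: ad_cancel[OF alg_hom_ident] tensor_swap_tsum tsum_mult_right times_tensor_pure flip: tsum_tensor_left)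
  finally have *: "tsum (\<Delta> h) (\<lambda>x y. (1 \<otimes> x \<rhd> b) * tensor_swap (\<Delta> y)) = tensor_swap (\<Delta> h) * (1 \<otimes> b)" .
  have "tsum (\<Delta> h) (\<lambda>x y. q * (1 \<otimes> x \<rhd> b) * q' * \<Delta> y)
      = q * tsum (\<Delta> h) (\<lambda>x y. (1 \<otimes> x \<rhd> b) * tensor_swap (\<Delta> y)) * q'"
    by (simp add: tsum_mult_left tsum_mult_right mult.assoc q)
  also have "\<dots> = \<Delta> h * (q * (1 \<otimes> b) * q')"
    by (simp add: * coprod_Q flip: mult.assoc)
  finally show "tsum (\<Delta> h) (\<lambda>x y. q * (1 \<otimes> x \<rhd> b) * q' * \<Delta> y) = \<Delta> h * (q * (1 \<otimes> b) * q')" .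
qed

text \<open>\<Phi> of a pure tensor is a product of two factors on each of which the action is
  already known, and the action distributes over products.\<close>

lemma Phi_ad: "tsum (\<Delta> h) (\<lambda>x y. \<Phi> (x \<rhd> a \<otimes> y \<rhd> b)) = ad \<Delta> h (\<Phi> (a \<otimes> b))"
proof -
  have *: "\<Phi> (a \<otimes> b) = (a \<otimes> 1) * (q * (1 \<otimes> b) * q')" for a b
    by (simp add: Phi_ident_pure mult.assoc)
  show ?thesis
    unfolding * ad_times[OF alg_hom_coprod, of h "a \<otimes> 1" "q * (1 \<otimes> b) * q'"]
      ad_coprod_q ad_coprod_tensor_one ..
qed

text \<open>The left-hand side is \<open>\<Phi>\<close> of the braiding of \<open>b \<otimes> c\<close>, the right-hand side \<open>\<Phi> (1 \<otimes> b) * \<Phi> (c \<otimes> 1)\<close>: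
  this is the cross relation of the braided tensor product algebra.\<close>

lemma Phi_braiding: "tsum R (\<lambda>r s. \<Phi> (s \<rhd> c \<otimes> r \<rhd> b)) = q * (1 \<otimes> b) * q' * (c \<otimes> 1)"
proof -
  have "tsum R (\<lambda>r s. \<Phi> (s \<rhd> c \<otimes> r \<rhd> b))
     = tsum R (\<lambda>r s. tsum (\<Delta> s) (\<lambda>x y. tsum R (\<lambda>r' s'. (x * c * S y * s') \<otimes> (r' * r) \<rhd> b)))"
  proof (rule tsum_cong)
    fix r s
    have "\<Phi> (s \<rhd> c \<otimes> r \<rhd> b) = tsum R (\<lambda>r' s'. (s \<rhd> c * s') \<otimes> (r' * r) \<rhd> b)"
      by (simp add: Phi_pure ad_mult alg_hom_ident)
    also have "\<dots> = tsum R (\<lambda>r' s'. tsum (\<Delta> s) (\<lambda>x y. (x * c * S y * s') \<otimes> (r' * r) \<rhd> b))"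
      by (simp only: ad_def[of _ s] tsum_mult_right tsum_tensor_right)
    finally show "\<Phi> (s \<rhd> c \<otimes> r \<rhd> b)
        = tsum (\<Delta> s) (\<lambda>x y. tsum R (\<lambda>r' s'. (x * c * S y * s') \<otimes> (r' * r) \<rhd> b))"
      by (simp only: tsum_commute[of R])
  qed
  also have "\<dots> = tsum R (\<lambda>u v. tsum R (\<lambda>r s. tsum R (\<lambda>r' s'. (s * c * S v * s') \<otimes> (r' * (u * r)) \<rhd> b)))"
    by (rule tsum_id_coprod_R) (intro clin clinear_ad alg_hom_ident)
  also have "\<dots> = tsum R (\<lambda>r s. tsum R (\<lambda>u v. tsum R (\<lambda>r' s'. (s * c * S v * s') \<otimes> (r' * (u * r)) \<rhd> b)))"
    by (rule tsum_commute)
  \<comment> \<open>The copy \<open>u, v\<close>, split off by the second hexagon and carrying the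
    antipode of the adjoint action, cancels the copy \<open>r', s'\<close> contributed by
    \<Phi>.\<close>
  also have "\<dots> = tsum R (\<lambda>r s. (s * c * 1) \<otimes> (1 * r) \<rhd> b)"
  proof (rule tsum_cong)
    fix r s
    have "tsum R (\<lambda>r' s'. tsum R (\<lambda>u v. (s * c * (S v * s')) \<otimes> ((r' * u) * r) \<rhd> b)) = (s * c * 1) \<otimes> (1 * r) \<rhd> b"
      by (rule tsum_R_op_inverse(2)[where f = "\<lambda>x y. (s * c * y) \<otimes> (x * r) \<rhd> b"]) (intro clin clinear_ad alg_hom_ident)
    then show "tsum R (\<lambda>u v. tsum R (\<lambda>r' s'. (s * c * S v * s') \<otimes> (r' * (u * r)) \<rhd> b)) = (s * c * 1) \<otimes> (1 * r) \<rhd> b"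
      by (subst tsum_commute) (simp add: mult.assoc)
  qed
  also have "\<dots> = tsum R (\<lambda>r s. s \<otimes> r \<rhd> b) * (c \<otimes> 1)"
    by (simp add: tsum_mult_right times_tensor_pure)
  finally show ?thesis by (simp add: tsum_R_ad alg_hom_ident)
qed

end

section \<open>Braided coassociativity\<close>

lemma alg_hom_leg12: "alg_hom leg12"
  and alg_hom_leg13: "alg_hom leg13"
  and alg_hom_leg23: "alg_hom leg23"
proof -
  show "alg_hom leg12"
    unfolding leg12_tsum[abs_def]
    by (rule alg_homI_tsum) (intro clin, simp_all add: one_tensor_def times_tensor_pure)
  show "alg_hom leg13"
    unfolding leg13_tsum[abs_def]
    by (rule alg_homI_tsum) (intro clin, simp_all add: one_tensor_def times_tensor_pure)
  show "alg_hom leg23"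
    unfolding leg23_tsum[abs_def]
    by (rule alg_homI_tsum) (intro clin, simp_all add: one_tensor_def times_tensor_pure)
qed

lemma leg23_eq: "leg23 t = 1 \<otimes> t"
  by (simp add: leg23_tsum flip: tsum_tensor_left)

lemma leg12_pure: "leg12 (a \<otimes> b) = a \<otimes> b \<otimes> 1"
  and leg13_pure: "leg13 (a \<otimes> b) = a \<otimes> 1 \<otimes> b"
  unfolding leg12_tsum leg13_tsum by (rule tsum_pure, intro clin)+

lemma leg12_commute: "leg12 t * (1 \<otimes> 1 \<otimes> c) = (1 \<otimes> 1 \<otimes> c) * leg12 t"
  and leg13_commute: "leg13 t * (1 \<otimes> c \<otimes> 1) = (1 \<otimes> c \<otimes> 1) * leg13 t"
  by (simp_all add: leg12_tsum leg13_tsum tsum_mult_left tsum_mult_right times_tensor_pure)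

context quasitriangular_star_hopf_algebra
begin

lemma Q_coprod: "Q \<Delta> = leg12 q * leg13 q"
proof -
  have "Q \<Delta> = tsum R (\<lambda>r s. tsum (\<Delta> r) (\<lambda>x y. s \<otimes> x \<otimes> y))"
    by (simp add: Q_def flip: tsum_tensor_left)
  also have "\<dots> = tsum R (\<lambda>a b. tsum R (\<lambda>c d. (b * d) \<otimes> a \<otimes> c))"
    by (rule tsum_coprod_id_R) (intro clin)
  also have "\<dots> = leg12 q * leg13 q"
    by (simp add: Q_def alg_hom_tsum alg_hom_leg12 alg_hom_leg13 leg12_pure leg13_pure tsum_mult_right)
      (simp add: tsum_mult_left times_tensor_pure)
  finally show ?thesis .
qed

text \<open>Quasi-cocommutativity moves \<open>leg23 q\<close> past \<open>Q \<Delta>\<close> at the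
  cost of flipping the coproduct. The hexagon factors both the original and the flipped element into
  legs, in opposite orders.\<close>

lemma Yang_Baxter: "leg12 q * leg13 q * leg23 q = leg23 q * leg13 q * leg12 q"
proof -
  have "Q \<Delta> * leg23 q = leg23 q * tsum R (\<lambda>r s. s \<otimes> tensor_swap (\<Delta> r))"
    by (simp add: Q_def[of \<Delta>] leg23_eq tsum_mult_left tsum_mult_right times_tensor_pure coprod_Q)
  also have "tsum R (\<lambda>r s. s \<otimes> tensor_swap (\<Delta> r)) = tsum R (\<lambda>r s. tsum (\<Delta> r) (\<lambda>x y. s \<otimes> y \<otimes> x))"
    by (simp add: tensor_swap_tsum tsum_tensor_left)
  also have "\<dots> = tsum R (\<lambda>a b. tsum R (\<lambda>c d. (b * d) \<otimes> c \<otimes> a))"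
    by (rule tsum_coprod_id_R) (intro clin)
  also have "\<dots> = leg13 q * leg12 q"
    by (simp add: Q_def alg_hom_tsum alg_hom_leg12 alg_hom_leg13 leg12_pure leg13_pure tsum_mult_right)
      (simp add: tsum_mult_left times_tensor_pure)
  finally show ?thesis by (simp add: Q_coprod mult.assoc)
qed

lemma leg_q_inverse:
  "leg12 q * leg12 q' = 1" "leg12 q' * leg12 q = 1"
  "leg13 q * leg13 q' = 1" "leg13 q' * leg13 q = 1"
  "leg23 q * leg23 q' = 1" "leg23 q' * leg23 q = 1"
  by (simp_all add: q_inverse alg_hom_leg12 alg_hom_leg13 alg_hom_leg23 alg_hom_one flip: alg_hom_mult)

lemma left_inverse_eqI: "x * y = 1 \<Longrightarrow> z * x = 1 \<Longrightarrow> y = (z :: 'a::ring_1)"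
  by (metis mult.assoc mult_1_left mult_1_right)

lemma Q_inv_coprod: "Q_inv \<Delta> = leg13 q' * leg12 q'"
proof (rule left_inverse_eqI)
  show "Q \<Delta> * Q_inv \<Delta> = 1" by (rule Q_inverse[OF alg_hom_coprod])
  have "leg13 q' * leg12 q' * Q \<Delta> = leg13 q' * (leg12 q' * leg12 q) * leg13 q"
    by (simp add: Q_coprod mult.assoc)
  then show "leg13 q' * leg12 q' * Q \<Delta> = 1" by (simp add: leg_q_inverse)
qed

text \<open>The left side is \<open>\<Delta> \<otimes> id\<close> applied to
  \<open>q (1 \<otimes> c) q'\<close>: braiding \<open>c\<close> past a tensor product is braiding
  it past the two factors one after the other.\<close>

lemma tsum_R_coprod_ad:
  "tsum R (\<lambda>r s. leg12 (\<Delta> s) * (1 \<otimes> 1 \<otimes> r \<rhd> c))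
    = leg23 q * leg13 q * (1 \<otimes> 1 \<otimes> c) * leg13 q' * leg23 q'"
proof -
  have leg13: "leg13 q * (1 \<otimes> 1 \<otimes> c) * leg13 q' = tsum R (\<lambda>r s. s \<otimes> 1 \<otimes> r \<rhd> c)"
    using arg_cong[OF tsum_R_ad[OF alg_hom_ident, of c], of leg13]
    by (simp add: alg_hom_tsum alg_hom_mult alg_hom_leg13 leg13_pure)
  have leg23: "leg23 q * (d \<otimes> 1 \<otimes> y) * leg23 q' = tsum R (\<lambda>r s. d \<otimes> s \<otimes> r \<rhd> y)" for d y
  proof -
    have "leg23 q * (d \<otimes> 1 \<otimes> y) * leg23 q' = (d \<otimes> 1) * leg23 (q * (1 \<otimes> y) * q')"
      by (simp add: leg23_eq times_tensor_pure)
    also have "\<dots> = tsum R (\<lambda>r s. d \<otimes> s \<otimes> r \<rhd> y)"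
      by (simp add: leg23_eq times_tensor_pure tsum_tensor_left tsum_mult_left flip: tsum_R_ad[OF alg_hom_ident])
    finally show ?thesis .
  qed
  have "tsum R (\<lambda>r s. leg12 (\<Delta> s) * (1 \<otimes> 1 \<otimes> r \<rhd> c))
      = tsum R (\<lambda>r s. tsum (\<Delta> s) (\<lambda>x y. x \<otimes> y \<otimes> r \<rhd> c))"
    by (simp add: leg12_tsum tsum_mult_right times_tensor_pure)
  also have "\<dots> = tsum R (\<lambda>a b. tsum R (\<lambda>r s. s \<otimes> b \<otimes> (a * r) \<rhd> c))"
    by (rule tsum_id_coprod_R) (intro clin clinear_ad alg_hom_ident)
  also have "\<dots> = tsum R (\<lambda>r s. tsum R (\<lambda>a b. s \<otimes> b \<otimes> a \<rhd> r \<rhd> c))"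
    by (subst tsum_commute) (simp add: ad_mult alg_hom_ident)
  also have "\<dots> = leg23 q * tsum R (\<lambda>r s. s \<otimes> 1 \<otimes> r \<rhd> c) * leg23 q'"
    by (simp add: tsum_mult_left tsum_mult_right leg23)
  finally show ?thesis by (simp add: mult.assoc flip: leg13)
qed

text \<open>Both sides let \<open>a\<close>, \<open>b\<close>, \<open>c\<close> act on a triple tensor product \<open>U \<otimes> V \<otimes> W\<close>, bracketed as
  \<open>U \<otimes> (V \<otimes> W)\<close> on the left and as \<open>(U \<otimes> V) \<otimes> W\<close> on the right.\<close>

lemma Phi_coprod_iterate:
  "Phi \<Delta> (a \<otimes> \<Phi> (b \<otimes> c)) = leg12 (\<Phi> (a \<otimes> b)) * tsum R (\<lambda>r s. leg12 (\<Delta> s) * (1 \<otimes> 1 \<otimes> r \<rhd> c))"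
proof -
  let ?a = "a \<otimes> 1 \<otimes> 1" and ?b = "1 \<otimes> b \<otimes> 1" and ?c = "1 \<otimes> 1 \<otimes> c"
  let ?q12 = "leg12 q" and ?q13 = "leg13 q" and ?q23 = "leg23 q"
  let ?p12 = "leg12 q'" and ?p13 = "leg13 q'" and ?p23 = "leg23 q'"
  \<comment> \<open>Rewriting both braid words through Yang-Baxter creates a \<open>?p12\<close>
    directly after \<open>?b\<close>, which completes the first factor of the claim. The remaining
    \<open>?q12\<close> commutes with \<open>?c\<close> and cancels against the new
    \<open>?p12\<close> on its right.\<close>
  have 1: "?q13 * ?q23 = ?p12 * (?q23 * ?q13 * ?q12)"
  proof -
    have "?q13 * ?q23 = ?p12 * (?q12 * ?q13 * ?q23)"
      by (simp add: leg_q_inverse flip: mult.assoc)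
    then show ?thesis by (simp only: Yang_Baxter)
  qed
  have 2: "?p23 * ?p13 = (?p12 * ?p13 * ?p23) * ?q12"
  proof (rule left_inverse_eqI)
    have "?q13 * ?q23 * (?p23 * ?p13) = ?q13 * (?q23 * ?p23) * ?p13" by (simp add: mult.assoc)
    then show "?q13 * ?q23 * (?p23 * ?p13) = 1" by (simp add: leg_q_inverse)
    have "?p12 * ?p13 * ?p23 * ?q12 * (?q13 * ?q23) = ?p12 * ?p13 * ?p23 * (?q12 * ?q13 * ?q23)"
      by (simp add: mult.assoc)
    also have "\<dots> = ?p12 * ?p13 * (?p23 * ?q23) * ?q13 * ?q12"
      by (simp only: Yang_Baxter) (simp only: mult.assoc)
    also have "\<dots> = ?p12 * (?p13 * ?q13) * ?q12"
      by (simp add: leg_q_inverse mult.assoc)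
    finally show "?p12 * ?p13 * ?p23 * ?q12 * (?q13 * ?q23) = 1"
      by (simp add: leg_q_inverse)
  qed
  have "Phi \<Delta> (a \<otimes> \<Phi> (b \<otimes> c)) = ?a * (?q12 * ?q13) * leg23 (\<Phi> (b \<otimes> c)) * (?p13 * ?p12)"
    by (simp add: Phi_pure_Q[OF alg_hom_coprod] Q_coprod Q_inv_coprod leg23_eq one_tensor_def)
  also have "leg23 (\<Phi> (b \<otimes> c)) = ?b * ?q23 * ?c * ?p23"
    by (simp add: Phi_ident_pure alg_hom_mult alg_hom_leg23) (simp add: leg23_eq)
  also have "?a * (?q12 * ?q13) * (?b * ?q23 * ?c * ?p23) * (?p13 * ?p12)
      = ?a * ?q12 * (?q13 * ?b) * ?q23 * ?c * (?p23 * ?p13) * ?p12"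
    by (simp add: mult.assoc)
  also have "\<dots> = ?a * ?q12 * ?b * (?q13 * ?q23) * ?c * (?p23 * ?p13) * ?p12"
    by (simp only: leg13_commute mult.assoc)
  also have "\<dots> = ?a * ?q12 * ?b * ?p12 * ?q23 * ?q13 * (?q12 * ?c) * ?p12 * ?p13 * ?p23 * (?q12 * ?p12)"
    unfolding 1 2 by (simp only: mult.assoc)
  also have "\<dots> = ?a * ?q12 * ?b * ?p12 * ?q23 * ?q13 * ?c * (?q12 * ?p12) * ?p13 * ?p23"
    by (simp only: leg12_commute mult.assoc leg_q_inverse mult_1_right)
  also have "\<dots> = (?a * ?q12 * ?b * ?p12) * (?q23 * ?q13 * ?c * ?p13 * ?p23)"
    by (simp add: leg_q_inverse mult.assoc)
  also have "?a * ?q12 * ?b * ?p12 = leg12 (\<Phi> (a \<otimes> b))"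
    by (simp add: Phi_ident_pure alg_hom_mult alg_hom_leg12) (simp add: leg12_pure)
  finally show ?thesis by (simp add: tsum_R_coprod_ad)
qed

lemma transmuted_coprod_eq: "transmuted_coprod \<Delta> S R b = Phi_inv (\<lambda>x. x) (\<Delta> b)"
proof -
  have "tensor_lift (\<lambda>r1 r2. (b1 * S r2) \<otimes> r1 \<rhd> b2) R = tsum R (\<lambda>r1 r2. (b1 * S r2) \<otimes> r1 \<rhd> b2)" for b1 b2
    by (rule bilin_tsum) (intro clin clinear_ad alg_hom_ident)
  then show ?thesis
    by (simp add: transmuted_coprod_def adjoint_act_eq Phi_inv_def bilin_tsum[OF bilin_Phi_inv])
qed

abbreviation \<Delta>\<^sub>B where "\<Delta>\<^sub>B \<equiv> transmuted_coprod \<Delta> S R"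

lemma Phi_transmuted_coprod: "\<Phi> (\<Delta>\<^sub>B b) = \<Delta> b"
  by (simp add: transmuted_coprod_eq Phi_Phi_inv alg_hom_ident)

lemma Phi_eqI: "\<Phi> s = \<Phi> t \<Longrightarrow> s = t"
  by (rule Phi_eqD[OF alg_hom_ident])

lemma clinear_transmuted_coprod: "clinear f \<Longrightarrow> clinear (\<lambda>x. \<Delta>\<^sub>B (f x))"
  unfolding transmuted_coprod_eq by (intro clinear_Phi_inv clin)

lemma transmuted_coassoc:
  "tensor_assoc (tensor_map \<Delta>\<^sub>B id (\<Delta>\<^sub>B b)) = tensor_map id \<Delta>\<^sub>B (\<Delta>\<^sub>B b)"
proof -
  note lin = clinear_transmuted_coprod[OF clinear_ident] clinear_id
  define W where "W = \<Delta>\<^sub>B b"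
  \<comment> \<open>The analogue of \<Phi> for three factors: the last two are identified first,
    then the first with their product. It is injective and sends both iterated braided coproducts of
    \<open>b\<close> to the iterated ordinary coproduct.\<close>
  define G where "G X = Phi \<Delta> (tsum X (\<lambda>a t. a \<otimes> \<Phi> t))" for X
  have bil: "bilin (\<lambda>a t :: 'h \<otimes> 'h. a \<otimes> \<Phi> t)" "bilin (\<lambda>a t :: 'h \<otimes> 'h. a \<otimes> Phi_inv (\<lambda>x. x) t)"
    by (intro clin clinear_Phi clinear_Phi_inv)+
  have G_eqD: "X = Y" if "G X = G Y" for X Y
  proof -
    have "tsum X (\<lambda>a t. a \<otimes> \<Phi> t) = tsum Y (\<lambda>a t. a \<otimes> \<Phi> t)"
      using that unfolding G_def by (rule Phi_eqD[OF alg_hom_coprod])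
    from arg_cong[OF this, of "\<lambda>T. tsum T (\<lambda>a t. a \<otimes> Phi_inv (\<lambda>x. x) t)"] show ?thesis
      by (simp add: tsum_tsum tsum_pure bil Phi_inv_Phi alg_hom_ident)
  qed
  have trip: "trilin (\<lambda>(a :: 'h) (b :: 'h) (c :: 'h). a \<otimes> b \<otimes> c)" by (intro clin)
  have "bilin (\<lambda>s (c :: 'h). tsum s (\<lambda>(a :: 'h) (b :: 'h). a \<otimes> b \<otimes> c))"
    by (rule trilin_bilin(2)[OF trip])
  then have assoc: "tensor_assoc (tensor_map \<Delta>\<^sub>B id W) = tsum W (\<lambda>x c. tsum (\<Delta>\<^sub>B x) (\<lambda>a b. a \<otimes> b \<otimes> c))"
    by (simp add: tensor_assoc_tsum tensor_map_tsum lin tsum_tsum tsum_pure)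
  have bil1: "bilin (\<lambda>u v. leg12 (\<Delta> u) * (1 \<otimes> 1 \<otimes> v))"
    by (intro clin clinear_alg_hom[OF alg_hom_leg12])
  have bil2: "bilin (\<lambda>u v. u \<otimes> \<Delta> v)"
    by (intro clin)
  have "G (tensor_assoc (tensor_map \<Delta>\<^sub>B id W)) = tsum W (\<lambda>x c. tsum (\<Delta>\<^sub>B x) (\<lambda>a b. Phi \<Delta> (a \<otimes> \<Phi> (b \<otimes> c))))"
    by (simp add: G_def assoc tsum_tsum tsum_pure bil Phi_tsum)
  also have "\<dots> = tsum W (\<lambda>x c. leg12 (\<Phi> (\<Delta>\<^sub>B x)) * tsum R (\<lambda>r s. leg12 (\<Delta> s) * (1 \<otimes> 1 \<otimes> r \<rhd> c)))"
    by (simp add: Phi_coprod_iterate flip: tsum_mult_right alg_hom_tsum[OF alg_hom_leg12] Phi_tsum)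
  also have "\<dots> = tsum W (\<lambda>x c. tsum (\<Phi> (x \<otimes> c)) (\<lambda>u v. leg12 (\<Delta> u) * (1 \<otimes> 1 \<otimes> v)))"
    by (simp add: Phi_transmuted_coprod Phi_pure tsum_tsum tsum_pure bil1 tsum_mult_left coprod_mult
        alg_hom_mult[OF alg_hom_leg12] mult.assoc)
  also have "\<dots> = tsum (\<Phi> W) (\<lambda>u v. leg12 (\<Delta> u) * (1 \<otimes> 1 \<otimes> v))"
    by (simp add: bil1 flip: tsum_tsum Phi_tsum)
  also have "\<dots> = tsum (\<Delta> b) (\<lambda>u v. tsum (\<Delta> u) (\<lambda>x y. x \<otimes> y \<otimes> v))"
    by (simp add: W_def Phi_transmuted_coprod leg12_tsum tsum_mult_right times_tensor_pure)
  also have "\<dots> = tsum (\<Delta> b) (\<lambda>u v. tsum (\<Delta> v) (\<lambda>x y. u \<otimes> x \<otimes> y))"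
    by (rule tsum_coassoc[OF trip])
  also have "\<dots> = tsum (\<Phi> W) (\<lambda>u v. u \<otimes> \<Delta> v)"
    by (simp add: W_def Phi_transmuted_coprod flip: tsum_tensor_left)
  also have "\<dots> = tsum W (\<lambda>a x. tsum (\<Phi> (a \<otimes> x)) (\<lambda>u v. u \<otimes> \<Delta> v))"
    by (simp add: bil2 flip: tsum_tsum Phi_tsum)
  also have "\<dots> = tsum W (\<lambda>a x. Phi \<Delta> (a \<otimes> \<Phi> (\<Delta>\<^sub>B x)))"
    by (simp add: Phi_transmuted_coprod Phi_pure tsum_tsum tsum_pure bil2 alg_hom_ad[OF alg_hom_coprod])
  also have "\<dots> = G (tensor_map id \<Delta>\<^sub>B W)"
    by (simp add: G_def tensor_map_tsum lin tsum_tsum tsum_pure bil Phi_tsum)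
  finally show ?thesis unfolding W_def by (rule G_eqD)
qed

end

section \<open>The transmutation as a braided Hopf algebra\<close>

lemma clinear_tensor_eqI:
  assumes "clinear f" "clinear g" "\<And>a b. f (a \<otimes> b) = g (a \<otimes> b)"
  shows "f = g"
  using assms by (intro additive_tensor_eqI) (auto simp: additive_def clinear_iff)

lemma clinear_tensor_map:
  assumes "clinear f" "clinear g"
  shows "clinear (tensor_map f g)"
proof -
  have "clinear (\<lambda>t. tsum t (\<lambda>a b. f a \<otimes> g b))"
    by (intro clin clinear_comp[OF assms(1)] clinear_comp[OF assms(2)])
  then show ?thesis by (simp add: tensor_map_tsum[OF assms, abs_def])
qed

lemma clinear_tensor_assoc: "clinear tensor_assoc"
proof -
  have "trilin (\<lambda>a b c. a \<otimes> b \<otimes> c)" by (intro clin)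
  then show ?thesis
    unfolding tensor_assoc_tsum[abs_def] by (intro clinear_tsum_arg trilin_bilin)
qed

lemma inv_tensor_assoc_pure: "inv tensor_assoc (a \<otimes> b \<otimes> c) = (a \<otimes> b) \<otimes> c"
  by (rule inv_f_eq) (simp_all add: bij_is_inj[OF bij_tensor_assoc])

lemma clinear_inv:
  assumes "clinear f" "bij f"
  shows "clinear (inv f)"
  unfolding clinear_iff
proof (intro conjI allI; rule inv_f_eq[OF bij_is_inj[OF assms(2)]])
  fix c x y
  show "f (inv f x + inv f y) = x + y" "f (c *\<^sub>C inv f x) = c *\<^sub>C x"
    using assms by (simp_all add: clinear_iff bij_is_surj surj_f_inv_f)
qed

lemma clinear_inv_tensor_assoc: "clinear (inv tensor_assoc)"
  by (rule clinear_inv[OF clinear_tensor_assoc bij_tensor_assoc])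

lemma clinear_o: "clinear f \<Longrightarrow> clinear g \<Longrightarrow> clinear (f \<circ> g)"
  by (simp add: clinear_iff)

lemma clinear_middle_map:
  assumes "clinear f"
  shows "clinear (middle_map f)"
  unfolding middle_map_def
  by (intro clinear_o clinear_tensor_map clinear_id clinear_tensor_assoc clinear_inv_tensor_assoc assms)

text \<open>A braiding does not send pure tensors to pure tensors, so its value is supplied as a
  sum, in the form that \<open>braiding_pure\<close> delivers.\<close>

lemma middle_map_pure:
  assumes f: "clinear f" and eq: "f (b \<otimes> c) = tsum t (\<lambda>r s. u r s \<otimes> v r s)"
  shows "middle_map f ((a \<otimes> b) \<otimes> (c \<otimes> d)) = tsum t (\<lambda>r s. (a \<otimes> u r s) \<otimes> (v r s \<otimes> d))"
  by (simp add: middle_map_def clinear_id clinear_tensor_map clinear_tensor_assoc clinear_inv_tensor_assoc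
      f eq inv_tensor_assoc_pure tsum_tensor_left tsum_tensor_right
      tsum_clinear[OF clinear_inv_tensor_assoc] tsum_clinear[OF clinear_tensor_map]
      tsum_clinear[OF clinear_tensor_assoc])

lemma left_moduleD:
  assumes "left_module act"
  shows "clinear f \<Longrightarrow> clinear (\<lambda>x. act (f x) v)" "clinear g \<Longrightarrow> clinear (\<lambda>x. act h (g x))"
    "act 1 v = v" "act (g' * h) v = act g' (act h v)"
  using assms by (auto simp: left_module_def intro: clinear_comp[of "\<lambda>h. act h v"] clinear_comp[of "act h"])

lemma bilin_braiding:
  assumes "left_module actV" "left_module actW"
  shows "bilin (\<lambda>v w. tsum R (\<lambda>r s. actW s w \<otimes> actV r v))"
  by (intro clin left_moduleD(2)[OF assms(1)] left_moduleD(2)[OF assms(2)])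

lemma braiding_tsum:
  assumes "left_module actV" "left_module actW"
  shows "braiding R actV actW t = tsum t (\<lambda>v w. tsum R (\<lambda>r s. actW s w \<otimes> actV r v))"
proof -
  have "bilin (\<lambda>r s. actW s w \<otimes> actV r v)" for v w
    by (intro clin left_moduleD(1)[OF assms(1)] left_moduleD(1)[OF assms(2)])
  then show ?thesis
    by (simp add: braiding_def bilin_tsum bilin_braiding[OF assms])
qed

lemma clinear_braiding:
  assumes "left_module actV" "left_module actW"
  shows "clinear (braiding R actV actW)"
  unfolding braiding_tsum[OF assms, abs_def] by (rule clinear_tsum_arg[OF bilin_braiding[OF assms]])

lemma braiding_pure:
  assumes "left_module actV" "left_module actW"
  shows "braiding R actV actW (v \<otimes> w) = tsum R (\<lambda>r s. actW s w \<otimes> actV r v)"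
  by (simp add: braiding_tsum[OF assms] tsum_pure bilin_braiding[OF assms])

lemma tensor_act_tsum:
  assumes "left_module actV" "left_module actW"
  shows "tensor_act \<Delta> actV actW h t = tsum t (\<lambda>v w. tsum (\<Delta> h) (\<lambda>x y. actV x v \<otimes> actW y w))"
proof -
  have 1: "bilin (\<lambda>x y. actV x v \<otimes> actW y w)" for v w
    by (intro clin left_moduleD(1)[OF assms(1)] left_moduleD(1)[OF assms(2)])
  have "bilin (\<lambda>v w. tsum (\<Delta> h) (\<lambda>x y. actV x v \<otimes> actW y w))"
    by (intro clin left_moduleD(2)[OF assms(1)] left_moduleD(2)[OF assms(2)])
  then show ?thesis by (simp add: tensor_act_def bilin_tsum 1)
qed

lemma bilin_times: "bilin (\<lambda>a b :: 'a::complex_algebra_1. a * b)"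
  by (intro clin)

lemma transmuted_mult_tsum: "transmuted_mult t = tsum t (\<lambda>a b. a * b)"
  unfolding transmuted_mult_def by (rule bilin_tsum[OF bilin_times])

lemma transmuted_mult_pure [simp]: "transmuted_mult (a \<otimes> b) = a * b"
  by (simp add: transmuted_mult_tsum tsum_pure bilin_times)

lemma clinear_transmuted_mult: "clinear transmuted_mult"
  unfolding transmuted_mult_tsum[abs_def] by (rule clinear_tsum_arg[OF bilin_times])

lemma clinear_transmuted_unit: "clinear transmuted_unit"
  by (simp add: clinear_iff transmuted_unit_def scaleC_add_left)

lemma left_unitor_pure [simp]: "left_unitor (z \<otimes> a) = z *\<^sub>C a"
  and right_unitor_pure [simp]: "right_unitor (a \<otimes> z) = z *\<^sub>C a"
  by (simp_all add: left_unitor_tsum right_unitor_tsum tsum_pure bilin_scale)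

lemma clinear_unitors: "clinear left_unitor" "clinear right_unitor"
  unfolding left_unitor_tsum[abs_def] right_unitor_tsum[abs_def]
  by (rule clinear_tsum_arg[OF bilin_scale(1)], rule clinear_tsum_arg[OF bilin_scale(2)])

context quasitriangular_star_hopf_algebra
begin

abbreviation S\<^sub>B where "S\<^sub>B \<equiv> transmuted_antipode \<Delta> S R"

section \<open>Product and coproduct of the transmutation\<close>

lemma left_module_ad: "left_module (ad (\<lambda>x. x))"
  unfolding left_module_def
  by (simp add: ad_one ad_mult alg_hom_ident clinear_ad clinear_ad_arg clinear_ident)

lemma clinear_tensor_act: "clinear (tensor_act \<Delta> (ad (\<lambda>x. x)) (ad (\<lambda>x. x)) h)"
  unfolding tensor_act_tsum[OF left_module_ad left_module_ad, abs_def]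
  by (intro clin clinear_ad_arg)

lemma tensor_act_pure:
  "tensor_act \<Delta> (ad (\<lambda>x. x)) (ad (\<lambda>x. x)) h (a \<otimes> b) = tsum (\<Delta> h) (\<lambda>x y. x \<rhd> a \<otimes> y \<rhd> b)"
  unfolding tensor_act_tsum[OF left_module_ad left_module_ad, abs_def]
  by (rule tsum_pure) (intro clin clinear_ad_arg)

lemma transmuted_mult_act: "transmuted_mult (tensor_act \<Delta> (ad (\<lambda>x. x)) (ad (\<lambda>x. x)) h t) = h \<rhd> transmuted_mult t"
proof -
  have "transmuted_mult \<circ> tensor_act \<Delta> (ad (\<lambda>x. x)) (ad (\<lambda>x. x)) h = (\<lambda>x. h \<rhd> x) \<circ> transmuted_mult"
    by (rule clinear_tensor_eqI)
      (simp_all add: clinear_o clinear_transmuted_mult clinear_tensor_act clinear_ad_arg clinear_ident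
        tensor_act_pure tsum_clinear[OF clinear_transmuted_mult] ad_times alg_hom_ident)
  then show ?thesis by (simp add: fun_eq_iff)
qed

lemma transmuted_coprod_act: "\<Delta>\<^sub>B (h \<rhd> b) = tensor_act \<Delta> (ad (\<lambda>x. x)) (ad (\<lambda>x. x)) h (\<Delta>\<^sub>B b)"
proof (rule Phi_eqI)
  have "\<Phi> \<circ> tensor_act \<Delta> (ad (\<lambda>x. x)) (ad (\<lambda>x. x)) h = ad \<Delta> h \<circ> \<Phi>"
    by (rule clinear_tensor_eqI)
      (simp_all add: clinear_o clinear_Phi[OF clinear_ident] clinear_tensor_act
        clinear_ad_arg[OF clinear_ident] tensor_act_pure Phi_tsum Phi_ad)
  then show "\<Phi> (\<Delta>\<^sub>B (h \<rhd> b)) = \<Phi> (tensor_act \<Delta> (ad (\<lambda>x. x)) (ad (\<lambda>x. x)) h (\<Delta>\<^sub>B b))"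
    by (simp add: fun_eq_iff Phi_transmuted_coprod alg_hom_ad[OF alg_hom_coprod])
qed

lemma Phi_braided_mult:
  "\<Phi> (tensor_map transmuted_mult transmuted_mult
      (middle_map (braiding R (ad (\<lambda>x. x)) (ad (\<lambda>x. x))) (s \<otimes> t))) = \<Phi> s * \<Phi> t"
proof -
  let ?M = "\<lambda>X. tensor_map transmuted_mult transmuted_mult (middle_map (braiding R (ad (\<lambda>x. x)) (ad (\<lambda>x. x))) X)"
  note lin = clinear_braiding[OF left_module_ad left_module_ad]
  have M: "clinear ?M"
    by (rule clinear_comp[OF clinear_tensor_map[OF clinear_transmuted_mult clinear_transmuted_mult]
          clinear_middle_map[OF lin]])
  have pure: "\<Phi> (?M ((a \<otimes> b) \<otimes> (c \<otimes> d))) = \<Phi> (a \<otimes> b) * \<Phi> (c \<otimes> d)" for a b c d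
  proof -
    \<comment> \<open>\<Phi> is left linear over the first factor, and its trailing
      \<open>q'\<close> cancels the leading \<open>q\<close> of the conjugate of
      \<open>1 \<otimes> d\<close>. Only the cross relation between \<open>b\<close> and
      \<open>c\<close> is left.\<close>
    have shift: "\<Phi> ((a * x) \<otimes> (y * d)) = (a \<otimes> 1) * \<Phi> (x \<otimes> y) * (q * (1 \<otimes> d) * q')" for x y
    proof -
      have "(a \<otimes> 1) * \<Phi> (x \<otimes> y) * (q * (1 \<otimes> d) * q')
        = (a \<otimes> 1) * (x \<otimes> 1) * q * (1 \<otimes> y) * (q' * q) * (1 \<otimes> d) * q'"
        by (simp add: Phi_ident_pure mult.assoc)
      also have "\<dots> = \<Phi> ((a * x) \<otimes> (y * d))"
        by (simp add: Phi_ident_pure q_inverse times_tensor_pure mult.assoc flip: mult.assoc[of "1 \<otimes> y"])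
      finally show ?thesis ..
    qed
    have "\<Phi> (?M ((a \<otimes> b) \<otimes> (c \<otimes> d))) = tsum R (\<lambda>r s. \<Phi> ((a * s \<rhd> c) \<otimes> (r \<rhd> b * d)))"
      by (simp add: middle_map_pure[OF lin braiding_pure[OF left_module_ad left_module_ad]]
          tsum_clinear[OF clinear_tensor_map] clinear_transmuted_mult Phi_tsum)
    also have "\<dots> = (a \<otimes> 1) * tsum R (\<lambda>r s. \<Phi> (s \<rhd> c \<otimes> r \<rhd> b)) * (q * (1 \<otimes> d) * q')"
      by (simp add: shift tsum_mult_left tsum_mult_right)
    also have "\<dots> = \<Phi> (a \<otimes> b) * \<Phi> (c \<otimes> d)"
      by (simp only: Phi_braiding) (simp only: Phi_ident_pure mult.assoc)
    finally show ?thesis .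
  qed
  have "\<Phi> (?M (s \<otimes> t)) = tsum s (\<lambda>a b. tsum t (\<lambda>c d. \<Phi> (?M ((a \<otimes> b) \<otimes> (c \<otimes> d)))))"
  proof -
    have "s \<otimes> t = tsum s (\<lambda>a b. tsum t (\<lambda>c d. (a \<otimes> b) \<otimes> (c \<otimes> d)))"
      by (simp flip: tsum_tensor_left tsum_tensor_right)
    then show ?thesis by (simp only: tsum_clinear[OF M] Phi_tsum)
  qed
  also have "\<dots> = tsum s (\<lambda>a b. \<Phi> (a \<otimes> b)) * tsum t (\<lambda>c d. \<Phi> (c \<otimes> d))"
    by (simp only: pure tsum_mult_right) (simp only: tsum_mult_left)
  also have "\<dots> = \<Phi> s * \<Phi> t" by (simp flip: Phi_tsum)
  finally show ?thesis .
qed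

lemma transmuted_coprod_mult:
  "\<Delta>\<^sub>B \<circ> transmuted_mult = tensor_map transmuted_mult transmuted_mult
     \<circ> middle_map (braiding R (ad (\<lambda>x. x)) (ad (\<lambda>x. x))) \<circ> tensor_map \<Delta>\<^sub>B \<Delta>\<^sub>B"
  (is "?l = ?r")
proof (rule clinear_tensor_eqI)
  note lin = clinear_transmuted_coprod[OF clinear_ident] clinear_transmuted_mult
    clinear_braiding[OF left_module_ad left_module_ad]
  show "clinear ?l" "clinear ?r"
    by (intro clinear_o clinear_tensor_map clinear_middle_map lin)+
  show "?l (a \<otimes> b) = ?r (a \<otimes> b)" for a b
    by (rule Phi_eqI) (simp add: lin Phi_braided_mult Phi_transmuted_coprod coprod_mult)
qed

lemma transmuted_coprod_unit: "\<Delta>\<^sub>B 1 = 1 \<otimes> 1"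
proof (rule Phi_eqI)
  show "\<Phi> (\<Delta>\<^sub>B 1) = \<Phi> (1 \<otimes> 1)"
    using Phi_ident_pure[of 1 1] by (simp add: Phi_transmuted_coprod coprod_one q_inverse flip: one_tensor_def)
qed

lemma transmuted_coprod_tsum: "\<Delta>\<^sub>B b = tsum (\<Delta> b) (\<lambda>x y. tsum R (\<lambda>r s. (x * S s) \<otimes> r \<rhd> y))"
  by (simp add: transmuted_coprod_eq Phi_inv_def)

section \<open>Counit axioms\<close>

lemma transmuted_counit_left: "left_unitor (tensor_map \<epsilon> id (\<Delta>\<^sub>B b)) = b"
proof -
  have 1: "tsum R (\<lambda>r s. (\<epsilon> x * \<epsilon> s) *\<^sub>C r \<rhd> y) = \<epsilon> x *\<^sub>C y" for x y
  proof -
    have "tsum R (\<lambda>r s. (\<epsilon> x * \<epsilon> s) *\<^sub>C r \<rhd> y) = \<epsilon> x *\<^sub>C (tsum R (\<lambda>r s. \<epsilon> s *\<^sub>C r) \<rhd> y)"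
      using clinear_ad[OF alg_hom_ident clinear_ident, of y]
      by (simp add: tsum_clinear[OF clinear_ad[OF alg_hom_ident clinear_ident]] tsum_scaleC clinear_iff)
    then show ?thesis by (simp add: counit_R_right ad_one alg_hom_ident)
  qed
  have "left_unitor (tensor_map \<epsilon> id (\<Delta>\<^sub>B b)) = tsum (\<Delta> b) (\<lambda>x y. tsum R (\<lambda>r s. (\<epsilon> x * \<epsilon> s) *\<^sub>C r \<rhd> y))"
    by (simp add: transmuted_coprod_tsum tsum_clinear[OF clinear_tensor_map[OF counit_linear clinear_id]]
        tsum_clinear[OF clinear_unitors(1)] counit_linear clinear_id counit_mult counit_antipode)
  also have "\<dots> = b" by (simp add: 1 tsum_counit_left clinear_ident)
  finally show ?thesis .
qed

lemma transmuted_counit_right: "right_unitor (tensor_map id \<epsilon> (\<Delta>\<^sub>B b)) = b"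
proof -
  have 1: "tsum R (\<lambda>r s. (\<epsilon> r * \<epsilon> y) *\<^sub>C (x * S s)) = \<epsilon> y *\<^sub>C x" for x y
  proof -
    have "tsum R (\<lambda>r s. (\<epsilon> r * \<epsilon> y) *\<^sub>C (x * S s)) = \<epsilon> y *\<^sub>C (x * S (tsum R (\<lambda>r s. \<epsilon> r *\<^sub>C s)))"
      using antipode_linear
      by (simp add: tsum_clinear[OF antipode_linear] tsum_scaleC tsum_mult_left clinear_iff mult.commute)
    then show ?thesis by (simp add: counit_R_left antipode_one)
  qed
  have "right_unitor (tensor_map id \<epsilon> (\<Delta>\<^sub>B b)) = tsum (\<Delta> b) (\<lambda>x y. tsum R (\<lambda>r s. (\<epsilon> r * \<epsilon> y) *\<^sub>C (x * S s)))"
    by (simp add: transmuted_coprod_tsum tsum_clinear[OF clinear_tensor_map[OF clinear_id counit_linear]]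
        tsum_clinear[OF clinear_unitors(2)] counit_linear clinear_id counit_ad)
  also have "\<dots> = b" by (simp add: 1 tsum_counit_right clinear_ident)
  finally show ?thesis .
qed

section \<open>The braided antipode\<close>

lemma transmuted_antipode_tsum: "S\<^sub>B b = tsum R (\<lambda>r s. s * S (r \<rhd> b))"
  unfolding transmuted_antipode_def adjoint_act_eq
  by (rule bilin_tsum) (intro clin clinear_ad alg_hom_ident)

lemma clinear_transmuted_antipode: "clinear S\<^sub>B"
  unfolding transmuted_antipode_tsum[abs_def] by (intro clin clinear_ad_arg)

text \<open>The copy of \<open>R\<close> in the braided coproduct is cancelled by the one inside
  \<open>S\<^sub>B\<close>, which reduces the claim to the ordinary antipode axiom.\<close>

lemma transmuted_antipode_right: "transmuted_mult (tensor_map id S\<^sub>B (\<Delta>\<^sub>B b)) = \<epsilon> b *\<^sub>C 1"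
proof -
  have 1: "tsum R (\<lambda>r s. x * S s * S\<^sub>B (r \<rhd> y)) = x * S y" for x y
  proof -
    have "tsum R (\<lambda>r s. x * S s * S\<^sub>B (r \<rhd> y))
        = tsum R (\<lambda>r' s'. tsum R (\<lambda>r s. x * (S s * s') * S ((r' * r) \<rhd> y)))"
      by (subst tsum_commute) (simp add: transmuted_antipode_tsum tsum_mult_left ad_mult alg_hom_ident mult.assoc)
    also have "\<dots> = x * 1 * S (1 \<rhd> y)"
      by (rule tsum_R_op_inverse(2)[where f = "\<lambda>u v. x * v * S (u \<rhd> y)"]) (intro clin clinear_ad alg_hom_ident)
    finally show ?thesis by (simp add: ad_one alg_hom_ident)
  qed
  have "transmuted_mult (tensor_map id S\<^sub>B (\<Delta>\<^sub>B b)) = tsum (\<Delta> b) (\<lambda>x y. tsum R (\<lambda>r s. x * S s * S\<^sub>B (r \<rhd> y)))"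
    by (simp add: transmuted_coprod_tsum tsum_clinear[OF clinear_tensor_map[OF clinear_id clinear_transmuted_antipode]]
        tsum_clinear[OF clinear_transmuted_mult] clinear_transmuted_antipode clinear_id)
  then show ?thesis by (simp add: 1 tsum_antipode_right)
qed

text \<open>Drinfeld's element implements the square of the antipode, so that \<open>S\<^sub>B\<close> has a closed form
  which makes the left antipode axiom computable.\<close>

definition drinfeld :: 'h where
  "drinfeld = tsum R (\<lambda>r s. S s * r)"

definition drinfeld_inv :: 'h where
  "drinfeld_inv = tsum R (\<lambda>r s. s * S (S r))"

text \<open>Quasi-cocommutativity gives \<open>S(h_(2)) u h_(1) = \<epsilon>(h) u\<close> for
  Drinfeld's element \<open>u\<close>. Multiplying on the left by \<open>S(S(h_(3)))\<close> cancels
  \<open>S(h_(2))\<close> and yields the commutation rule.\<close>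

lemma drinfeld_commute: "drinfeld * h = S (S h) * drinfeld"
proof -
  have 1: "tsum (\<Delta> h) (\<lambda>a b. S b * drinfeld * a) = \<epsilon> h *\<^sub>C drinfeld" for h
  proof -
    have "tsum (\<Delta> h) (\<lambda>a b. S b * drinfeld * a) = tsum (\<Delta> h) (\<lambda>x y. tsum R (\<lambda>a b. S (b * y) * (a * x)))"
      by (simp add: drinfeld_def antipode_mult tsum_mult_left tsum_mult_right mult.assoc)
    also have "\<dots> = tsum (\<Delta> h) (\<lambda>x y. tsum R (\<lambda>a b. S (x * b) * (y * a)))"
      by (rule tsum_coprod_op_R[symmetric]) (intro clin)
    also have "\<dots> = tsum R (\<lambda>a b. tsum (\<Delta> h) (\<lambda>x y. S b * (S x * y) * a))"
      by (subst tsum_commute) (simp add: antipode_mult mult.assoc)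
    also have "\<dots> = \<epsilon> h *\<^sub>C drinfeld"
      by (simp add: tsum_antipode_left drinfeld_def tsum_scaleC flip: tsum_mult_left tsum_mult_right)
    finally show ?thesis .
  qed
  have 2: "tsum (\<Delta> h) (\<lambda>b c. S (S c) * S b) = \<epsilon> h *\<^sub>C 1" for h
    using arg_cong[OF tsum_antipode_right[of h], of S] antipode_linear
    by (simp add: tsum_clinear[OF antipode_linear] antipode_mult clinear_iff antipode_one)
  have "drinfeld * h = tsum (\<Delta> h) (\<lambda>a s. \<epsilon> s *\<^sub>C (drinfeld * a))"
    by (rule tsum_counit_right[symmetric]) (intro clin)
  also have "\<dots> = tsum (\<Delta> h) (\<lambda>a s. tsum (\<Delta> s) (\<lambda>b c. S (S c) * S b * drinfeld * a))"
    by (simp add: 2 flip: tsum_mult_right)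
  also have "\<dots> = tsum (\<Delta> h) (\<lambda>s c. tsum (\<Delta> s) (\<lambda>a b. S (S c) * S b * drinfeld * a))"
    by (rule tsum_coassoc[symmetric]) (intro clin)
  also have "\<dots> = tsum (\<Delta> h) (\<lambda>s c. \<epsilon> s *\<^sub>C (S (S c) * drinfeld))"
    by (simp add: 1 mult.assoc flip: tsum_mult_left) (simp add: 1 flip: mult.assoc)
  also have "\<dots> = S (S h) * drinfeld"
    by (rule tsum_counit_left) (intro clin)
  finally show ?thesis .
qed

lemma drinfeld_inv_left: "drinfeld_inv * drinfeld = 1"
proof -
  have "drinfeld_inv * drinfeld = tsum R (\<lambda>c d. d * (drinfeld * c))"
    by (simp add: drinfeld_inv_def tsum_mult_right mult.assoc flip: drinfeld_commute)
  also have "\<dots> = tsum R (\<lambda>c d. tsum R (\<lambda>a b. (d * S b) * (a * c)))"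
    by (simp add: tsum_mult_left tsum_mult_right mult.assoc drinfeld_def)
  also have "\<dots> = tsum R (\<lambda>a b. tsum R (\<lambda>c d. (d * S b) * (a * c)))"
    by (rule tsum_commute)
  also have "\<dots> = 1 * 1"
    by (rule tsum_R_op_inverse(1)[where f = "\<lambda>x y. y * x"]) (intro clin)
  finally show ?thesis by simp
qed

lemma drinfeld_inv_right: "drinfeld * drinfeld_inv = 1"
proof -
  have "drinfeld * drinfeld_inv = tsum R (\<lambda>a b. (drinfeld * b) * S (S a))"
    by (simp add: drinfeld_inv_def tsum_mult_left mult.assoc)
  also have "\<dots> = tsum R (\<lambda>a b. S (S b) * drinfeld * S (S a))"
    by (simp only: drinfeld_commute)
  \<comment> \<open>The identity \<open>(S \<otimes> S) R = R\<close>, read backwards, strips one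
    \<open>S\<close> from both legs and brings the sum into a form where two copies of
    \<open>R\<close> cancel.\<close>
  also have "\<dots> = tsum (tsum R (\<lambda>a b. S a \<otimes> S b)) (\<lambda>a b. S b * drinfeld * S a)"
    by (subst tsum_tsum, intro clin, rule tsum_cong, rule tsum_pure[symmetric], intro clin)
  also have "\<dots> = tsum R (\<lambda>a b. tsum R (\<lambda>c d. S (d * b) * (c * S a)))"
    by (simp add: antipode_antipode_R drinfeld_def tsum_mult_left tsum_mult_right antipode_mult mult.assoc)
  also have "\<dots> = tsum R (\<lambda>c d. tsum R (\<lambda>a b. S (d * b) * (c * S a)))"
    by (rule tsum_commute)
  also have "\<dots> = S 1 * 1"
    by (rule tsum_R_inverse(2)[where f = "\<lambda>x y. S y * x"]) (intro clin)
  finally show ?thesis by (simp add: antipode_one)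
qed

lemma drinfeld_inv_commute: "h * drinfeld_inv = drinfeld_inv * S (S h)"
proof -
  have "drinfeld_inv * S (S h) = drinfeld_inv * (S (S h) * drinfeld) * drinfeld_inv" by (simp add: mult.assoc drinfeld_inv_right)
  also have "\<dots> = drinfeld_inv * drinfeld * (h * drinfeld_inv)" by (simp add: mult.assoc flip: drinfeld_commute)
  finally show ?thesis by (simp add: drinfeld_inv_left)
qed

text \<open>Applying \<open>S\<close> to the adjoint action brings its double antipode next to
  \<open>s\<close>. After the hexagon this inner copy of \<open>R\<close> sums to
  \<open>drinfeld_inv\<close>, which then moves to the front by its commutation rule.\<close>

lemma transmuted_antipode_drinfeld: "S\<^sub>B b = drinfeld_inv * tsum R (\<lambda>r s. S (r * b * S s))"
proof -
  have "S\<^sub>B b = tsum R (\<lambda>r s. tsum (\<Delta> r) (\<lambda>c d. s * S (S d) * S b * S c))"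
    by (simp add: transmuted_antipode_tsum ad_def tsum_clinear[OF antipode_linear] antipode_mult tsum_mult_left mult.assoc)
  also have "\<dots> = tsum R (\<lambda>x y. tsum R (\<lambda>c d. (y * d) * S (S c) * S b * S x))"
    by (rule tsum_coprod_id_R) (intro clin)
  also have "\<dots> = tsum R (\<lambda>x y. (y * drinfeld_inv) * S b * S x)"
    by (simp add: drinfeld_inv_def tsum_mult_left tsum_mult_right mult.assoc)
  also have "\<dots> = drinfeld_inv * tsum R (\<lambda>r s. S (r * b * S s))"
    by (simp add: drinfeld_inv_commute antipode_mult tsum_mult_left mult.assoc)
  finally show ?thesis .
qed

text \<open>The hexagon splits the \<open>R\<close> of the braided coproduct into two copies. One
  cancels the \<open>R\<close> in the closed form of \<open>S\<^sub>B\<close>; the other surrounds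
  \<open>S x * y\<close>, which collapses to the counit of \<open>b\<close>, and sums to
  \<open>drinfeld\<close>, cancelling the \<open>drinfeld_inv\<close> in front.\<close>

lemma transmuted_antipode_left: "transmuted_mult (tensor_map S\<^sub>B id (\<Delta>\<^sub>B b)) = \<epsilon> b *\<^sub>C 1"
proof -
  have 1: "tsum R (\<lambda>r s. S\<^sub>B (x * S s) * r \<rhd> y) = drinfeld_inv * tsum R (\<lambda>c d. S (S d) * S x * y * S c)" for x y
  proof -
    have "tsum R (\<lambda>r s. S\<^sub>B (x * S s) * r \<rhd> y) = tsum R (\<lambda>r s. tsum (\<Delta> r) (\<lambda>c d. S\<^sub>B (x * S s) * (c * y * S d)))"
      by (simp add: ad_def tsum_mult_left)
    also have "\<dots> = tsum R (\<lambda>a b. tsum R (\<lambda>c d. S\<^sub>B (x * S (b * d)) * (a * y * S c)))"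
      by (rule tsum_coprod_id_R) (intro clin clinear_comp[OF clinear_transmuted_antipode])
    also have "\<dots> = tsum R (\<lambda>a b. tsum R (\<lambda>c d. tsum R (\<lambda>r s.
        drinfeld_inv * (S (S (s * b)) * S (S d) * S x * (S r * a) * y * S c))))"
      by (simp add: transmuted_antipode_drinfeld antipode_mult tsum_mult_left tsum_mult_right mult.assoc)
    also have "\<dots> = tsum R (\<lambda>c d. tsum R (\<lambda>r s. tsum R (\<lambda>a b.
        drinfeld_inv * (S (S (s * b)) * S (S d) * S x * (S r * a) * y * S c))))"
      by (subst tsum_commute) (rule tsum_cong, rule tsum_commute)
    also have "\<dots> = tsum R (\<lambda>c d. drinfeld_inv * (S (S 1) * S (S d) * S x * 1 * y * S c))"
    proof (rule tsum_cong)
      fix c d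
      show "tsum R (\<lambda>r s. tsum R (\<lambda>a b. drinfeld_inv * (S (S (s * b)) * S (S d) * S x * (S r * a) * y * S c)))
        = drinfeld_inv * (S (S 1) * S (S d) * S x * 1 * y * S c)"
        by (rule tsum_R_inverse(1)[where f = "\<lambda>p q. drinfeld_inv * (S (S q) * S (S d) * S x * p * y * S c)"]) (intro clin)
    qed
    also have "\<dots> = drinfeld_inv * tsum R (\<lambda>c d. S (S d) * S x * y * S c)"
      by (simp add: antipode_one tsum_mult_left)
    finally show ?thesis .
  qed
  have drinfeld: "tsum R (\<lambda>c d. S (S d) * S c) = drinfeld"
  proof -
    have "tsum R (\<lambda>c d. S (S d) * S c) = tsum (tsum R (\<lambda>a b. S a \<otimes> S b)) (\<lambda>a b. S b * a)"
      by (subst tsum_tsum, intro clin, rule tsum_cong, rule tsum_pure[symmetric], intro clin)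
    then show ?thesis by (simp add: antipode_antipode_R drinfeld_def)
  qed
  have "transmuted_mult (tensor_map S\<^sub>B id (\<Delta>\<^sub>B b)) = tsum (\<Delta> b) (\<lambda>x y. tsum R (\<lambda>r s. S\<^sub>B (x * S s) * r \<rhd> y))"
    by (simp add: transmuted_coprod_tsum tsum_clinear[OF clinear_tensor_map[OF clinear_transmuted_antipode clinear_id]]
        tsum_clinear[OF clinear_transmuted_mult] clinear_transmuted_antipode clinear_id)
  also have "\<dots> = drinfeld_inv * tsum R (\<lambda>c d. tsum (\<Delta> b) (\<lambda>x y. S (S d) * (S x * y) * S c))"
    by (subst tsum_commute) (simp add: 1 tsum_mult_left mult.assoc)
  also have "\<dots> = drinfeld_inv * tsum R (\<lambda>c d. \<epsilon> b *\<^sub>C (S (S d) * S c))"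
    by (simp add: tsum_antipode_left flip: tsum_mult_left tsum_mult_right)
  also have "\<dots> = \<epsilon> b *\<^sub>C 1"
    by (simp add: drinfeld drinfeld_inv_left flip: tsum_scaleC)
  finally show ?thesis .
qed

lemma transmuted_antipode_act: "S\<^sub>B (h \<rhd> b) = h \<rhd> S\<^sub>B b"
proof -
  \<comment> \<open>This is \<open>ad_cancel\<close> under \<open>S\<close>: the trailing
    \<open>S s\<close> of the adjoint action is moved to the left at the price of a further action
    on \<open>b\<close>.\<close>
  have S: "S (r \<rhd> b) * S s = tsum (\<Delta> s) (\<lambda>x y. S y * S ((x * r) \<rhd> b))" for r s
  proof -
    have "S (r \<rhd> b) * S s = S (tsum (\<Delta> s) (\<lambda>x y. x \<rhd> r \<rhd> b * y))"
      by (simp only: ad_cancel[OF alg_hom_ident] antipode_mult)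
    then show ?thesis
      by (simp add: tsum_clinear[OF antipode_linear] antipode_mult ad_mult alg_hom_ident)
  qed
  note lin = clin clinear_ad alg_hom_ident
  have "h \<rhd> S\<^sub>B b = tsum (\<Delta> h) (\<lambda>a s. a * tsum R (\<lambda>r t. t * (S (r \<rhd> b) * S s)))"
    by (simp add: ad_def[of _ h] transmuted_antipode_tsum tsum_mult_left tsum_mult_right mult.assoc)
  also have "\<dots> = tsum (\<Delta> h) (\<lambda>a s. tsum (\<Delta> s) (\<lambda>x y. tsum R (\<lambda>r t. (a * t) * (S y * S ((x * r) \<rhd> b)))))"
    by (simp only: S tsum_mult_left tsum_commute[of R] mult.assoc)
  also have "\<dots> = tsum (\<Delta> h) (\<lambda>s y. tsum (\<Delta> s) (\<lambda>a x. tsum R (\<lambda>r t. (a * t) * (S y * S ((x * r) \<rhd> b)))))"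
    by (rule tsum_coassoc[symmetric]) (intro lin)
  \<comment> \<open>Quasi-cocommutativity exchanges \<open>a\<close> and \<open>x\<close> across
    \<open>R\<close>; now \<open>x\<close> stands next to \<open>S y\<close> and the antipode axiom
    applies.\<close>
  also have "\<dots> = tsum (\<Delta> h) (\<lambda>s y. tsum (\<Delta> s) (\<lambda>a x. tsum R (\<lambda>r t. (t * x) * (S y * S ((r * a) \<rhd> b)))))"
  proof (rule tsum_cong)
    fix s y
    show "tsum (\<Delta> s) (\<lambda>a x. tsum R (\<lambda>r t. (a * t) * (S y * S ((x * r) \<rhd> b))))
      = tsum (\<Delta> s) (\<lambda>a x. tsum R (\<lambda>r t. (t * x) * (S y * S ((r * a) \<rhd> b))))"
      by (rule tsum_coprod_op_R[where f = "\<lambda>p q. q * (S y * S (p \<rhd> b))"]) (intro lin)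
  qed
  also have "\<dots> = tsum (\<Delta> h) (\<lambda>a s. tsum (\<Delta> s) (\<lambda>x y. tsum R (\<lambda>r t. (t * x) * (S y * S ((r * a) \<rhd> b)))))"
    by (rule tsum_coassoc) (intro lin)
  also have "\<dots> = tsum R (\<lambda>r t. tsum (\<Delta> h) (\<lambda>a s. tsum (\<Delta> s) (\<lambda>x y. t * (x * S y) * S ((r * a) \<rhd> b))))"
    by (simp only: tsum_commute[of R] mult.assoc)
  also have "\<dots> = tsum R (\<lambda>r t. tsum (\<Delta> h) (\<lambda>a s. \<epsilon> s *\<^sub>C (t * S ((r * a) \<rhd> b))))"
    by (simp add: tsum_antipode_right flip: tsum_mult_left tsum_mult_right)
  also have "\<dots> = tsum R (\<lambda>r t. t * S ((r * h) \<rhd> b))"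
    by (rule tsum_cong, rule tsum_counit_right) (intro lin)
  also have "\<dots> = S\<^sub>B (h \<rhd> b)"
    by (simp add: transmuted_antipode_tsum ad_mult alg_hom_ident)
  finally show ?thesis ..
qed

lemma transmutation_braided_hopf_algebra:
  "braided_hopf_algebra \<Delta> \<epsilon> R (adjoint_act \<Delta> S) transmuted_mult transmuted_unit \<Delta>\<^sub>B \<epsilon> S\<^sub>B"
proof -
  have [simp]: "adjoint_act \<Delta> S = ad (\<lambda>x. x)" by (rule ext) (rule adjoint_act_eq)
  note lin = clinear_id clinear_transmuted_mult clinear_transmuted_unit counit_linear
    clinear_transmuted_coprod[OF clinear_ident] clinear_transmuted_antipode clinear_unitors clinear_tensor_assoc
  show ?thesis
  proof
    show "left_module (adjoint_act \<Delta> S)" by (simp add: left_module_ad)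
    show "left_module_hom (tensor_act \<Delta> (adjoint_act \<Delta> S) (adjoint_act \<Delta> S)) (adjoint_act \<Delta> S) transmuted_mult"
      by (simp add: left_module_hom_def lin transmuted_mult_act)
    show "left_module_hom (trivial_act \<epsilon>) (adjoint_act \<Delta> S) transmuted_unit"
    proof -
      have "transmuted_unit (\<epsilon> h * z) = h \<rhd> transmuted_unit z" for h z
        using clinear_ad_arg[OF clinear_ident, of "\<lambda>x. x" h]
        by (simp add: transmuted_unit_def clinear_iff ad_unit alg_hom_ident mult.commute)
      then show ?thesis by (simp add: left_module_hom_def trivial_act_def lin)
    qed
    show "left_module_hom (adjoint_act \<Delta> S) (tensor_act \<Delta> (adjoint_act \<Delta> S) (adjoint_act \<Delta> S)) \<Delta>\<^sub>B"
      by (simp add: left_module_hom_def lin transmuted_coprod_act)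
    show "left_module_hom (adjoint_act \<Delta> S) (trivial_act \<epsilon>) \<epsilon>"
      by (simp add: left_module_hom_def lin trivial_act_def counit_ad)
    show "left_module_hom (adjoint_act \<Delta> S) (adjoint_act \<Delta> S) S\<^sub>B"
      by (simp add: left_module_hom_def lin transmuted_antipode_act)
    show "transmuted_mult \<circ> tensor_map transmuted_mult id
        = transmuted_mult \<circ> tensor_map id transmuted_mult \<circ> (tensor_assoc :: ('h \<otimes> 'h) \<otimes> 'h \<Rightarrow> _)"
      (is "?l = ?r")
    proof (rule clinear_tensor_eqI)
      show c: "clinear ?l" "clinear ?r" by (intro clinear_o clinear_tensor_map lin)+
      fix t :: "'h \<otimes> 'h" and c
      have "(\<lambda>t. ?l (t \<otimes> c)) = (\<lambda>t. ?r (t \<otimes> c))"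
      proof (rule clinear_tensor_eqI)
        show "clinear (\<lambda>t. ?l (t \<otimes> c))" "clinear (\<lambda>t. ?r (t \<otimes> c))"
          by (rule clinear_comp[OF c(1)] clinear_comp[OF c(2)], intro clin)+
      qed (simp add: lin mult.assoc)
      then show "?l (t \<otimes> c) = ?r (t \<otimes> c)" by (rule fun_cong)
    qed
    show "transmuted_mult \<circ> tensor_map transmuted_unit id = (left_unitor :: complex \<otimes> 'h \<Rightarrow> _)"
      by (rule clinear_tensor_eqI)
        (intro clinear_o clinear_tensor_map lin, simp_all add: lin transmuted_unit_def)
    show "transmuted_mult \<circ> tensor_map id transmuted_unit = (right_unitor :: 'h \<otimes> complex \<Rightarrow> _)"
      by (rule clinear_tensor_eqI)
        (intro clinear_o clinear_tensor_map lin, simp_all add: lin transmuted_unit_def)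
    show "tensor_assoc \<circ> tensor_map \<Delta>\<^sub>B id \<circ> \<Delta>\<^sub>B = tensor_map id \<Delta>\<^sub>B \<circ> \<Delta>\<^sub>B"
      by (simp add: fun_eq_iff transmuted_coassoc)
    show "left_unitor \<circ> tensor_map \<epsilon> id \<circ> \<Delta>\<^sub>B = id"
      by (simp add: fun_eq_iff transmuted_counit_left)
    show "right_unitor \<circ> tensor_map id \<epsilon> \<circ> \<Delta>\<^sub>B = id"
      by (simp add: fun_eq_iff transmuted_counit_right)
    show "\<Delta>\<^sub>B \<circ> transmuted_mult = tensor_map transmuted_mult transmuted_mult
        \<circ> middle_map (braiding R (adjoint_act \<Delta> S) (adjoint_act \<Delta> S)) \<circ> tensor_map \<Delta>\<^sub>B \<Delta>\<^sub>B"
      by (simp add: transmuted_coprod_mult)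
    show "\<Delta>\<^sub>B (transmuted_unit 1) = transmuted_unit 1 \<otimes> transmuted_unit 1"
      by (simp add: transmuted_unit_def transmuted_coprod_unit)
    show "\<epsilon> \<circ> transmuted_mult = left_unitor \<circ> tensor_map \<epsilon> \<epsilon>"
      by (rule clinear_tensor_eqI)
        (intro clinear_o clinear_tensor_map lin, intro clinear_o clinear_tensor_map lin,
          simp add: lin counit_mult)
    show "\<epsilon> \<circ> transmuted_unit = id"
      using counit_linear by (simp add: fun_eq_iff transmuted_unit_def clinear_iff counit_one)
    show "transmuted_mult \<circ> tensor_map S\<^sub>B id \<circ> \<Delta>\<^sub>B = transmuted_unit \<circ> \<epsilon>"
      by (simp add: fun_eq_iff transmuted_antipode_left transmuted_unit_def)
    show "transmuted_mult \<circ> tensor_map id S\<^sub>B \<circ> \<Delta>\<^sub>B = transmuted_unit \<circ> \<epsilon>"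
      by (simp add: fun_eq_iff transmuted_antipode_right transmuted_unit_def)
  qed
qed

end

section \<open>The star structure\<close>

lemma tensor_map_add_antilinear:
  "antilinear f \<Longrightarrow> antilinear g \<Longrightarrow> tensor_map f g (x + y) = tensor_map f g x + tensor_map f g y"
  unfolding tensor_map_def by (simp add: tensor_lift_add balanced_tensor_map)

lemma clinear_bar_map: "clinear f \<Longrightarrow> clinear (bar_map f)"
  by (simp add: clinear_iff conjugate.map_sel flip: unbar_inject)

lemma balanced_Upsilon: "balanced (\<lambda>v w. bar w \<otimes> bar v)"
  by (simp add: balanced_def bar_simps pure_tensor_add_left pure_tensor_add_right
      pure_tensor_scaleC_left pure_tensor_scaleC_right)

lemma clinear_Upsilon: "clinear Upsilon"
proof -
  have "tensor_lift (\<lambda>v w. bar w \<otimes> bar v) (cnj c *\<^sub>C t) = c *\<^sub>C tensor_lift (\<lambda>v w. bar w \<otimes> bar v) t"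
    for c and t :: "'a \<otimes> 'b"
    by (rule tensor_lift_scaleC[OF balanced_Upsilon]) (simp add: bar_simps pure_tensor_scaleC_right)
  then show ?thesis
    by (simp add: clinear_iff Upsilon_def tensor_lift_add[OF balanced_Upsilon])
qed

lemma inv_Upsilon_pure: "inv Upsilon (bar w \<otimes> bar v) = bar (v \<otimes> w)"
  by (rule inv_f_eq[OF bij_is_inj[OF bij_Upsilon]])
    (simp add: Upsilon_def tensor_lift_pure[OF balanced_Upsilon])

lemma clinear_inv_Upsilon: "clinear (inv Upsilon)"
  by (rule clinear_inv[OF clinear_Upsilon bij_Upsilon])

lemma bilin_swap: "bilin (\<lambda>a b. b \<otimes> a)"
  by (intro clin)

lemma bar_tsum: "bar (tsum t f) = tsum t (\<lambda>a b. bar (f a b))"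
  by (rule tsum_additive) (simp add: bar_simps)

context star_hopf_algebra
begin

lemma star_add: "star (x + y) = star x + star y"
  and star_scaleC: "star (c *\<^sub>C x) = cnj c *\<^sub>C star x"
  using star_antilinear by (auto simp: antilinear_def)

lemma star_one: "star 1 = 1"
  using star_mult[of "star 1" 1] by (simp add: star_star)

lemma star_tsum: "star (tsum t f) = tsum t (\<lambda>a b. star (f a b))"
  by (rule tsum_additive) (rule star_add)

abbreviation star2 where "star2 \<equiv> tensor_map star star"

lemma star2_pure: "star2 (a \<otimes> b) = star a \<otimes> star b"
  by (simp add: star_antilinear)

lemma star2_tsum: "star2 (tsum t f) = tsum t (\<lambda>a b. star2 (f a b))"
  by (rule tsum_additive) (rule tensor_map_add_antilinear[OF star_antilinear star_antilinear])

lemma star2_eq: "star2 t = tsum t (\<lambda>a b. star a \<otimes> star b)"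
  by (rule tensor_map_tsum_antilinear[OF star_antilinear star_antilinear])

text \<open>The star reverses products in both legs without exchanging the legs, so it is again an
  antiautomorphism of \<open>H \<otimes> H\<close>.\<close>

lemma star2_mult: "star2 (s * t) = star2 t * star2 s"
proof -
  have "star2 (s * t) = tsum s (\<lambda>a b. tsum t (\<lambda>c d. (star c \<otimes> star d) * (star a \<otimes> star b)))"
    by (subst tensor_times) (simp add: star2_tsum star2_pure star_mult times_tensor_pure)
  then show ?thesis
    by (simp only: star2_eq[of s] star2_eq[of t] tsum_mult_left) (simp only: tsum_mult_right)
qed

lemma star2_star2: "star2 (star2 t) = t"
  by (simp add: star2_eq[of t] star2_tsum star2_pure star_star)

lemma tsum_coprod_star:
  "bilin f \<Longrightarrow> tsum (\<Delta> (star h)) f = tsum (\<Delta> h) (\<lambda>a b. f (star a) (star b))"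
  by (simp add: coprod_star star2_eq tsum_tsum tsum_pure)

text \<open>The conjugate of \<open>\<epsilon> (star h)\<close> satisfies the left counit law as
  well, and a left and a right counit agree.\<close>

lemma counit_star: "\<epsilon> (star h) = cnj (\<epsilon> h)"
proof -
  have "clinear (\<lambda>h. cnj (\<epsilon> (star h)))"
    using counit_linear by (simp add: clinear_iff star_add star_scaleC)
  note lin = this
  have "star h = tsum (\<Delta> (star h)) (\<lambda>a b. \<epsilon> a *\<^sub>C b)"
    by (simp add: tsum_counit_left clinear_ident)
  also have "\<dots> = tsum (\<Delta> h) (\<lambda>a b. \<epsilon> (star a) *\<^sub>C star b)"
    by (rule tsum_coprod_star) (intro clin)
  finally have "star (star h) = tsum (\<Delta> h) (\<lambda>a b. cnj (\<epsilon> (star a)) *\<^sub>C b)"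
    by (simp add: star_tsum star_scaleC star_star)
  then have "\<epsilon> h = \<epsilon> (tsum (\<Delta> h) (\<lambda>a b. cnj (\<epsilon> (star a)) *\<^sub>C b))"
    by (simp add: star_star)
  also have "\<dots> = tsum (\<Delta> h) (\<lambda>a b. \<epsilon> b *\<^sub>C cnj (\<epsilon> (star a)))"
    using counit_linear by (simp add: tsum_clinear[OF counit_linear] clinear_iff mult.commute)
  also have "\<dots> = cnj (\<epsilon> (star h))"
    by (rule tsum_counit_right[OF lin])
  finally show ?thesis by simp
qed

text \<open>\<open>star \<circ> S \<circ> star\<close> is an antipode for the opposite coproduct, hence inverse to \<open>S\<close>.\<close>

lemma antipode_star: "S (star (S (star h))) = h"
proof -
  have inv: "tsum (\<Delta> h) (\<lambda>a b. S (star (S (star a))) * S b) = \<epsilon> h *\<^sub>C 1" for h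
  proof -
    have "tsum (\<Delta> h) (\<lambda>a b. S (star a) * star b) = tsum (\<Delta> (star h)) (\<lambda>a b. S a * b)"
      by (rule tsum_coprod_star[symmetric]) (intro clin)
    then have "tsum (\<Delta> h) (\<lambda>a b. S (star a) * star b) = cnj (\<epsilon> h) *\<^sub>C 1"
      by (simp add: tsum_antipode_left counit_star)
    from arg_cong[OF this, of "\<lambda>x. S (star x)"] show ?thesis
      using antipode_linear
      by (simp add: star_tsum star_mult star_star star_scaleC star_one antipode_mult antipode_one
          tsum_clinear[OF antipode_linear] clinear_iff)
  qed
  have lin: "clinear (\<lambda>h. S (star (S (star h))))"
    using antipode_linear by (simp add: clinear_iff star_add star_scaleC)
  have "S (star (S (star h))) = tsum (\<Delta> h) (\<lambda>a b. (\<epsilon> a *\<^sub>C 1) * b)"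
    by (rule convolution_cancel_right[where \<phi> = S and \<psi> = "\<lambda>x. x" and f = "\<lambda>h. S (star (S (star h)))"])
      (rule lin antipode_linear clinear_ident tsum_antipode_left inv)+
  then show ?thesis by (simp add: tsum_counit_left clinear_ident)
qed

lemma antipode_star': "S (star (S h)) = star h"
  using antipode_star[of "star h"] by (simp add: star_star)

lemma inv_antipode_star: "inv S (star h) = star (S h)"
proof (rule inv_f_eq)
  show "inj S" by (rule injI) (metis antipode_star' star_star)
qed (rule antipode_star')

lemma conjugate_act_bar: "conjugate_act S star act h (bar v) = bar (act (star (S h)) v)"
  by (simp add: conjugate_act_def inv_antipode_star)

lemma left_module_conjugate:
  assumes "left_module act"
  shows "left_module (conjugate_act S star act)"
proof -
  have "conjugate_act S star act h x = bar (act (star (S h)) (unbar x))" for h x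
    by (simp add: conjugate_act_def inv_antipode_star)
  then show ?thesis
    using assms antipode_linear
    by (auto simp: left_module_def clinear_iff star_add star_scaleC star_one star_mult antipode_one
        antipode_mult bar_simps)
qed

text \<open>Star and antipode each reverse products, but only the antipode flips the coproduct. This
  flip compensates for the reversed order of the factors around \<open>b\<close>, so the adjoint
  form reappears.\<close>

lemma star_ad: "star (ad (\<lambda>x. x) h b) = ad (\<lambda>x. x) (star (S h)) (star b)"
proof -
  have "\<Delta> (star (S h)) = tsum (\<Delta> h) (\<lambda>x y. star (S y) \<otimes> star (S x))"
    by (simp add: coprod_star coprod_antipode star2_tsum star2_pure)
  moreover have "bilin (\<lambda>x y. x * star b * S y)"
    by (intro clin)
  ultimately show ?thesis
    by (simp add: ad_def tsum_tsum tsum_pure star_tsum star_mult antipode_star' mult.assoc)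
qed

end

context quasitriangular_star_hopf_algebra
begin

lemma antireal_braiding:
  fixes actX :: "'h \<Rightarrow> 'x::complex_vector \<Rightarrow> 'x" and actY :: "'h \<Rightarrow> 'y::complex_vector \<Rightarrow> 'y"
  assumes real: "tensor_map star star R = inverse_elt R"
    and X: "left_module actX" and Y: "left_module actY"
  shows "antireal_braiding_at S star R actX actY"
proof -
  let ?\<Psi> = "braiding R actX actY"
  let ?cX = "conjugate_act S star actX" and ?cY = "conjugate_act S star actY"
  \<comment> \<open>The candidate for the inverse braiding: it acts through
    \<open>(S \<otimes> id) R\<close>, the inverse of \<open>R\<close>.\<close>
  define N where "N t = tsum t (\<lambda>y x. tsum R (\<lambda>r s. actX (S r) x \<otimes> actY s y))" for t
  have bil: "bilin (\<lambda>y x. tsum R (\<lambda>r s. actX (S r) x \<otimes> actY s y))"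
    by (intro clin left_moduleD(2)[OF X] left_moduleD(2)[OF Y])
  have N: "clinear N" "N (y \<otimes> x) = tsum R (\<lambda>r s. actX (S r) x \<otimes> actY s y)" for x y
    unfolding N_def by (rule clinear_tsum_arg[OF bil], rule tsum_pure[OF bil])
  note \<Psi> = clinear_braiding[OF X Y] braiding_pure[OF X Y]
  have "?\<Psi> \<circ> N = id"
  proof (rule clinear_tensor_eqI)
    fix y x
    have "?\<Psi> (N (y \<otimes> x)) = tsum R (\<lambda>r s. tsum R (\<lambda>r' s'. actY (s' * s) y \<otimes> actX (r' * S r) x))"
      by (simp add: N(2) tsum_clinear[OF \<Psi>(1)] \<Psi>(2) left_moduleD(4)[OF X] left_moduleD(4)[OF Y])
    also have "\<dots> = tsum R (\<lambda>r' s'. tsum R (\<lambda>r s. actY (s' * s) y \<otimes> actX (r' * S r) x))"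
      by (rule tsum_commute)
    also have "\<dots> = actY 1 y \<otimes> actX 1 x"
      by (rule tsum_R_inverse(2)[where f = "\<lambda>u v. actY v y \<otimes> actX u x"])
        (intro clin left_moduleD(1)[OF X] left_moduleD(1)[OF Y])
    finally show "(?\<Psi> \<circ> N) (y \<otimes> x) = id (y \<otimes> x)"
      by (simp add: left_moduleD(3)[OF X] left_moduleD(3)[OF Y])
  qed (intro clinear_o \<Psi>(1) N(1) clinear_id)+
  moreover have "N \<circ> ?\<Psi> = id"
  proof (rule clinear_tensor_eqI)
    fix x y
    have "N (?\<Psi> (x \<otimes> y)) = tsum R (\<lambda>r s. tsum R (\<lambda>r' s'. actX (S r' * r) x \<otimes> actY (s' * s) y))"
      by (simp add: N(2) tsum_clinear[OF N(1)] \<Psi>(2) left_moduleD(4)[OF X] left_moduleD(4)[OF Y])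
    also have "\<dots> = tsum R (\<lambda>r' s'. tsum R (\<lambda>r s. actX (S r' * r) x \<otimes> actY (s' * s) y))"
      by (rule tsum_commute)
    also have "\<dots> = actX 1 x \<otimes> actY 1 y"
      by (rule tsum_R_inverse(1)[where f = "\<lambda>u v. actX u x \<otimes> actY v y"])
        (intro clin left_moduleD(1)[OF X] left_moduleD(1)[OF Y])
    finally show "(N \<circ> ?\<Psi>) (x \<otimes> y) = id (x \<otimes> y)"
      by (simp add: left_moduleD(3)[OF X] left_moduleD(3)[OF Y])
  qed (intro clinear_o \<Psi>(1) N(1) clinear_id)+
  ultimately have inv: "inv ?\<Psi> = N" by (rule inv_unique_comp)
  \<comment> \<open>Conjugate modules are acted on through \<open>star (S h)\<close>, so their
    braiding involves this element. Since \<open>S \<otimes> S\<close> fixes \<open>R\<close> and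
    the star inverts it, the element is the inverse of \<open>R\<close>, which is what
    \<open>N\<close> acts by.\<close>
  have "tsum R (\<lambda>r s. star (S r) \<otimes> star (S s)) = star2 (tsum R (\<lambda>r s. S r \<otimes> S s))"
    by (simp add: star2_tsum star2_pure)
  also have "\<dots> = tsum R (\<lambda>r s. S r \<otimes> s)"
    by (simp add: antipode_antipode_R real antipode_R)
  finally have RR: "tsum R (\<lambda>r s. star (S r) \<otimes> star (S s)) = tsum R (\<lambda>r s. S r \<otimes> s)" .
  have SR: "tsum R (\<lambda>r s. f (star (S r)) (star (S s))) = tsum R (\<lambda>r s. f (S r) s)" if "bilin f"
    for f :: "'h \<Rightarrow> 'h \<Rightarrow> _"
    using arg_cong[OF RR, of "\<lambda>t. tsum t f"] by (simp add: tsum_tsum tsum_pure that)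
  note c = left_module_conjugate[OF X] left_module_conjugate[OF Y]
  have "inv Upsilon \<circ> braiding R ?cX ?cY = bar_map N \<circ> inv Upsilon"
  proof (rule clinear_tensor_eqI)
    show "clinear (inv Upsilon \<circ> braiding R ?cX ?cY)" "clinear (bar_map N \<circ> inv Upsilon)"
      by (intro clinear_o clinear_inv_Upsilon clinear_braiding c clinear_bar_map N(1))+
    fix a :: "'x conjugate" and b :: "'y conjugate"
    obtain x y where [simp]: "a = bar x" "b = bar y" by (metis conjugate.exhaust)
    have "tsum R (\<lambda>r s. actX (star (S r)) x \<otimes> actY (star (S s)) y) = tsum R (\<lambda>r s. actX (S r) x \<otimes> actY s y)"
      by (rule SR) (intro clin left_moduleD(1)[OF X] left_moduleD(1)[OF Y])
    then show "(inv Upsilon \<circ> braiding R ?cX ?cY) (a \<otimes> b) = (bar_map N \<circ> inv Upsilon) (a \<otimes> b)"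
      by (simp add: braiding_pure[OF c] conjugate_act_bar tsum_clinear[OF clinear_inv_Upsilon]
          inv_Upsilon_pure N(2) flip: bar_tsum)
  qed
  then show ?thesis by (simp add: antireal_braiding_at_def inv)
qed

lemma transmuted_coprod_star:
  assumes real: "tensor_map star star R = inverse_elt R"
  shows "\<Delta>\<^sub>B (star b) = tsum (\<Delta>\<^sub>B b) (\<lambda>x y. braiding R (ad (\<lambda>x. x)) (ad (\<lambda>x. x)) (star y \<otimes> star x))"
proof (rule Phi_eqI)
  have "star2 q = tensor_swap (star2 R)"
    by (simp add: Q_def star2_tsum star2_pure star2_eq[of R]
        tsum_clinear[OF alg_hom_clinear[OF alg_hom_swap]] tensor_swap_tsum tsum_tsum tsum_pure bilin_swap)
  also have "\<dots> = q'"
    unfolding real Q_inv_def antipode_R[symmetric]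
    by (simp add: tsum_clinear[OF alg_hom_clinear[OF alg_hom_swap]]) (simp add: tensor_swap_tsum tsum_pure bilin_swap)
  finally have q: "star2 q = q'" .
  then have q': "star2 q' = q" using star2_star2[of q] by simp
  have "\<Phi> (\<Delta>\<^sub>B (star b)) = star2 (\<Phi> (\<Delta>\<^sub>B b))"
    by (simp add: Phi_transmuted_coprod coprod_star)
  also have "\<dots> = star2 (tsum (\<Delta>\<^sub>B b) (\<lambda>x y. \<Phi> (x \<otimes> y)))"
    by (simp flip: Phi_tsum)
  also have "\<dots> = tsum (\<Delta>\<^sub>B b) (\<lambda>x y. q * (1 \<otimes> star y) * q' * (star x \<otimes> 1))"
    by (simp add: star2_tsum Phi_ident_pure star2_mult star2_pure q q' star_one mult.assoc)
  also have "\<dots> = \<Phi> (tsum (\<Delta>\<^sub>B b) (\<lambda>x y. braiding R (ad (\<lambda>x. x)) (ad (\<lambda>x. x)) (star y \<otimes> star x)))"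
    by (simp add: Phi_tsum braiding_pure[OF left_module_ad left_module_ad] Phi_braiding)
  finally show "\<Phi> (\<Delta>\<^sub>B (star b)) = \<dots>" .
qed

lemma transmutation_braided_star_hopf_algebra:
  assumes real: "tensor_map star star R = inverse_elt R"
  shows "braided_star_hopf_algebra \<Delta> \<epsilon> S star R (adjoint_act \<Delta> S) transmuted_mult transmuted_unit
    \<Delta>\<^sub>B \<epsilon> S\<^sub>B (\<lambda>b. bar (star b))"
proof -
  have [simp]: "adjoint_act \<Delta> S = ad (\<lambda>x. x)" by (rule ext) (rule adjoint_act_eq)
  have lin: "clinear (\<lambda>b. bar (star b))"
    by (simp add: clinear_iff star_add star_scaleC bar_simps)
  interpret B: braided_hopf_algebra \<Delta> \<epsilon> R "adjoint_act \<Delta> S" transmuted_mult transmuted_unit \<Delta>\<^sub>B \<epsilon> S\<^sub>B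
    by (rule transmutation_braided_hopf_algebra)
  show ?thesis
  proof
    show "left_module_hom (adjoint_act \<Delta> S) (conjugate_act S star (adjoint_act \<Delta> S)) (\<lambda>b. bar (star b))"
      by (simp add: left_module_hom_def lin conjugate_act_bar star_ad)
    show "bar_map (\<lambda>b. bar (star b)) \<circ> (\<lambda>b. bar (star b)) = bb"
      by (simp add: fun_eq_iff bb_def star_star)
    show "bar_map transmuted_mult \<circ> inv Upsilon \<circ> tensor_map (\<lambda>b. bar (star b)) (\<lambda>b. bar (star b))
        = (\<lambda>b. bar (star b)) \<circ> transmuted_mult" (is "?l = ?r")
    proof (rule clinear_tensor_eqI)
      show "clinear ?l" "clinear ?r"
        by (intro clinear_o clinear_bar_map clinear_inv_Upsilon clinear_tensor_map
            clinear_transmuted_mult lin)+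
      show "?l (a \<otimes> b) = ?r (a \<otimes> b)" for a b
        by (simp add: lin inv_Upsilon_pure star_mult)
    qed
    show "bar_map transmuted_unit \<circ> star_complex = (\<lambda>b. bar (star b)) \<circ> transmuted_unit"
      by (simp add: fun_eq_iff star_complex_def transmuted_unit_def star_scaleC star_one)
    show "bar_map \<Delta>\<^sub>B \<circ> (\<lambda>b. bar (star b)) = bar_map (braiding R (adjoint_act \<Delta> S) (adjoint_act \<Delta> S))
        \<circ> inv Upsilon \<circ> tensor_map (\<lambda>b. bar (star b)) (\<lambda>b. bar (star b)) \<circ> \<Delta>\<^sub>B"
      by (simp add: fun_eq_iff transmuted_coprod_star[OF real] bar_tsum tensor_map_tsum[OF lin lin]
          tsum_clinear[OF clinear_inv_Upsilon] inv_Upsilon_pure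
          tsum_clinear[OF clinear_bar_map[OF clinear_braiding[OF left_module_ad left_module_ad]]])
  qed
qed

end

text \<open>A braided star-Hopf algebra presupposes an antireal braiding, which
  \<open>braided_star_hopf_algebra\<close> does not contain; it is therefore the first conjunct, for
  modules over arbitrary carrier types.\<close>

theorem theorem5p6:
  fixes \<Delta> :: "'h::complex_algebra_1 \<Rightarrow> 'h \<otimes> 'h"
    and \<epsilon> :: "'h \<Rightarrow> complex"
    and S :: "'h \<Rightarrow> 'h"
    and star :: "'h \<Rightarrow> 'h"
    and R :: "'h \<otimes> 'h"
  assumes "quasitriangular_star_hopf_algebra \<Delta> \<epsilon> S star R"
    and "tensor_map star star R = inverse_elt R"
  shows "(\<forall>(actX :: 'h \<Rightarrow> 'x::complex_vector \<Rightarrow> 'x) (actY :: 'h \<Rightarrow> 'y::complex_vector \<Rightarrow> 'y).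
            left_module actX \<longrightarrow> left_module actY \<longrightarrow> antireal_braiding_at S star R actX actY) \<and>
         braided_star_hopf_algebra \<Delta> \<epsilon> S star R
           (adjoint_act \<Delta> S) transmuted_mult transmuted_unit
           (transmuted_coprod \<Delta> S R) \<epsilon> (transmuted_antipode \<Delta> S R)
           (\<lambda>b. bar (star b))"
proof -
  interpret quasitriangular_star_hopf_algebra \<Delta> \<epsilon> S star R by (rule assms(1))
  show ?thesis
    using antireal_braiding[OF assms(2)] transmutation_braided_star_hopf_algebra[OF assms(2)] by blast
qed

end
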